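(* There is a universal constant $C>0$ such that the following holds for all integers $1\le d_1\le d_2$, all even integers $n\ge4$, and all $\alpha\in(0,e^{-1})$, $\beta\in(0,1-\alpha)$. Let $\mathcal{P}^{(d_1,d_2)}_{\rm Multi}$ be the set of probability distributions $p_{YZ}$ on $\{1,\dots,d_1\}\times\{1,\dots,d_2\}$, with marginals $p_Y,p_Z$. Let $\mathcal{P}_0=\{p_{YZ}\in\mathcal{P}^{(d_1,d_2)}_{\rm Multi}:p_{YZ}=p_Yp_Z\}$ and $\mathcal{P}_1=\{p_{YZ}\in\mathcal{P}^{(d_1,d_2)}_{\rm Multi}:\|p_{YZ}-p_Yp_Z\|_1\ge\epsilon_n\}$, where $$\epsilon_n\ \ge\ \frac{C}{\beta^{3/4}}\sqrt{\log\Big(\frac1\alpha\Big)}\cdot\max\left\{\frac{d_1^{1/4}d_2^{1/2}}{n^{3/4}},\ \frac{d_1^{1/4}d_2^{1/4}}{n^{1/2}}\right\}.$$ Then the sample-splitting permutation test based on $U^{{\rm split}*}$ satisfies $$\sup_{P\in\mathcal{P}_0}\mathbb{P}_P(U^{{\rm split}*}>c_{1-\alpha})\le\alpha\quad\text{and}\quad\sup_{P\in\mathcal{P}_1}\mathbb{P}_P(U^{{\rm split}*}\le c_{1-\alpha})\le\beta .$$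
   Context: Data: $(Y_1,Z_1),\dots,(Y_{3n},Z_{3n})$ i.i.d. from $p_{YZ}$. Put $\widetilde Y_i:=(Y_i,Z_i)$ and $\widetilde Z_i:=(Y_{n+i},Z_{2n+i})$ for $i=1,\dots,n$ (samples from $p_{YZ}$ and from $p_Yp_Z$, respectively). Weights: $m_1:=\min\{n/2,d_1\}$, $m_2:=\min\{n/2,d_2\}$ and $$w_{k_1,k_2}:=\Big[\frac1{2d_1}+\frac1{2m_1}\sum_{i=1}^{m_1}\mathbb{1}(Y_{3n/2+i}=k_1)\Big]\times\Big[\frac1{2d_2}+\frac1{2m_2}\sum_{j=1}^{m_2}\mathbb{1}(Z_{5n/2+j}=k_2)\Big].$$ Statistic: $g^*_w\{(x_1,y_1),(x_2,y_2)\}:=\sum_{k_1=1}^{d_1}\sum_{k_2=1}^{d_2}w_{k_1,k_2}^{-1}\mathbb{1}(x_1=k_1,y_1=k_2)\mathbb{1}(x_2=k_1,y_2=k_2)$, $h(u_1,u_2;v_1,v_2):=g^*_w(u_1,u_2)+g^*_w(v_1,v_2)-g^*_w(u_1,v_2)-g^*_w(u_2,v_1)$, and $U^{{\rm split}*}$ is the average of $h(\widetilde Y_{i_1},\widetilde Y_{i_2};\widetilde Z_{j_1},\widetilde Z_{j_2})$ over all ordered pairs $i_1\ne i_2$ and $j_1\ne j_2$ in $\{1,\dots,n/2\}$ (only the first halves of the two constructed samples are used; they are independent of the weights). Critical value: $c_{1-\alpha}$ is the $1-\alpha$ quantile, $\inf\{t:F(t)\ge1-\alpha\}$, of the distribution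 function $F$ of the statistic when the $n$ pooled observations $(\widetilde Y_1,\dots,\widetilde Y_{n/2},\widetilde Z_1,\dots,\widetilde Z_{n/2})$ are permuted by a uniformly random permutation of the $n$ positions (first $n/2$ positions forming the first sample, last $n/2$ the second), with the weights held fixed. *)

theory Defs
  imports "HOL-Probability.Probability" "HOL-Combinatorics.Permutations"
begin

definition P_Multi :: "nat \<Rightarrow> nat \<Rightarrow> (nat \<times> nat) pmf set" where
  "P_Multi d1 d2 = {p. set_pmf p \<subseteq> {1..d1} \<times> {1..d2}}"

definition prod_of_marginals :: "(nat \<times> nat) pmf \<Rightarrow> (nat \<times> nat) pmf" where
  "prod_of_marginals p = pair_pmf (map_pmf fst p) (map_pmf snd p)"

definition l1_dist :: "nat \<Rightarrow> nat \<Rightarrow> (nat \<times> nat) pmf \<Rightarrow> (nat \<times> nat) pmf \<Rightarrow> real" where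
  "l1_dist d1 d2 p q = (\<Sum>k1=1..d1. \<Sum>k2=1..d2. \<bar>pmf p (k1, k2) - pmf q (k1, k2)\<bar>)"

definition P_null :: "nat \<Rightarrow> nat \<Rightarrow> (nat \<times> nat) pmf set" where
  "P_null d1 d2 = {p \<in> P_Multi d1 d2. p = prod_of_marginals p}"

definition P_alt :: "nat \<Rightarrow> nat \<Rightarrow> real \<Rightarrow> (nat \<times> nat) pmf set" where
  "P_alt d1 d2 \<epsilon> = {p \<in> P_Multi d1 d2. l1_dist d1 d2 p (prod_of_marginals p) \<ge> \<epsilon>}"

text \<open>
  A data set is a function \<open>x\<close> with \<open>x i = (Y\<^sub>i, Z\<^sub>i)\<close> for \<open>i \<in> {1..3n}\<close>. Its law under \<open>p\<close> is the
  \<open>3n\<close>-fold product of \<open>p\<close>; the value outside \<open>{1..3n}\<close> is a dummy that no statistic below reads.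
\<close>

definition data_pmf :: "nat \<Rightarrow> (nat \<times> nat) pmf \<Rightarrow> (nat \<Rightarrow> nat \<times> nat) pmf" where
  "data_pmf n p = Pi_pmf {1..3 * n} (0, 0) (\<lambda>_. p)"

definition Y_tilde :: "(nat \<Rightarrow> nat \<times> nat) \<Rightarrow> nat \<Rightarrow> nat \<times> nat" where
  "Y_tilde x i = (fst (x i), snd (x i))"

definition Z_tilde :: "nat \<Rightarrow> (nat \<Rightarrow> nat \<times> nat) \<Rightarrow> nat \<Rightarrow> nat \<times> nat" where
  "Z_tilde n x i = (fst (x (n + i)), snd (x (2 * n + i)))"

text \<open>
  Throughout, \<open>n\<close> is meant to be even, so that the \<open>div\<close> in \<open>n/2\<close>, \<open>3n/2\<close> and \<open>5n/2\<close> is exact.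
\<close>

definition weight ::
    "nat \<Rightarrow> nat \<Rightarrow> nat \<Rightarrow> (nat \<Rightarrow> nat \<times> nat) \<Rightarrow> nat \<Rightarrow> nat \<Rightarrow> real" where
  "weight n d1 d2 x k1 k2 =
     (let m1 = min (n div 2) d1; m2 = min (n div 2) d2 in
       (1 / (2 * real d1) +
          1 / (2 * real m1) * (\<Sum>i=1..m1. of_bool (fst (x (3 * n div 2 + i)) = k1))) *
       (1 / (2 * real d2) +
          1 / (2 * real m2) * (\<Sum>j=1..m2. of_bool (snd (x (5 * n div 2 + j)) = k2))))"

definition g_star ::
    "nat \<Rightarrow> nat \<Rightarrow> (nat \<Rightarrow> nat \<Rightarrow> real) \<Rightarrow> nat \<times> nat \<Rightarrow> nat \<times> nat \<Rightarrow> real" where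
  "g_star d1 d2 w u v =
     (\<Sum>k1=1..d1. \<Sum>k2=1..d2. inverse (w k1 k2) *
        of_bool (fst u = k1 \<and> snd u = k2) * of_bool (fst v = k1 \<and> snd v = k2))"

definition h_kernel :: "('a \<Rightarrow> 'a \<Rightarrow> real) \<Rightarrow> 'a \<Rightarrow> 'a \<Rightarrow> 'a \<Rightarrow> 'a \<Rightarrow> real" where
  "h_kernel g u1 u2 v1 v2 = g u1 u2 + g v1 v2 - g u1 v2 - g u2 v1"

definition ordered_pairs :: "nat \<Rightarrow> (nat \<times> nat) set" where
  "ordered_pairs m = {(i1, i2). i1 \<in> {1..m} \<and> i2 \<in> {1..m} \<and> i1 \<noteq> i2}"

definition U_stat :: "('a \<Rightarrow> 'a \<Rightarrow> real) \<Rightarrow> nat \<Rightarrow> (nat \<Rightarrow> 'a) \<Rightarrow> (nat \<Rightarrow> 'a) \<Rightarrow> real" where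
  "U_stat g m u v =
     (\<Sum>(i1, i2)\<in>ordered_pairs m. \<Sum>(j1, j2)\<in>ordered_pairs m.
        h_kernel g (u i1) (u i2) (v j1) (v j2)) / (real (card (ordered_pairs m)))\<^sup>2"

definition U_split :: "nat \<Rightarrow> nat \<Rightarrow> nat \<Rightarrow> (nat \<Rightarrow> nat \<times> nat) \<Rightarrow> real" where
  "U_split n d1 d2 x =
     U_stat (g_star d1 d2 (weight n d1 d2 x)) (n div 2) (Y_tilde x) (Z_tilde n x)"

definition pooled :: "nat \<Rightarrow> (nat \<Rightarrow> nat \<times> nat) \<Rightarrow> nat \<Rightarrow> nat \<times> nat" where
  "pooled n x i = (if i \<le> n div 2 then Y_tilde x i else Z_tilde n x (i - n div 2))"

definition U_perm :: "nat \<Rightarrow> nat \<Rightarrow> nat \<Rightarrow> (nat \<Rightarrow> nat \<times> nat) \<Rightarrow> (nat \<Rightarrow> nat) \<Rightarrow> real" where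
  "U_perm n d1 d2 x \<pi> =
     U_stat (g_star d1 d2 (weight n d1 d2 x)) (n div 2)
       (\<lambda>i. pooled n x (\<pi> i)) (\<lambda>j. pooled n x (\<pi> (n div 2 + j)))"

text \<open>
  The data \<open>x\<close>, and hence the weights, are held fixed; only \<open>\<pi>\<close> is random.
\<close>

definition perm_cdf :: "nat \<Rightarrow> nat \<Rightarrow> nat \<Rightarrow> (nat \<Rightarrow> nat \<times> nat) \<Rightarrow> real \<Rightarrow> real" where
  "perm_cdf n d1 d2 x =
     cdf (measure_pmf (map_pmf (U_perm n d1 d2 x) (pmf_of_set {\<pi>. \<pi> permutes {1..n}})))"

definition crit_value :: "nat \<Rightarrow> nat \<Rightarrow> nat \<Rightarrow> real \<Rightarrow> (nat \<Rightarrow> nat \<times> nat) \<Rightarrow> real" where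
  "crit_value n d1 d2 \<alpha> x = Inf {t. perm_cdf n d1 d2 x t \<ge> 1 - \<alpha>}"

end

theory Submission imports Defs begin

text \<open>
  Conditionally on the weights, the pooled observations are independent, and under the null they are
  exchangeable; this gives the level.

  For the power, keep the weights \<open>w\<close> fixed and let \<open>p\<close> be the law of the data, \<open>q\<close> the product of
  its marginals, \<open>L = ln (1 / \<alpha>)\<close> and \<open>m = n / 2\<close>. The statistic has mean
  \<open>S = \<Sum> (p - q)\<^sup>2 / w\<close>, which is at least \<open>\<epsilon>\<^sup>2\<close> by the Cauchy-Schwarz inequality, as the
  weights sum to 1. The Efron-Stein inequality bounds its variance in terms of \<open>S\<close> and of
  \<open>\<Psi> = \<Sum> (p\<^sup>2 + q\<^sup>2) / w\<^sup>2\<close>. A uniform permutation stays uniform when \<open>i\<close> and \<open>m + i\<close> are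
  swapped independently with probability 1/2; these swaps turn the permuted statistic, up to a small
  remainder, into a Rademacher chaos of order two, whose exponential moments bound the critical value
  by a multiple of \<open>L G / m\<^sup>2\<close>, where \<open>G\<^sup>2\<close> is the sum of the squared kernel values, of expectation at
  most \<open>4 m\<^sup>2 \<Psi>\<close>. So the type II error is controlled by \<open>\<Psi> / (m\<^sup>2 S\<^sup>2)\<close>, and this ratio is averaged
  over the weights using \<open>E (1 / (N + 1)) \<le> 1 / ((k + 1) p)\<close> for a binomial \<open>N\<close> with parameters
  \<open>k\<close> and \<open>p\<close>.
\<close>

section \<open>Product distributions with finite support\<close>

text \<open>All laws here have finite support, so integrability is automatic and Fubini is an
  exchange of finite sums. The chaos has exponential tails at scale \<open>G\<close>, so the
  critical value grows only linearly in \<open>L\<close>; as \<open>S\<close> is compared with it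
  and \<open>S \<ge> \<epsilon>\<^sup>2\<close>, the separation pays \<open>sqrt L\<close>. The
  obstacle is that the weights estimate only the marginals, so \<open>p\<^sup>2 / w\<^sup>2\<close>
  cannot be averaged over them. It is split into a part in
  \<open>(p - q)\<^sup>2 / w\<^sup>2\<close>, charged to \<open>S\<close> through the deterministic
  bound \<open>1 / w \<le> 4 * d1 * d2\<close>, and a part in \<open>q\<^sup>2 / w\<^sup>2\<close>,
  which factorises because \<open>q\<close> and \<open>w\<close> are both products over the two
  coordinates. Each factor has mean at most \<open>4 * d\<^sup>2 / (min m d + 1)\<close>: of order
  \<open>d\<close> if \<open>d \<le> m\<close> and \<open>d\<^sup>2 / m\<close> otherwise. Since an
  l1 distance never exceeds 2, the separation condition excludes \<open>d1 > m\<close>; the two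
  remaining cases, \<open>d2 \<le> m\<close> and \<open>d2 > m\<close>, account for the two terms of
  the maximum.\<close>

abbreviation expct :: "'a pmf \<Rightarrow> ('a \<Rightarrow> real) \<Rightarrow> real" where
  "expct p f \<equiv> measure_pmf.expectation p f"

lemma expct_mono:
  assumes "finite (set_pmf p)" "\<And>x. x \<in> set_pmf p \<Longrightarrow> f x \<le> g x"
  shows "expct p f \<le> expct p g"
  using assms by (intro integral_mono_AE) (auto simp: AE_measure_pmf_iff integrable_measure_pmf_finite)

lemma expct_cong:
  assumes "\<And>x. x \<in> set_pmf p \<Longrightarrow> f x = g x"
  shows "expct p f = expct p g"
  using assms by (intro integral_cong_AE) (auto simp: AE_measure_pmf_iff)

lemma expct_le_const:
  assumes "finite (set_pmf p)" "\<And>x. x \<in> set_pmf p \<Longrightarrow> f x \<le> c"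
  shows "expct p f \<le> c"
  using expct_mono[OF assms(1), of f "\<lambda>_. c"] assms(2) by simp

lemma expct_add:
  assumes "finite (set_pmf p)"
  shows "expct p (\<lambda>x. f x + g x) = expct p f + expct p g"
  using assms by (simp add: integrable_measure_pmf_finite)

lemma expct_diff:
  assumes "finite (set_pmf p)"
  shows "expct p (\<lambda>x. f x - g x) = expct p f - expct p g"
  using assms by (simp add: integrable_measure_pmf_finite)

lemma expct_sum:
  assumes "finite (set_pmf p)"
  shows "expct p (\<lambda>x. \<Sum>i\<in>A. f i x) = (\<Sum>i\<in>A. expct p (f i))"
  using assms by (intro Bochner_Integration.integral_sum) (simp add: integrable_measure_pmf_finite)

lemma expct_of_bool: "expct p (\<lambda>x. of_bool (P x)) = measure_pmf.prob p {x. P x}"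
proof -
  have "(\<lambda>x. of_bool (P x) :: real) = indicator {x. P x}"
    by (auto simp: indicator_def)
  then show ?thesis
    by simp
qed

lemma expct_sq_le:
  assumes "finite (set_pmf p)"
  shows "(expct p f)\<^sup>2 \<le> expct p (\<lambda>x. (f x)\<^sup>2)"
proof -
  let ?e = "expct p f"
  have "0 \<le> expct p (\<lambda>x. (f x - ?e)\<^sup>2)"
    by (intro integral_nonneg_AE) auto
  also have "\<dots> = expct p (\<lambda>x. (f x)\<^sup>2 - 2 * ?e * f x + ?e\<^sup>2)"
    by (intro expct_cong) (simp add: power2_diff)
  also have "\<dots> = expct p (\<lambda>x. (f x)\<^sup>2) - ?e\<^sup>2"
    by (simp add: expct_add expct_diff assms power2_eq_square)
  finally show ?thesis by simp
qed

lemma expct_bind: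
  assumes "finite (set_pmf p)" "\<And>x. x \<in> set_pmf p \<Longrightarrow> finite (set_pmf (q x))"
  shows "expct (bind_pmf p q) f = expct p (\<lambda>x. expct (q x) f)"
  using assms by (subst pmf_expectation_bind[of "set_pmf p"])
    (auto simp: integral_measure_pmf[of "set_pmf p"])

lemma expct_swap:
  assumes "finite (set_pmf p)" "finite (set_pmf q)"
  shows "expct p (\<lambda>x. expct q (f x)) = expct q (\<lambda>y. expct p (\<lambda>x. f x y))"
proof -
  have "expct p (\<lambda>x. expct q (f x)) = (\<Sum>x\<in>set_pmf p. \<Sum>y\<in>set_pmf q. pmf p x * (pmf q y * f x y))"
    using assms by (simp add: integral_measure_pmf[of "set_pmf p"] integral_measure_pmf[of "set_pmf q"]
      sum_distrib_left)
  also have "\<dots> = (\<Sum>y\<in>set_pmf q. \<Sum>x\<in>set_pmf p. pmf q y * (pmf p x * f x y))"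
    by (subst sum.swap) (simp add: mult_ac)
  also have "\<dots> = expct q (\<lambda>y. expct p (\<lambda>x. f x y))"
    using assms by (simp add: integral_measure_pmf[of "set_pmf p"] integral_measure_pmf[of "set_pmf q"]
      sum_distrib_left)
  finally show ?thesis .
qed

lemma expct_pair:
  assumes "finite (set_pmf p)" "finite (set_pmf q)"
  shows "expct (pair_pmf p q) f = expct p (\<lambda>x. expct q (\<lambda>y. f (x, y)))"
  unfolding pair_pmf_def using assms by (simp add: expct_bind)

lemma markov_le:
  assumes fin: "finite (set_pmf p)" and nn: "\<And>x. x \<in> set_pmf p \<Longrightarrow> 0 \<le> f x"
    and ge: "\<And>x. x \<in> set_pmf p \<Longrightarrow> P x \<Longrightarrow> 1 \<le> f x"
  shows "measure_pmf.prob p {x. P x} \<le> expct p f"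
  unfolding expct_of_bool[symmetric] using nn ge by (intro expct_mono[OF fin]) (auto simp: of_bool_def)

lemma finite_set_Pi_pmf:
  assumes "finite I" "\<And>i. i \<in> I \<Longrightarrow> finite (set_pmf (p i))"
  shows "finite (set_pmf (Pi_pmf I d p))"
  using assms by (auto simp: set_Pi_pmf)

lemma expct_Pi_insert:
  assumes "finite I" "a \<notin> I" "\<And>i. i \<in> insert a I \<Longrightarrow> finite (set_pmf (p i))"
  shows "expct (Pi_pmf (insert a I) d p) f
    = expct (p a) (\<lambda>y. expct (Pi_pmf I d p) (\<lambda>x. f (x(a := y))))"
  using assms by (simp add: Pi_pmf_insert expct_pair finite_set_Pi_pmf)

lemma expct_Pi_split:
  assumes "finite I" "a \<in> I" "\<And>i. i \<in> I \<Longrightarrow> finite (set_pmf (p i))"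
  shows "expct (Pi_pmf I d p) f
    = expct (p a) (\<lambda>y. expct (Pi_pmf (I - {a}) d p) (\<lambda>x. f (x(a := y))))"
proof -
  have "insert a (I - {a}) = I"
    using assms by auto
  then show ?thesis
    using expct_Pi_insert[of "I - {a}" a p d f] assms by auto
qed

lemma expct_Pi_component:
  assumes "finite I" "a \<in> I"
  shows "expct (Pi_pmf I d p) (\<lambda>x. f (x a)) = expct (p a) f"
proof -
  have "expct (Pi_pmf I d p) (\<lambda>x. f (x a)) = expct (map_pmf (\<lambda>x. x a) (Pi_pmf I d p)) f"
    by simp
  then show ?thesis
    using assms by (simp only: Pi_pmf_component if_True)
qed

text \<open>The usual choice of \<open>f0 i\<close> is the conditional mean given the other
  coordinates; it minimises the right side, so any function that does not read coordinate
  \<open>i\<close> will do. The induction decomposes the variance into the mean of the conditional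
  variance given coordinate \<open>a\<close> and the variance of the conditional mean
  \<open>F\<close>.\<close>

theorem efron_stein:
  assumes "finite I" "\<And>i. i \<in> I \<Longrightarrow> finite (set_pmf (p i))"
    and "\<And>i x y. i \<in> I \<Longrightarrow> f0 i (x(i := y)) = f0 i x"
  shows "expct (Pi_pmf I d p) (\<lambda>x. (f x)\<^sup>2) - (expct (Pi_pmf I d p) f)\<^sup>2
    \<le> (\<Sum>i\<in>I. expct (Pi_pmf I d p) (\<lambda>x. (f x - f0 i x)\<^sup>2))"
  using assms
proof (induction I arbitrary: f f0 rule: finite_induct)
  case empty
  then show ?case by simp
next
  case (insert a I)
  let ?P = "Pi_pmf I d p"
  have finP: "finite (set_pmf ?P)" and fina: "finite (set_pmf (p a))"
    using insert by (auto intro!: finite_set_Pi_pmf)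
  have split: "expct (Pi_pmf (insert a I) d p) h = expct (p a) (\<lambda>y. expct ?P (\<lambda>x. h (x(a := y))))" for h
    using insert by (intro expct_Pi_insert) auto
  have f0a: "f0 a (x(a := y)) = f0 a x" for x y
    using insert.prems by blast
  have f0i: "f0 i ((x(i := z))(a := y)) = f0 i (x(a := y))" if "i \<in> I" for i x y z
    using insert.prems(2)[of i "x(a := y)" z] that insert.hyps
    by (metis fun_upd_twist insertCI)
  define F where "F = (\<lambda>y. expct ?P (\<lambda>x. f (x(a := y))))"
  define c where "c = expct ?P (f0 a)"
  have IH: "expct ?P (\<lambda>x. (f (x(a := y)))\<^sup>2) \<le> (F y)\<^sup>2 +
      (\<Sum>i\<in>I. expct ?P (\<lambda>x. (f (x(a := y)) - f0 i (x(a := y)))\<^sup>2))" for y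
  proof -
    have "expct ?P (\<lambda>x. (f (x(a := y)))\<^sup>2) - (expct ?P (\<lambda>x. f (x(a := y))))\<^sup>2
        \<le> (\<Sum>i\<in>I. expct ?P (\<lambda>x. (f (x(a := y)) - f0 i (x(a := y)))\<^sup>2))"
    proof (rule insert.IH)
      show "finite (set_pmf (p i))" if "i \<in> I" for i
        using insert.prems(1) that by simp
      show "f0 i ((x(i := z))(a := y)) = f0 i (x(a := y))" if "i \<in> I" for i x z
        using f0i that .
    qed
    then show ?thesis
      unfolding F_def by linarith
  qed
  \<comment> \<open>A variance is the least mean square distance to a constant, so it may be
    compared with the distance to \<open>c\<close>.\<close>
  have "expct (p a) (\<lambda>y. (F y)\<^sup>2) - (expct (p a) F)\<^sup>2 \<le> expct (p a) (\<lambda>y. (F y - c)\<^sup>2)"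
  proof -
    have "expct (p a) (\<lambda>y. (F y - c)\<^sup>2) = expct (p a) (\<lambda>y. (F y)\<^sup>2 - 2 * c * F y + c\<^sup>2)"
      by (intro expct_cong) (simp add: power2_diff)
    also have "\<dots> = expct (p a) (\<lambda>y. (F y)\<^sup>2) - 2 * c * expct (p a) F + c\<^sup>2"
      by (simp add: expct_add expct_diff fina)
    also have "\<dots> = expct (p a) (\<lambda>y. (F y)\<^sup>2) - (expct (p a) F)\<^sup>2 + (expct (p a) F - c)\<^sup>2"
      by (simp add: power2_diff)
    finally show ?thesis by simp
  qed
  also have "\<dots> \<le> expct (p a) (\<lambda>y. expct ?P (\<lambda>x. (f (x(a := y)) - f0 a x)\<^sup>2))"
  proof (intro expct_mono fina)
    fix y
    \<comment> \<open>\<open>f0 a\<close> does not read coordinate \<open>a\<close>, so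
      \<open>c\<close> is its mean for every \<open>y\<close>; the difference is one average, to
      which Jensen applies.\<close>
    have "F y - c = expct ?P (\<lambda>x. f (x(a := y)) - f0 a x)"
      by (simp add: F_def c_def expct_diff finP)
    then show "(F y - c)\<^sup>2 \<le> expct ?P (\<lambda>x. (f (x(a := y)) - f0 a x)\<^sup>2)"
      using expct_sq_le[OF finP] by simp
  qed
  also have "\<dots> = expct (Pi_pmf (insert a I) d p) (\<lambda>x. (f x - f0 a x)\<^sup>2)"
    by (simp add: split f0a)
  finally have 1: "expct (p a) (\<lambda>y. (F y)\<^sup>2) - (expct (p a) F)\<^sup>2
      \<le> expct (Pi_pmf (insert a I) d p) (\<lambda>x. (f x - f0 a x)\<^sup>2)" .
  have "expct (Pi_pmf (insert a I) d p) (\<lambda>x. (f x)\<^sup>2) = expct (p a) (\<lambda>y. expct ?P (\<lambda>x. (f (x(a := y)))\<^sup>2))"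
    by (rule split)
  also have "\<dots> \<le> expct (p a) (\<lambda>y. (F y)\<^sup>2 +
      (\<Sum>i\<in>I. expct ?P (\<lambda>x. (f (x(a := y)) - f0 i (x(a := y)))\<^sup>2)))"
    using IH by (intro expct_mono fina)
  also have "\<dots> = expct (p a) (\<lambda>y. (F y)\<^sup>2) +
      (\<Sum>i\<in>I. expct (Pi_pmf (insert a I) d p) (\<lambda>x. (f x - f0 i x)\<^sup>2))"
    by (simp add: expct_add expct_sum fina split)
  finally show ?case
    using 1 insert.hyps by (simp add: split F_def)
qed

text \<open>The second moment is the squared mean plus the variance; Efron-Stein with the
  \<open>i\<close>-th term left out bounds the variance by the second moments of the single
  terms.\<close>

lemma expct_sq_indicator_sum_le:
  assumes "finite I" "\<And>i. i \<in> I \<Longrightarrow> finite (set_pmf (p i))"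
  shows "expct (Pi_pmf I d p) (\<lambda>x. (\<Sum>b\<in>I. c b * of_bool (x b = k))\<^sup>2)
    \<le> (\<Sum>b\<in>I. c b * pmf (p b) k)\<^sup>2 + (\<Sum>b\<in>I. (c b)\<^sup>2 * pmf (p b) k)"
proof -
  let ?P = "Pi_pmf I d p"
  define f where "f = (\<lambda>x. \<Sum>b\<in>I. c b * of_bool (x b = k))"
  define f0 where "f0 = (\<lambda>i x. \<Sum>b\<in>I - {i}. c b * of_bool (x b = k))"
  have fin: "finite (set_pmf ?P)"
    using assms by (rule finite_set_Pi_pmf)
  have pr: "expct ?P (\<lambda>x. of_bool (x b = k)) = pmf (p b) k" if "b \<in> I" for b
  proof -
    have "expct ?P (\<lambda>x. of_bool (x b = k)) = expct (p b) (\<lambda>y. of_bool (y = k))"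
      using expct_Pi_component[OF assms(1) that, of d p "\<lambda>y. of_bool (y = k)"] .
    then show ?thesis
      by (simp add: expct_of_bool measure_pmf_single)
  qed
  have "expct ?P f = (\<Sum>b\<in>I. c b * pmf (p b) k)"
    unfolding f_def using pr by (simp add: expct_sum[OF fin])
  moreover have "expct ?P (\<lambda>x. (f x - f0 b x)\<^sup>2) = (c b)\<^sup>2 * pmf (p b) k" if "b \<in> I" for b
  proof -
    have "(f x - f0 b x)\<^sup>2 = (c b)\<^sup>2 * of_bool (x b = k)" for x
      unfolding f_def f0_def sum.remove[OF assms(1) that] by (simp add: power_mult_distrib)
    then show ?thesis
      using pr[OF that] by simp
  qed
  moreover have "expct ?P (\<lambda>x. (f x)\<^sup>2) - (expct ?P f)\<^sup>2 \<le> (\<Sum>i\<in>I. expct ?P (\<lambda>x. (f x - f0 i x)\<^sup>2))"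
    using assms by (intro efron_stein) (auto simp: f0_def intro!: sum.cong)
  ultimately show ?thesis
    by (simp add: f_def)
qed

section \<open>Rademacher chaos of order two\<close>

definition rad :: "real pmf" where
  "rad = pmf_of_set {-1, 1}"

lemma set_rad: "set_pmf rad = {-1, 1}"
  by (simp add: rad_def)

lemma expct_rad: "expct rad f = (f (- 1) + f 1) / 2"
  unfolding rad_def by (subst integral_pmf_of_set) auto

lemma finite_rad: "finite (set_pmf rad)"
  by (simp add: set_rad)

lemma finite_Pi_rad: "finite I \<Longrightarrow> finite (set_pmf (Pi_pmf I d (\<lambda>_. rad)))"
  by (intro finite_set_Pi_pmf finite_rad)

text \<open>This is \<open>cosh t \<le> exp (t\<^sup>2 / 2)\<close>, obtained from the analytic step
  of Hoeffding's lemma for an interval of length \<open>2 * l\<close> and probability 1/2; negative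
  \<open>t\<close> follows by symmetry.\<close>

lemma expct_rad_exp_le: "expct rad (\<lambda>z. exp (t * z)) \<le> exp (t\<^sup>2 / 2)"
proof -
  have pos: "expct rad (\<lambda>z. exp (l * z)) \<le> exp (l\<^sup>2 / 2)" if "l > 0" for l :: real
  proof -
    have e: "expct rad (\<lambda>z. exp (l * z)) = exp (- l) * (1 + 1/2 * (exp (2 * l) - 1))"
      by (simp add: expct_rad exp_add[symmetric] field_simps)
    have g: "1 + 1/2 * (exp (2 * l) - 1) > 0"
      using exp_gt_zero[of "l * 2"] by (simp add: field_simps add_pos_pos)
    have "- (2 * l) * (1/2) + ln (1 + 1/2 * (exp (2 * l) - 1)) \<le> (2 * l)\<^sup>2 / 8"
      by (rule Hoeffdings_lemma_aux) (use that in auto)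
    then have "exp (- l + ln (1 + 1/2 * (exp (2 * l) - 1))) \<le> exp (l\<^sup>2 / 2)"
      by (simp add: power_mult_distrib)
    then show ?thesis
      unfolding e exp_add exp_ln[OF g] .
  qed
  consider "t > 0" | "t = 0" | "t < 0"
    by linarith
  then show ?thesis
  proof cases
    case 3
    then show ?thesis
      using pos[of "- t"] by (simp add: expct_rad add.commute)
  qed (use pos[of t] in auto)
qed

text \<open>The shift \<open>s\<close> carries the induction: fixing one sign moves its column of
  \<open>c\<close> into \<open>s\<close>. Averaging over that sign raises the factor \<nu> to
  \<open>\<nu> * (1 + 2 * \<nu> * \<tau>)\<close>, where \<tau> is the squared norm of the column.
  This is a discrete form of the equation that the derivative of \<nu> equals
  \<open>2 * \<nu>\<^sup>2\<close>, whose solution \<open>\<mu> / (1 - 2 * \<mu> * \<sigma>)\<close>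
  is the factor in the bound.\<close>

lemma expct_exp_sq_norm_le:
  fixes c :: "'i \<Rightarrow> 'j \<Rightarrow> real" and \<mu> :: real
  assumes "finite A" "0 \<le> \<mu>" "2 * \<mu> * (\<Sum>i\<in>K. \<Sum>j\<in>A. (c i j)\<^sup>2) < 1"
  shows "expct (Pi_pmf A d (\<lambda>_. rad)) (\<lambda>z. exp (\<mu> * (\<Sum>i\<in>K. (s i + (\<Sum>j\<in>A. c i j * z j))\<^sup>2)))
    \<le> exp (\<mu> / (1 - 2 * \<mu> * (\<Sum>i\<in>K. \<Sum>j\<in>A. (c i j)\<^sup>2)) * ((\<Sum>i\<in>K. (s i)\<^sup>2) + (\<Sum>i\<in>K. \<Sum>j\<in>A. (c i j)\<^sup>2)))"
  using assms
proof (induction A arbitrary: s rule: finite_induct)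
  case empty
  then show ?case by simp
next
  case (insert a A)
  define \<sigma> where "\<sigma> = (\<Sum>i\<in>K. \<Sum>j\<in>A. (c i j)\<^sup>2)"
  define \<tau> where "\<tau> = (\<Sum>i\<in>K. (c i a)\<^sup>2)"
  define S where "S = (\<Sum>i\<in>K. (s i)\<^sup>2)"
  define r where "r = (\<Sum>i\<in>K. s i * c i a)"
  have sum: "(\<Sum>i\<in>K. \<Sum>j\<in>insert a A. (c i j)\<^sup>2) = \<tau> + \<sigma>"
    using insert.hyps by (simp add: \<tau>_def \<sigma>_def sum.distrib)
  have nn: "0 \<le> \<tau>" "0 \<le> \<sigma>" "0 \<le> S"
    by (auto simp: \<tau>_def \<sigma>_def S_def intro!: sum_nonneg)
  have lt: "2 * \<mu> * (\<tau> + \<sigma>) < 1"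
    using insert.prems sum by simp
  have m\<tau>: "0 \<le> \<mu> * \<tau>" "0 \<le> \<mu> * \<sigma>"
    using nn insert.prems by auto
  have lt\<sigma>: "2 * \<mu> * \<sigma> < 1"
    using lt m\<tau> by (simp add: algebra_simps)
  define \<nu> where "\<nu> = \<mu> / (1 - 2 * \<mu> * \<sigma>)"
  define \<nu>' where "\<nu>' = \<mu> / (1 - 2 * \<mu> * (\<tau> + \<sigma>))"
  have \<nu>0: "0 \<le> \<nu>" "0 \<le> \<nu>'"
    using lt lt\<sigma> insert.prems by (auto simp: \<nu>_def \<nu>'_def)
  \<comment> \<open>Cross-multiplied, this is \<open>(u + v) * (u - v) \<le> u\<^sup>2\<close> for
    \<open>u = 1 - 2 * \<mu> * \<sigma>\<close> and \<open>v = 2 * \<mu> * \<tau>\<close>.\<close>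
  have \<nu>le: "\<nu> * (1 + 2 * \<nu> * \<tau>) \<le> \<nu>'"
  proof -
    have "\<nu> * (1 + 2 * \<nu> * \<tau>) = \<mu> * (1 - 2 * \<mu> * \<sigma> + 2 * \<mu> * \<tau>) / (1 - 2 * \<mu> * \<sigma>)\<^sup>2"
      using lt\<sigma> by (simp add: \<nu>_def field_simps power2_eq_square)
    also have "\<dots> \<le> \<nu>'"
    proof -
      have "(1 - 2 * \<mu> * \<sigma> + 2 * \<mu> * \<tau>) * (1 - 2 * \<mu> * (\<tau> + \<sigma>))
          = (1 - 2 * \<mu> * \<sigma>)\<^sup>2 - (2 * \<mu> * \<tau>)\<^sup>2"
        by (simp add: algebra_simps power2_eq_square)
      also have "\<dots> \<le> (1 - 2 * \<mu> * \<sigma>)\<^sup>2"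
        by simp
      finally have "(1 - 2 * \<mu> * \<sigma> + 2 * \<mu> * \<tau>) * (1 - 2 * \<mu> * (\<tau> + \<sigma>)) \<le> (1 - 2 * \<mu> * \<sigma>)\<^sup>2" .
      then have "(1 - 2 * \<mu> * \<sigma> + 2 * \<mu> * \<tau>) / (1 - 2 * \<mu> * \<sigma>)\<^sup>2 \<le> 1 / (1 - 2 * \<mu> * (\<tau> + \<sigma>))"
        using lt lt\<sigma> by (simp add: field_simps)
      from mult_left_mono[OF this \<open>0 \<le> \<mu>\<close>] show ?thesis
        by (simp add: \<nu>'_def)
    qed
    finally show ?thesis .
  qed
  have \<nu>\<nu>': "\<nu> \<le> \<nu>'"
    using \<nu>le \<nu>0 nn by (smt (verit) mult_left_mono mult_nonneg_nonneg mult_cancel_left1)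
  have rS: "r\<^sup>2 \<le> S * \<tau>"
    unfolding r_def S_def \<tau>_def by (rule Cauchy_Schwarz_ineq_sum)
  have "expct (Pi_pmf (insert a A) d (\<lambda>_. rad)) (\<lambda>z. exp (\<mu> * (\<Sum>i\<in>K. (s i + (\<Sum>j\<in>insert a A. c i j * z j))\<^sup>2)))
    = expct rad (\<lambda>y. expct (Pi_pmf A d (\<lambda>_. rad)) (\<lambda>z. exp (\<mu> * (\<Sum>i\<in>K. ((s i + c i a * y) + (\<Sum>j\<in>A. c i j * z j))\<^sup>2))))"
  proof -
    have eq: "(\<Sum>j\<in>insert a A. c i j * (z(a := y)) j) = c i a * y + (\<Sum>j\<in>A. c i j * z j)" for i z y
      using insert.hyps by (auto intro!: sum.cong)
    show ?thesis
      unfolding expct_Pi_insert[OF insert.hyps(1,2) finite_rad] eq by (simp add: add.assoc)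
  qed
  also have "\<dots> \<le> expct rad (\<lambda>y. exp (\<nu> * ((\<Sum>i\<in>K. (s i + c i a * y)\<^sup>2) + \<sigma>)))"
    using insert.IH[OF \<open>0 \<le> \<mu>\<close>] lt\<sigma> unfolding \<sigma>_def[symmetric] \<nu>_def
    by (intro expct_mono finite_rad) auto
  also have "\<dots> = expct rad (\<lambda>y. exp (\<nu> * (S + \<tau> + \<sigma>)) * exp (2 * \<nu> * r * y))"
  proof (intro expct_cong)
    fix y assume "y \<in> set_pmf rad"
    then have "y\<^sup>2 = 1"
      by (auto simp: set_rad)
    then have "(\<Sum>i\<in>K. (s i + c i a * y)\<^sup>2) = S + \<tau> + 2 * r * y"
      unfolding S_def \<tau>_def r_def sum_distrib_right sum_distrib_left sum.distrib[symmetric]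
      by (intro sum.cong) (auto simp: power2_sum power_mult_distrib)
    then show "exp (\<nu> * ((\<Sum>i\<in>K. (s i + c i a * y)\<^sup>2) + \<sigma>)) = exp (\<nu> * (S + \<tau> + \<sigma>)) * exp (2 * \<nu> * r * y)"
      by (simp add: exp_add[symmetric] algebra_simps)
  qed
  also have "\<dots> \<le> exp (\<nu> * (S + \<tau> + \<sigma>)) * exp ((2 * \<nu> * r)\<^sup>2 / 2)"
    using expct_rad_exp_le by simp
  also have "\<dots> \<le> exp (\<nu>' * (S + (\<tau> + \<sigma>)))"
  proof -
    have "(2 * \<nu> * r)\<^sup>2 / 2 = 2 * \<nu>\<^sup>2 * r\<^sup>2"
      by (simp add: power_mult_distrib)
    also have "\<dots> \<le> 2 * \<nu>\<^sup>2 * (S * \<tau>)"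
      using rS by (intro mult_left_mono) auto
    finally have "\<nu> * (S + \<tau> + \<sigma>) + (2 * \<nu> * r)\<^sup>2 / 2 \<le> \<nu> * (1 + 2 * \<nu> * \<tau>) * S + \<nu> * (\<tau> + \<sigma>)"
      by (simp add: algebra_simps power2_eq_square)
    also have "\<dots> \<le> \<nu>' * S + \<nu>' * (\<tau> + \<sigma>)"
      using \<nu>le \<nu>\<nu>' nn by (intro add_mono mult_right_mono) auto
    finally show ?thesis
      by (simp add: exp_add[symmetric] algebra_simps)
  qed
  finally show ?case
    by (simp add: sum \<nu>'_def S_def)
qed

text \<open>The premise says that \<open>s i\<close> reads only coordinates below \<open>i\<close>.
  Integrating out the last sign first, its factor has conditional mean at most 1 by the sub-Gaussian
  bound.\<close>

lemma expct_exp_martingale_le: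
  fixes s :: "nat \<Rightarrow> (nat \<Rightarrow> real) \<Rightarrow> real"
  assumes "\<And>i j z y. i \<le> j \<Longrightarrow> s i (z(j := y)) = s i z"
  shows "expct (Pi_pmf {1..m} d (\<lambda>_. rad)) (\<lambda>z. exp (\<Sum>i=1..m. z i * s i z - (s i z)\<^sup>2 / 2)) \<le> 1"
proof (induction m)
  case 0
  then show ?case by simp
next
  case (Suc m)
  let ?P = "Pi_pmf {1..m} d (\<lambda>_. rad)" and ?t = "\<lambda>z. \<Sum>i=1..m. z i * s i z - (s i z)\<^sup>2 / 2"
  have ins: "{1..Suc m} = insert (Suc m) {1..m}"
    by auto
  have t: "(\<Sum>i=1..Suc m. (z(Suc m := y)) i * s i (z(Suc m := y)) - (s i (z(Suc m := y)))\<^sup>2 / 2)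
     = ?t z + (y * s (Suc m) z - (s (Suc m) z)\<^sup>2 / 2)" for z y
  proof -
    have "s i (z(Suc m := y)) = s i z" if "i \<in> {1..Suc m}" for i
      using assms that by simp
    then show ?thesis
      by (simp add: ins)
  qed
  have "expct (Pi_pmf {1..Suc m} d (\<lambda>_. rad)) (\<lambda>z. exp (\<Sum>i=1..Suc m. z i * s i z - (s i z)\<^sup>2 / 2))
    = expct rad (\<lambda>y. expct ?P (\<lambda>z. exp (?t z + (y * s (Suc m) z - (s (Suc m) z)\<^sup>2 / 2))))"
    unfolding t[symmetric] unfolding ins by (rule expct_Pi_insert) (auto simp: finite_rad)
  also have "\<dots> = expct ?P (\<lambda>z. expct rad (\<lambda>y. exp (?t z + (y * s (Suc m) z - (s (Suc m) z)\<^sup>2 / 2))))"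
    by (rule expct_swap) (auto intro: finite_rad finite_Pi_rad)
  also have "\<dots> \<le> expct ?P (\<lambda>z. exp (?t z))"
  proof (intro expct_mono finite_Pi_rad)
    fix z
    have "expct rad (\<lambda>y. exp (?t z + (y * s (Suc m) z - (s (Suc m) z)\<^sup>2 / 2)))
      = exp (?t z) * exp (- ((s (Suc m) z)\<^sup>2 / 2)) * expct rad (\<lambda>y. exp (s (Suc m) z * y))"
      by (simp add: expct_rad exp_add[symmetric] algebra_simps)
    also have "\<dots> \<le> exp (?t z) * exp (- ((s (Suc m) z)\<^sup>2 / 2)) * exp ((s (Suc m) z)\<^sup>2 / 2)"
      by (intro mult_left_mono expct_rad_exp_le) auto
    also have "\<dots> = exp (?t z)"
      by (simp add: exp_add[symmetric])
    finally show "expct rad (\<lambda>y. exp (?t z + (y * s (Suc m) z - (s (Suc m) z)\<^sup>2 / 2))) \<le> exp (?t z)" .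
  qed simp
  also have "\<dots> \<le> 1"
    by (rule Suc.IH)
  finally show ?case .
qed

lemma sum_offdiag_symmetric:
  fixes f :: "nat \<Rightarrow> nat \<Rightarrow> real"
  assumes "\<And>i j. f i j = f j i"
  shows "(\<Sum>i=1..m. \<Sum>j\<in>{1..m} - {i}. f i j) = 2 * (\<Sum>i=1..m. \<Sum>j=1..m. of_bool (j < i) * f i j)"
proof -
  have "(\<Sum>i=1..m. \<Sum>j\<in>{1..m} - {i}. f i j)
    = (\<Sum>i=1..m. \<Sum>j=1..m. of_bool (j < i) * f i j + of_bool (i < j) * f i j)"
  proof (rule sum.cong[OF refl])
    fix i assume "i \<in> {1..m}"
    have "(\<Sum>j\<in>{1..m} - {i}. f i j) = (\<Sum>j=1..m. if j = i then 0 else f i j)"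
      by (intro sum.mono_neutral_cong_left) auto
    also have "\<dots> = (\<Sum>j=1..m. of_bool (j < i) * f i j + of_bool (i < j) * f i j)"
      by (intro sum.cong) auto
    finally show "(\<Sum>j\<in>{1..m} - {i}. f i j) = (\<Sum>j=1..m. of_bool (j < i) * f i j + of_bool (i < j) * f i j)" .
  qed
  also have "\<dots> = (\<Sum>i=1..m. \<Sum>j=1..m. of_bool (j < i) * f i j) + (\<Sum>i=1..m. \<Sum>j=1..m. of_bool (i < j) * f i j)"
    by (simp add: sum.distrib)
  also have "(\<Sum>i=1..m. \<Sum>j=1..m. of_bool (i < j) * f i j) = (\<Sum>i=1..m. \<Sum>j=1..m. of_bool (j < i) * f i j)"
    by (subst sum.swap) (use assms in auto)
  finally show ?thesis by simp
qed

text \<open>The chaos is a martingale sum over \<open>i\<close> with increments \<open>z i * s i z\<close>; half the exponent is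
  spent on the exponential supermartingale and half on its quadratic variation.\<close>

theorem expct_exp_chaos_le:
  fixes h :: "nat \<Rightarrow> nat \<Rightarrow> real"
  assumes sym: "\<And>i j. h i j = h j i" and G: "0 < G"
    and bound: "(\<Sum>i=1..m. \<Sum>j\<in>{1..m} - {i}. (h i j)\<^sup>2) \<le> 4 * G\<^sup>2"
  shows "expct (Pi_pmf {1..m} d (\<lambda>_. rad))
      (\<lambda>z. exp ((\<Sum>i=1..m. \<Sum>j\<in>{1..m} - {i}. z i * z j * h i j) / (8 * G))) \<le> (1 + exp (1/2)) / 2"
proof -
  let ?P = "Pi_pmf {1..m} d (\<lambda>_. rad)"
  \<comment> \<open>Each unordered pair occurs twice in the chaos, so \<open>2 * X z\<close> is the
    sum of the \<open>z i * s i z\<close> once the strict lower triangle of \<open>h\<close> is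
    divided by \<open>2 * G\<close>. With this scaling the squared Frobenius norm \<sigma> is at
    most 1/2, and at \<open>\<mu> = 1/2\<close> the bound for the quadratic variation has exponent
    at most 1/2.\<close>
  define c where "c = (\<lambda>i j. of_bool (j < i) * h i j / (2 * G))"
  define s where "s = (\<lambda>i z. \<Sum>j=1..m. c i j * z j)"
  define M where "M = (\<lambda>z. \<Sum>i=1..m. z i * s i z - (s i z)\<^sup>2 / 2)"
  define Q where "Q = (\<lambda>z. 1/2 * (\<Sum>i=1..m. (0 + s i z)\<^sup>2))"
  define X where "X = (\<lambda>z. (\<Sum>i=1..m. \<Sum>j\<in>{1..m} - {i}. z i * z j * h i j) / (8 * G))"
  have fin: "finite (set_pmf ?P)"
    by (simp add: finite_Pi_rad)
  have X: "2 * X z = M z + Q z" for z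
  proof -
    have "2 * X z = (\<Sum>i=1..m. z i * s i z)"
    proof -
      have "2 * X z = (\<Sum>i=1..m. \<Sum>j=1..m. of_bool (j < i) * (z i * z j * h i j)) / (2 * G)"
        unfolding X_def by (subst sum_offdiag_symmetric) (use sym G in \<open>auto simp: mult_ac\<close>)
      then show ?thesis
        by (simp add: s_def c_def sum_distrib_left sum_divide_distrib mult_ac)
    qed
    then show ?thesis
      by (simp add: M_def Q_def sum_subtractf sum_divide_distrib)
  qed
  have EM: "expct ?P (\<lambda>z. exp (M z)) \<le> 1"
    unfolding M_def
  proof (rule expct_exp_martingale_le)
    show "s i (z(j := y)) = s i z" if "i \<le> j" for i j z y
      unfolding s_def using that by (intro sum.cong) (auto simp: c_def)
  qed
  define \<sigma> where "\<sigma> = (\<Sum>i=1..m. \<Sum>j=1..m. (c i j)\<^sup>2)"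
  have \<sigma>: "\<sigma> \<le> 1/2"
  proof -
    have "\<sigma> = (\<Sum>i=1..m. \<Sum>j=1..m. of_bool (j < i) * (h i j)\<^sup>2) / (4 * G\<^sup>2)"
      unfolding \<sigma>_def c_def sum_divide_distrib
      by (intro sum.cong) (auto simp: power_divide power_mult_distrib)
    also have "\<dots> = (\<Sum>i=1..m. \<Sum>j\<in>{1..m} - {i}. (h i j)\<^sup>2) / (8 * G\<^sup>2)"
      by (subst sum_offdiag_symmetric) (use sym in auto)
    also have "\<dots> \<le> 4 * G\<^sup>2 / (8 * G\<^sup>2)"
      using bound by (intro divide_right_mono) auto
    also have "\<dots> = 1/2"
      using G by simp
    finally show ?thesis .
  qed
  have EQ: "expct ?P (\<lambda>z. exp (Q z)) \<le> exp (1/2)"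
  proof -
    have "expct ?P (\<lambda>z. exp (Q z)) \<le> exp ((1/2) / (1 - 2 * (1/2) * \<sigma>) * ((\<Sum>i\<in>{1..m}. 0\<^sup>2) + \<sigma>))"
      unfolding Q_def \<sigma>_def s_def
      by (rule expct_exp_sq_norm_le) (use \<sigma> in \<open>auto simp: \<sigma>_def\<close>)
    also have "\<dots> \<le> exp (1/2)"
      using \<sigma> by (simp add: field_simps)
    finally show ?thesis .
  qed
  have "expct ?P (\<lambda>z. exp (X z)) \<le> expct ?P (\<lambda>z. (exp (M z) + exp (Q z)) / 2)"
  proof (intro expct_mono fin)
    fix z
    have "exp (X z) = exp (M z / 2) * exp (Q z / 2)"
      using X[of z] by (simp add: exp_add[symmetric] field_simps)
    also have "\<dots> \<le> ((exp (M z / 2))\<^sup>2 + (exp (Q z / 2))\<^sup>2) / 2"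
      using sum_squares_bound[of "exp (M z / 2)" "exp (Q z / 2)"] by simp
    also have "\<dots> = (exp (M z) + exp (Q z)) / 2"
      by (simp add: exp_double[symmetric])
    finally show "exp (X z) \<le> (exp (M z) + exp (Q z)) / 2" .
  qed
  also have "\<dots> \<le> (1 + exp (1/2)) / 2"
    using EM EQ expct_add[OF fin, of "\<lambda>z. exp (M z)" "\<lambda>z. exp (Q z)"] by simp
  finally show ?thesis
    by (simp add: X_def)
qed

section \<open>Quantiles and permutation tests\<close>

definition quantile :: "real pmf \<Rightarrow> real \<Rightarrow> real" where
  "quantile q \<alpha> = Inf {t. cdf (measure_pmf q) t \<ge> 1 - \<alpha>}"

lemma cdf_pmf: "cdf (measure_pmf q) t = measure_pmf.prob q {..t}"
  by (simp add: cdf_def)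

lemma prob_greater: "measure_pmf.prob q {x::real. t < x} = 1 - cdf (measure_pmf q) t"
proof -
  have "{x. t < x} = UNIV - {..t}"
    by auto
  then show ?thesis
    using measure_pmf.prob_compl[of "{..t}" q] by (simp add: cdf_pmf)
qed

context
  fixes q :: "real pmf" and \<alpha> :: real
  assumes fin: "finite (set_pmf q)" and \<alpha>: "0 < \<alpha>" "\<alpha> < 1"
begin

lemma bdd_below_quantile_set: "bdd_below {t. cdf (measure_pmf q) t \<ge> 1 - \<alpha>}"
proof (rule bdd_belowI)
  fix t assume "t \<in> {t. cdf (measure_pmf q) t \<ge> 1 - \<alpha>}"
  then have "measure_pmf.prob q {..t} \<noteq> 0"
    using \<alpha> by (simp add: cdf_pmf)
  then obtain s where "s \<in> set_pmf q" "s \<le> t"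
    by (auto simp: measure_pmf_zero_iff)
  then show "Min (set_pmf q) \<le> t"
    using Min_le[OF fin] by fastforce
qed

lemma quantile_le:
  assumes "measure_pmf.prob q {x. t < x} \<le> \<alpha>"
  shows "quantile q \<alpha> \<le> t"
  unfolding quantile_def using assms
  by (intro cInf_lower bdd_below_quantile_set) (simp add: prob_greater)

lemma prob_greater_quantile: "measure_pmf.prob q {x. quantile q \<alpha> < x} \<le> \<alpha>"
proof -
  let ?F = "cdf (measure_pmf q)" and ?c = "quantile q \<alpha>"
  have "measure_pmf.prob q {..Max (set_pmf q)} = 1"
    using fin by (intro measure_pmf.prob_eq_1[THEN iffD2]) (auto simp: AE_measure_pmf_iff)
  then have "Max (set_pmf q) \<in> {t. ?F t \<ge> 1 - \<alpha>}"
    using \<alpha> by (simp add: cdf_pmf)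
  then have ne: "{t. ?F t \<ge> 1 - \<alpha>} \<noteq> {}"
    by blast
  \<comment> \<open>No atom lies strictly between \<open>?c\<close> and \<open>Min D\<close>, so a
    point \<open>s\<close> of the quantile set below \<open>Min D\<close> has every atom above
    \<open>?c\<close> to its right; right continuity of the distribution function is bypassed. The
    element \<open>?c + 1\<close> keeps \<open>D\<close> nonempty when no atom exceeds
    \<open>?c\<close>.\<close>
  define D where "D = insert (?c + 1) {x \<in> set_pmf q. ?c < x}"
  have D: "finite D" "D \<noteq> {}"
    using fin by (auto simp: D_def)
  then have "?c < Min D"
    by (simp add: Min_gr_iff) (auto simp: D_def)
  then obtain s where s: "1 - \<alpha> \<le> ?F s" "s < Min D"
    using cInf_less_iff[OF ne bdd_below_quantile_set] unfolding quantile_def by auto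
  have "measure_pmf.prob q {x. ?c < x} \<le> measure_pmf.prob q {x. s < x}"
  proof (rule measure_pmf.finite_measure_mono_AE)
    have "s < x" if "x \<in> set_pmf q" "?c < x" for x
      using s(2) Min_le[OF D(1), of x] that by (auto simp: D_def)
    then show "AE x in measure_pmf q. x \<in> {x. ?c < x} \<longrightarrow> x \<in> {x. s < x}"
      by (simp add: AE_measure_pmf_iff)
  qed simp
  then show ?thesis
    using s(1) by (simp add: prob_greater)
qed

end

section \<open>Uniform permutations and the level of a permutation test\<close>

definition perms :: "nat \<Rightarrow> (nat \<Rightarrow> nat) set" where
  "perms n = {\<pi>. \<pi> permutes {1..n}}"

lemma finite_perms [simp]: "finite (perms n)"
  by (simp add: perms_def finite_permutations)

lemma perms_nonempty [simp]: "perms n \<noteq> {}"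
  using permutes_id unfolding perms_def by blast

lemma set_unif_perms [simp]: "set_pmf (pmf_of_set (perms n)) = perms n"
  by simp

lemma unif_perms_comp_left:
  assumes "\<sigma> \<in> perms n"
  shows "map_pmf ((\<circ>) \<sigma>) (pmf_of_set (perms n)) = pmf_of_set (perms n)"
proof (rule map_pmf_of_set_bij_betw)
  have \<sigma>: "\<sigma> permutes {1..n}"
    using assms by (simp add: perms_def)
  have "inj ((\<circ>) \<sigma> :: (nat \<Rightarrow> nat) \<Rightarrow> _)"
    using permutes_inj[OF \<sigma>] by (simp add: fun.inj_map)
  then show "bij_betw ((\<circ>) \<sigma>) (perms n) (perms n)"
    using image_compose_permutations_left[OF \<sigma>] unfolding perms_def
    by (auto simp: bij_betw_def intro: inj_on_subset)
qed auto

lemma unif_perms_comp_right: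
  assumes "\<sigma> \<in> perms n"
  shows "map_pmf (\<lambda>\<pi>. \<pi> \<circ> \<sigma>) (pmf_of_set (perms n)) = pmf_of_set (perms n)"
proof (rule map_pmf_of_set_bij_betw)
  have \<sigma>: "\<sigma> permutes {1..n}"
    using assms by (simp add: perms_def)
  have "inj (\<lambda>\<pi> :: nat \<Rightarrow> nat. \<pi> \<circ> \<sigma>)"
    using permutes_surj[OF \<sigma>] by (auto simp: inj_def surj_def fun_eq_iff) metis
  then show "bij_betw (\<lambda>\<pi>. \<pi> \<circ> \<sigma>) (perms n) (perms n)"
    using image_compose_permutations_right[OF \<sigma>] unfolding perms_def
    by (auto simp: bij_betw_def intro: inj_on_subset)
qed auto

text \<open>Permuting the data composes the random permutation with a fixed one, so the critical
  value does not change. By exchangeability the identity may be replaced by any \<sigma> in the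
  rejection probability; averaging over \<sigma> inside the expectation leaves, for each
  \<open>x\<close>, the share of permutations whose statistic exceeds the quantile. Exchangeability
  is asked of the positions up to \<open>n\<close> only, which leaves room for further positions
  that determine the weights.\<close>

theorem permutation_test_level:
  fixes T :: "(nat \<Rightarrow> 'a) \<Rightarrow> (nat \<Rightarrow> nat) \<Rightarrow> real" and n :: nat and \<alpha> :: real
  defines "c \<equiv> \<lambda>x. quantile (map_pmf (T x) (pmf_of_set (perms n))) \<alpha>"
  assumes fin: "finite (set_pmf D)" and \<alpha>: "0 < \<alpha>" "\<alpha> < 1"
    and exch: "\<And>\<sigma>. \<sigma> \<in> perms n \<Longrightarrow> map_pmf (\<lambda>x. x \<circ> \<sigma>) D = D"
    and equivariant: "\<And>x \<sigma> \<pi>. \<sigma> \<in> perms n \<Longrightarrow> \<pi> \<in> perms n \<Longrightarrow> T (x \<circ> \<sigma>) \<pi> = T x (\<sigma> \<circ> \<pi>)"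
  shows "measure_pmf.prob D {x. T x id > c x} \<le> \<alpha>"
proof -
  let ?U = "pmf_of_set (perms n)"
  have c_inv: "c (x \<circ> \<sigma>) = c x" if "\<sigma> \<in> perms n" for x \<sigma>
  proof -
    have "map_pmf (T (x \<circ> \<sigma>)) ?U = map_pmf (\<lambda>\<pi>. T x (\<sigma> \<circ> \<pi>)) ?U"
      using equivariant[OF that] by (intro map_pmf_cong) auto
    also have "\<dots> = map_pmf (T x) (map_pmf ((\<circ>) \<sigma>) ?U)"
      by (simp add: pmf.map_comp comp_def)
    finally show ?thesis
      using unif_perms_comp_left[OF that] by (simp add: c_def)
  qed
  have id: "id \<in> perms n"
    by (simp add: perms_def permutes_id)
  have "measure_pmf.prob D {x. T x id > c x} = expct D (\<lambda>x. of_bool (T x \<sigma> > c x))" if "\<sigma> \<in> perms n" for \<sigma>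
  proof -
    have "measure_pmf.prob D {x. T x id > c x} = expct (map_pmf (\<lambda>x. x \<circ> \<sigma>) D) (\<lambda>x. of_bool (T x id > c x))"
      by (simp add: exch[OF that] expct_of_bool)
    also have "\<dots> = expct D (\<lambda>x. of_bool (T x \<sigma> > c x))"
      using equivariant[OF that id] by (simp add: c_inv[OF that])
    finally show ?thesis .
  qed
  then have "measure_pmf.prob D {x. T x id > c x} = expct ?U (\<lambda>\<sigma>. expct D (\<lambda>x. of_bool (T x \<sigma> > c x)))"
    using expct_cong[of ?U "\<lambda>_. measure_pmf.prob D {x. T x id > c x}" "\<lambda>\<sigma>. expct D (\<lambda>x. of_bool (T x \<sigma> > c x))"]
    by simp
  also have "\<dots> = expct D (\<lambda>x. expct ?U (\<lambda>\<sigma>. of_bool (T x \<sigma> > c x)))"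
    by (rule expct_swap) (use fin in auto)
  also have "\<dots> \<le> \<alpha>"
  proof (rule expct_le_const[OF fin])
    fix x
    have "measure_pmf.prob (map_pmf (T x) ?U) {y. c x < y} \<le> \<alpha>"
      unfolding c_def using \<alpha> by (intro prob_greater_quantile) auto
    then show "expct ?U (\<lambda>\<sigma>. of_bool (T x \<sigma> > c x)) \<le> \<alpha>"
      by (simp add: expct_of_bool measure_map_pmf vimage_def)
  qed
  finally show ?thesis .
qed

section \<open>The permuted U-statistic\<close>

lemma sum_minus_singleton:
  fixes f :: "'a \<Rightarrow> real"
  assumes "finite A"
  shows "(\<Sum>j\<in>A - {i}. f j) = (\<Sum>j\<in>A. of_bool (j \<noteq> i) * f j)"
  using assms by (intro sum.mono_neutral_cong_left) auto

lemma sum_1_double: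
  fixes f :: "nat \<Rightarrow> real"
  shows "(\<Sum>a=1..2 * m. f a) = (\<Sum>i=1..m. f i) + (\<Sum>i=1..m. f (m + i))"
proof -
  have "(\<Sum>a=1..2 * m. f a) = (\<Sum>a\<in>{1..m} \<union> {m + 1..m + m}. f a)"
    by (intro sum.cong) auto
  also have "\<dots> = (\<Sum>i=1..m. f i) + (\<Sum>a\<in>{m + 1..m + m}. f a)"
    by (intro sum.union_disjoint) auto
  also have "(\<Sum>a\<in>{m + 1..m + m}. f a) = (\<Sum>i=1..m. f (m + i))"
    by (rule sum.reindex_bij_witness[of _ "\<lambda>i. m + i" "\<lambda>i. i - m"]) auto
  finally show ?thesis .
qed

lemma sum_ordered_pairs:
  "(\<Sum>(i, j)\<in>ordered_pairs m. f i j) = (\<Sum>i=1..m. \<Sum>j\<in>{1..m} - {i}. f i j)"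
proof -
  have "ordered_pairs m = Sigma {1..m} (\<lambda>i. {1..m} - {i})"
    by (auto simp: ordered_pairs_def)
  then show ?thesis
    by (simp add: sum.Sigma)
qed

lemma card_ordered_pairs: "real (card (ordered_pairs m)) = real m * (real m - 1)"
proof -
  have "real (card (ordered_pairs m)) = (\<Sum>(i, j)\<in>ordered_pairs m. 1)"
    by (simp add: split_def)
  also have "\<dots> = (\<Sum>i=1..m. real m - 1)"
    unfolding sum_ordered_pairs by (intro sum.cong) (auto simp: of_nat_diff)
  finally show ?thesis
    by simp
qed

lemma sum_ordered_pairs_fst:
  fixes f :: "nat \<Rightarrow> real"
  shows "(\<Sum>(i, j)\<in>ordered_pairs m. f i) = (real m - 1) * (\<Sum>i=1..m. f i)"
  unfolding sum_ordered_pairs sum_distrib_left by (intro sum.cong) (auto simp: of_nat_diff)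

lemma sum_ordered_pairs_snd:
  fixes f :: "nat \<Rightarrow> real"
  shows "(\<Sum>(i, j)\<in>ordered_pairs m. f j) = (real m - 1) * (\<Sum>i=1..m. f i)"
proof -
  have "(\<Sum>(i, j)\<in>ordered_pairs m. f j) = (\<Sum>(i, j)\<in>ordered_pairs m. f i)"
    by (rule sum.reindex_bij_witness[of _ prod.swap prod.swap]) (auto simp: ordered_pairs_def)
  then show ?thesis
    by (simp add: sum_ordered_pairs_fst)
qed

text \<open>Each cross pair \<open>(i, j)\<close>, the case \<open>i = j\<close> included, arises
  from \<open>(m - 1)\<^sup>2\<close> choices of the two other indices; divided by
  \<open>(m * (m - 1))\<^sup>2\<close> this leaves \<open>1 / m\<^sup>2\<close>. The within-sample
  pairs keep the normalisation \<open>m * (m - 1)\<close>.\<close>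

lemma U_stat_eq:
  assumes "2 \<le> m"
  shows "U_stat g m u v =
    (\<Sum>i=1..m. \<Sum>j\<in>{1..m} - {i}. g (u i) (u j) + g (v i) (v j)) / (real m * (real m - 1))
    - 2 * (\<Sum>i=1..m. \<Sum>j=1..m. g (u i) (v j)) / (real m)\<^sup>2"
proof -
  let ?P = "ordered_pairs m"
  define N where "N = real m * (real m - 1)"
  define A where "A = (\<Sum>(i, j)\<in>?P. g (u i) (u j))"
  define B where "B = (\<Sum>(i, j)\<in>?P. g (v i) (v j))"
  define C where "C = (\<Sum>i=1..m. \<Sum>j=1..m. g (u i) (v j))"
  have N: "N > 0" "real m > 0" "real m - 1 > 0"
    using assms by (auto simp: N_def)
  have C1: "(\<Sum>(i1, i2)\<in>?P. \<Sum>(j1, j2)\<in>?P. g (u i1) (v j2)) = (real m - 1)\<^sup>2 * C"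
    unfolding sum_ordered_pairs_snd sum_ordered_pairs_fst C_def
    by (simp add: sum_distrib_left power2_eq_square mult_ac)
  have C2: "(\<Sum>(i1, i2)\<in>?P. \<Sum>(j1, j2)\<in>?P. g (u i2) (v j1)) = (real m - 1)\<^sup>2 * C"
    unfolding sum_ordered_pairs_snd sum_ordered_pairs_fst C_def
    by (simp add: sum_distrib_left power2_eq_square mult_ac)
  have "(\<Sum>(i1, i2)\<in>?P. \<Sum>(j1, j2)\<in>?P. h_kernel g (u i1) (u i2) (v j1) (v j2))
    = (\<Sum>(i1, i2)\<in>?P. \<Sum>(j1, j2)\<in>?P. g (u i1) (u i2)) + (\<Sum>(i1, i2)\<in>?P. \<Sum>(j1, j2)\<in>?P. g (v j1) (v j2))
      - (\<Sum>(i1, i2)\<in>?P. \<Sum>(j1, j2)\<in>?P. g (u i1) (v j2)) - (\<Sum>(i1, i2)\<in>?P. \<Sum>(j1, j2)\<in>?P. g (u i2) (v j1))"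
    by (simp add: h_kernel_def split_def sum.distrib sum_subtractf)
  also have "\<dots> = N * A + N * B - 2 * (real m - 1)\<^sup>2 * C"
    unfolding C1 C2 A_def B_def N_def
    by (simp add: split_def card_ordered_pairs sum_distrib_left[symmetric])
  finally have "U_stat g m u v = (N * A + N * B - 2 * (real m - 1)\<^sup>2 * C) / N\<^sup>2"
    by (simp add: U_stat_def card_ordered_pairs N_def)
  also have "\<dots> = (A + B) / N - 2 * C / (real m)\<^sup>2"
  proof -
    have "(k * l * A + k * l * B - 2 * l\<^sup>2 * C) / (k * l)\<^sup>2 = (A + B) / (k * l) - 2 * C / k\<^sup>2"
      if "k > 0" "l > 0" for k l :: real
      using that by (simp add: field_simps power2_eq_square)
    then show ?thesis
      using N unfolding N_def by blast
  qed
  finally show ?thesis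
    by (simp add: A_def B_def C_def N_def sum_ordered_pairs sum.distrib)
qed

lemma sum_offdiag_permute:
  fixes f :: "nat \<Rightarrow> nat \<Rightarrow> real"
  assumes "\<pi> permutes S" "finite S"
  shows "(\<Sum>a\<in>S. \<Sum>b\<in>S - {a}. f (\<pi> a) (\<pi> b)) = (\<Sum>a\<in>S. \<Sum>b\<in>S - {a}. f a b)"
proof -
  have "(\<Sum>a\<in>S. \<Sum>b\<in>S - {a}. f (\<pi> a) (\<pi> b)) = (\<Sum>a\<in>S. \<Sum>b\<in>S. of_bool (\<pi> b \<noteq> \<pi> a) * f (\<pi> a) (\<pi> b))"
    using assms permutes_inj[OF assms(1)] by (simp add: sum_minus_singleton inj_eq)
  also have "\<dots> = (\<Sum>a\<in>S. \<Sum>b\<in>S. of_bool (b \<noteq> \<pi> a) * f (\<pi> a) b)"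
  proof (rule sum.cong[OF refl])
    fix a
    show "(\<Sum>b\<in>S. of_bool (\<pi> b \<noteq> \<pi> a) * f (\<pi> a) (\<pi> b)) = (\<Sum>b\<in>S. of_bool (b \<noteq> \<pi> a) * f (\<pi> a) b)"
      using sum.permute[OF assms(1), of "\<lambda>b. of_bool (b \<noteq> \<pi> a) * f (\<pi> a) b"] by (simp only: o_def)
  qed
  also have "\<dots> = (\<Sum>a\<in>S. \<Sum>b\<in>S. of_bool (b \<noteq> a) * f a b)"
    using sum.permute[OF assms(1), of "\<lambda>a. \<Sum>b\<in>S. of_bool (b \<noteq> a) * f a b"] by (simp add: o_def)
  finally show ?thesis
    using assms by (simp add: sum_minus_singleton)
qed

section \<open>Symmetrisation by swapping pairs\<close>

definition pair_swap :: "nat \<Rightarrow> (nat \<Rightarrow> real) \<Rightarrow> nat \<Rightarrow> nat" where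
  "pair_swap m \<zeta> a = (if a \<in> {1..m} \<and> \<zeta> a = -1 then m + a
     else if a \<in> {m + 1..2 * m} \<and> \<zeta> (a - m) = -1 then a - m else a)"

text \<open>The map is its own inverse for every \<zeta>: only the value -1 makes \<open>a\<close>
  and \<open>m + a\<close> change places.\<close>

lemma pair_swap_perms: "pair_swap m \<zeta> \<in> perms (2 * m)"
proof -
  have inv: "pair_swap m \<zeta> (pair_swap m \<zeta> a) = a" for a
    by (auto simp: pair_swap_def)
  have out: "pair_swap m \<zeta> a = a" if "a \<notin> {1..2 * m}" for a
    using that by (auto simp: pair_swap_def)
  have "pair_swap m \<zeta> permutes {1..2 * m}"
    unfolding permutes_def using inv out by metis
  then show ?thesis
    by (simp add: perms_def)
qed

text \<open>This is \<open>h_kernel\<close> at \<open>w i\<close>, \<open>w j\<close>,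
  \<open>w (m + i)\<close>, \<open>w (m + j)\<close>. If \<open>g\<close> is read as an inner
  product, it pairs the difference \<open>w i - w (m + i)\<close> with
  \<open>w j - w (m + j)\<close>, so swapping one pair flips the sign.\<close>

definition pair_kernel :: "('a \<Rightarrow> 'a \<Rightarrow> real) \<Rightarrow> nat \<Rightarrow> (nat \<Rightarrow> 'a) \<Rightarrow> nat \<Rightarrow> nat \<Rightarrow> real" where
  "pair_kernel g m w i j = g (w i) (w j) + g (w (m + i)) (w (m + j)) - g (w i) (w (m + j)) - g (w j) (w (m + i))"

lemma pair_kernel_swap:
  assumes g: "\<And>a b. g a b = g b a" and ij: "i \<in> {1..m}" "j \<in> {1..m}"
    and "\<zeta> i \<in> {-1, 1}" "\<zeta> j \<in> {-1, 1}"
  shows "pair_kernel g m (w \<circ> pair_swap m \<zeta>) i j = \<zeta> i * \<zeta> j * pair_kernel g m w i j"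
proof -
  have s: "pair_swap m \<zeta> k = (if \<zeta> k = -1 then m + k else k)"
    "pair_swap m \<zeta> (m + k) = (if \<zeta> k = -1 then k else m + k)" if "k \<in> {1..m}" for k
    using that by (auto simp: pair_swap_def)
  show ?thesis
    using assms(4,5) unfolding pair_kernel_def o_def s[OF ij(1)] s[OF ij(2)]
    by (auto simp: g)
qed

text \<open>The four kernel values belonging to \<open>(i, j)\<close> sit at four off-diagonal
  entries of the matrix of order \<open>2 * m\<close>, and different \<open>(i, j)\<close> share
  none, so the only loss is the factor 4 from squaring a sum of four terms.\<close>

lemma sum_pair_kernel_sq_le:
  fixes g :: "'a \<Rightarrow> 'a \<Rightarrow> real"
  assumes g: "\<And>a b. g a b = g b a"
  shows "(\<Sum>i=1..m. \<Sum>j\<in>{1..m} - {i}. (pair_kernel g m w i j)\<^sup>2)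
    \<le> 4 * (\<Sum>a=1..2 * m. \<Sum>b\<in>{1..2 * m} - {a}. (g (w a) (w b))\<^sup>2)"
proof -
  define f where "f = (\<lambda>a b. of_bool (b \<noteq> a) * (g (w a) (w b))\<^sup>2)"
  have four: "(x + y - z - t)\<^sup>2 \<le> 4 * (x\<^sup>2 + y\<^sup>2 + z\<^sup>2 + t\<^sup>2)" for x y z t :: real
  proof -
    have "4 * (x\<^sup>2 + y\<^sup>2 + z\<^sup>2 + t\<^sup>2) - (x + y - z - t)\<^sup>2
      = (x - y)\<^sup>2 + (x + z)\<^sup>2 + (x + t)\<^sup>2 + (y + z)\<^sup>2 + (y + t)\<^sup>2 + (z - t)\<^sup>2"
      by (simp add: power2_eq_square algebra_simps)
    then show ?thesis
      by (smt (verit) zero_le_power2)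
  qed
  have "(\<Sum>i=1..m. \<Sum>j\<in>{1..m} - {i}. (pair_kernel g m w i j)\<^sup>2)
    = (\<Sum>i=1..m. \<Sum>j=1..m. of_bool (j \<noteq> i) * (pair_kernel g m w i j)\<^sup>2)"
    by (simp only: sum_minus_singleton[OF finite_atLeastAtMost])
  also have "\<dots> \<le> (\<Sum>i=1..m. \<Sum>j=1..m. 4 * (f i j + f (m + i) (m + j) + f i (m + j) + f (m + i) j))"
  proof (intro sum_mono)
    fix i j assume "i \<in> {1..m}" "j \<in> {1..m}"
    then show "of_bool (j \<noteq> i) * (pair_kernel g m w i j)\<^sup>2
      \<le> 4 * (f i j + f (m + i) (m + j) + f i (m + j) + f (m + i) j)"
      using four[of "g (w i) (w j)" "g (w (m + i)) (w (m + j))" "g (w i) (w (m + j))" "g (w j) (w (m + i))"]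
      by (cases "i = j") (auto simp: f_def pair_kernel_def g[of "w j" "w (m + i)"])
  qed
  also have "\<dots> = 4 * (\<Sum>a=1..2 * m. \<Sum>b=1..2 * m. f a b)"
    unfolding sum_1_double by (simp add: sum.distrib sum_distrib_left algebra_simps)
  also have "\<dots> = 4 * (\<Sum>a=1..2 * m. \<Sum>b\<in>{1..2 * m} - {a}. (g (w a) (w b))\<^sup>2)"
    by (simp only: f_def sum_minus_singleton[OF finite_atLeastAtMost])
  finally show ?thesis .
qed

lemma U_stat_le_paired:
  assumes m: "2 \<le> m" and g: "\<And>a b. g a b = g b a" and nn: "\<And>a b. 0 \<le> g a b" and G: "0 < G"
    and bound: "(\<Sum>a=1..2 * m. \<Sum>b\<in>{1..2 * m} - {a}. (g (w a) (w b))\<^sup>2) \<le> G\<^sup>2"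
  shows "U_stat g m w (\<lambda>j. w (m + j))
    \<le> ((\<Sum>i=1..m. \<Sum>j\<in>{1..m} - {i}. pair_kernel g m w i j) + 2 * G) / (real m * (real m - 1))"
proof -
  define S where "S = (\<Sum>i=1..m. \<Sum>j\<in>{1..m} - {i}. g (w i) (w j) + g (w (m + i)) (w (m + j)))"
  define Q where "Q = (\<Sum>i=1..m. \<Sum>j\<in>{1..m} - {i}. g (w i) (w (m + j)))"
  define T where "T = (\<Sum>i=1..m. \<Sum>j=1..m. g (w i) (w (m + j)))"
  have pos: "real m > 0" "real m - 1 > 0"
    using m by auto
  have pk: "(\<Sum>i=1..m. \<Sum>j\<in>{1..m} - {i}. pair_kernel g m w i j) = S - 2 * Q"
  proof -
    have "(\<Sum>i=1..m. \<Sum>j\<in>{1..m} - {i}. g (w j) (w (m + i))) = Q"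
    proof -
      have "(\<Sum>i=1..m. \<Sum>j\<in>{1..m} - {i}. g (w j) (w (m + i)))
        = (\<Sum>j=1..m. \<Sum>i=1..m. of_bool (j \<noteq> i) * g (w j) (w (m + i)))"
        unfolding sum_minus_singleton[OF finite_atLeastAtMost] by (rule sum.swap)
      also have "\<dots> = Q"
        unfolding Q_def sum_minus_singleton[OF finite_atLeastAtMost] by (simp only: eq_commute)
      finally show ?thesis .
    qed
    then show ?thesis
      by (simp add: pair_kernel_def S_def Q_def sum.distrib sum_subtractf)
  qed
  have "Q \<le> T"
    unfolding Q_def T_def using nn by (intro sum_mono sum_mono2) auto
  have "Q \<le> real m * G"
  proof -
    define x where "x = (\<lambda>(i, j). g (w i) (w (m + j)))"
    have "Q\<^sup>2 = (\<Sum>p\<in>ordered_pairs m. 1 * x p)\<^sup>2"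
      unfolding Q_def sum_ordered_pairs[symmetric] by (simp add: x_def split_def)
    also have "\<dots> \<le> (\<Sum>p\<in>ordered_pairs m. 1\<^sup>2) * (\<Sum>p\<in>ordered_pairs m. (x p)\<^sup>2)"
      by (rule Cauchy_Schwarz_ineq_sum)
    also have "\<dots> = (real m * (real m - 1)) * (\<Sum>i=1..m. \<Sum>j\<in>{1..m} - {i}. (g (w i) (w (m + j)))\<^sup>2)"
      unfolding sum_ordered_pairs[symmetric] by (simp add: card_ordered_pairs x_def split_def)
    also have "\<dots> \<le> (real m)\<^sup>2 * G\<^sup>2"
    proof (intro mult_mono order.trans[OF _ bound])
      define f where "f = (\<lambda>a b. of_bool (b \<noteq> a) * (g (w a) (w b))\<^sup>2)"
      have f: "0 \<le> f a b" for a b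
        by (simp add: f_def)
      have "(\<Sum>i=1..m. \<Sum>j\<in>{1..m} - {i}. (g (w i) (w (m + j)))\<^sup>2) \<le> (\<Sum>i=1..m. \<Sum>j=1..m. f i (m + j))"
        by (intro sum_mono order.trans[OF sum_mono2[of "{1..m}"]]) (auto simp: f_def)
      also have "\<dots> \<le> (\<Sum>a=1..2 * m. \<Sum>b=1..2 * m. f a b)"
        unfolding sum_1_double sum.distrib using f by (simp add: sum_nonneg)
      also have "\<dots> = (\<Sum>a=1..2 * m. \<Sum>b\<in>{1..2 * m} - {a}. (g (w a) (w b))\<^sup>2)"
        by (simp only: f_def sum_minus_singleton[OF finite_atLeastAtMost])
      finally show "(\<Sum>i=1..m. \<Sum>j\<in>{1..m} - {i}. (g (w i) (w (m + j)))\<^sup>2) \<le> \<dots>" .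
      show "real m * (real m - 1) \<le> (real m)\<^sup>2"
        by (simp add: power2_eq_square algebra_simps)
    qed (auto intro!: sum_nonneg)
    finally have "Q\<^sup>2 \<le> (real m * G)\<^sup>2"
      by (simp add: power_mult_distrib)
    then show ?thesis
      by (rule power2_le_imp_le) (use G in auto)
  qed
  have "U_stat g m w (\<lambda>j. w (m + j)) = S / (real m * (real m - 1)) - 2 * T / (real m)\<^sup>2"
    unfolding U_stat_eq[OF m] S_def T_def ..
  also have "\<dots> \<le> S / (real m * (real m - 1)) - 2 * Q / (real m)\<^sup>2"
    using \<open>Q \<le> T\<close> by (simp add: divide_right_mono)
  also have "\<dots> = (S - 2 * Q) / (real m * (real m - 1)) + 2 * Q / ((real m)\<^sup>2 * (real m - 1))"
  proof -
    have eq: "S / (k * l) - 2 * Q / k\<^sup>2 = (S - 2 * Q) / (k * l) + 2 * Q / (k\<^sup>2 * l)"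
      if "k > 0" "l > 0" "k = l + 1" for k l :: real
    proof -
      have "2 * Q / k\<^sup>2 + 2 * Q / (k\<^sup>2 * l) = 2 * Q * (l + 1) / (k\<^sup>2 * l)"
        using that(1,2) by (simp add: field_simps)
      also have "\<dots> = 2 * Q / (k * l)"
        unfolding that(3)[symmetric] using that(1,2) by (simp add: power2_eq_square)
      finally show ?thesis
        by (simp add: diff_divide_distrib)
    qed
    show ?thesis
      by (rule eq) (use pos in auto)
  qed
  also have "2 * Q / ((real m)\<^sup>2 * (real m - 1)) \<le> 2 * (real m * G) / ((real m)\<^sup>2 * (real m - 1))"
    using \<open>Q \<le> real m * G\<close> pos by (intro divide_right_mono) auto
  also have "\<dots> = 2 * G / (real m * (real m - 1))"
    using pos by (simp add: power2_eq_square)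
  finally show ?thesis
    unfolding pk by (simp add: add_divide_distrib)
qed

theorem permuted_U_stat_tail:
  assumes m: "2 \<le> m" and g: "\<And>a b. g a b = g b a" and nn: "\<And>a b. 0 \<le> g a b" and G: "0 < G"
    and bound: "(\<Sum>a=1..2 * m. \<Sum>b\<in>{1..2 * m} - {a}. (g (w a) (w b))\<^sup>2) \<le> G\<^sup>2"
    and L: "1 \<le> L"
  shows "measure_pmf.prob (pmf_of_set (perms (2 * m)))
      {\<pi>. 40 * L * G / (real m)\<^sup>2 < U_stat g m (\<lambda>i. w (\<pi> i)) (\<lambda>j. w (\<pi> (m + j)))} \<le> exp (- L)"
proof -
  let ?P = "pmf_of_set (perms (2 * m))" and ?R = "Pi_pmf {1..m} 0 (\<lambda>_. rad)"
  define X where "X = (\<lambda>\<pi>. \<Sum>i=1..m. \<Sum>j\<in>{1..m} - {i}. pair_kernel g m (w \<circ> \<pi>) i j)"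
  \<comment> \<open>Permuting only reorders the squared entries, so one \<open>G\<close> serves all
    permutations.\<close>
  have boundp: "(\<Sum>a=1..2 * m. \<Sum>b\<in>{1..2 * m} - {a}. (g ((w \<circ> \<pi>) a) ((w \<circ> \<pi>) b))\<^sup>2) \<le> G\<^sup>2"
    if "\<pi> \<in> perms (2 * m)" for \<pi>
    using sum_offdiag_permute[of \<pi> "{1..2 * m}" "\<lambda>a b. (g (w a) (w b))\<^sup>2"] that bound
    by (simp add: perms_def)
  \<comment> \<open>The bound \<open>m\<^sup>2 \<le> 2 * m * (m - 1)\<close> turns 40 into 20, and
    the remainder \<open>2 * G \<le> 2 * L * G\<close> takes off another 2.\<close>
  have large: "18 * L * G < X \<pi>"
    if \<pi>: "\<pi> \<in> perms (2 * m)"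
      and U: "40 * L * G / (real m)\<^sup>2 < U_stat g m (\<lambda>i. w (\<pi> i)) (\<lambda>j. w (\<pi> (m + j)))" for \<pi>
  proof -
    let ?K = "real m * (real m - 1)"
    have K: "0 < ?K" "(real m)\<^sup>2 \<le> 2 * ?K" "0 < (real m)\<^sup>2"
      using m by (auto simp: power2_eq_square algebra_simps)
    have "20 * L * G / ?K = 40 * L * G / (2 * ?K)"
      by simp
    also have "\<dots> \<le> 40 * L * G / (real m)\<^sup>2"
    proof (intro divide_left_mono)
      show "0 < 2 * ?K * (real m)\<^sup>2"
        using K m by (intro mult_pos_pos) auto
    qed (use K L G in auto)
    also have "\<dots> < (X \<pi> + 2 * G) / ?K"
      using U U_stat_le_paired[where w = "w \<circ> \<pi>", OF m g nn G boundp[OF \<pi>]]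
      unfolding X_def by (simp add: o_def)
    finally have "20 * L * G < X \<pi> + 2 * G"
      using K by (simp add: divide_less_cancel)
    moreover have "G \<le> L * G"
      using G L by simp
    ultimately show ?thesis
      by linarith
  qed
  have swap: "X (\<pi> \<circ> pair_swap m \<zeta>) = (\<Sum>i=1..m. \<Sum>j\<in>{1..m} - {i}. \<zeta> i * \<zeta> j * pair_kernel g m (w \<circ> \<pi>) i j)"
    if "\<zeta> \<in> set_pmf ?R" for \<pi> \<zeta>
    unfolding X_def
  proof (intro sum.cong refl)
    fix i j assume ij: "i \<in> {1..m}" "j \<in> {1..m} - {i}"
    have "\<zeta> k \<in> {-1, 1}" if "k \<in> {1..m}" for k
      using \<open>\<zeta> \<in> set_pmf ?R\<close> that by (auto simp: set_Pi_pmf PiE_dflt_def set_rad)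
    then show "pair_kernel g m (w \<circ> (\<pi> \<circ> pair_swap m \<zeta>)) i j = \<zeta> i * \<zeta> j * pair_kernel g m (w \<circ> \<pi>) i j"
      using pair_kernel_swap[where w = "w \<circ> \<pi>", OF g] ij by (simp add: comp_assoc)
  qed
  have "measure_pmf.prob ?P {\<pi>. 40 * L * G / (real m)\<^sup>2 < U_stat g m (\<lambda>i. w (\<pi> i)) (\<lambda>j. w (\<pi> (m + j)))}
    \<le> expct ?P (\<lambda>\<pi>. of_bool (18 * L * G < X \<pi>))"
    unfolding expct_of_bool[symmetric] using large by (intro expct_mono) auto
  also have "\<dots> = expct ?R (\<lambda>\<zeta>. expct ?P (\<lambda>\<pi>. of_bool (18 * L * G < X (\<pi> \<circ> pair_swap m \<zeta>))))"
  proof -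
    have "expct ?P (\<lambda>\<pi>. of_bool (18 * L * G < X (\<pi> \<circ> pair_swap m \<zeta>))) = expct ?P (\<lambda>\<pi>. of_bool (18 * L * G < X \<pi>))" for \<zeta>
      by (subst (2) unif_perms_comp_right[OF pair_swap_perms[of m \<zeta>], symmetric]) (simp only: integral_map_pmf)
    then show ?thesis
      by simp
  qed
  also have "\<dots> = expct ?P (\<lambda>\<pi>. expct ?R (\<lambda>\<zeta>. of_bool (18 * L * G < X (\<pi> \<circ> pair_swap m \<zeta>))))"
    by (rule expct_swap) (auto simp: finite_Pi_rad)
  also have "\<dots> \<le> exp (- L)"
  proof (rule expct_le_const)
    fix \<pi> assume \<pi>: "\<pi> \<in> set_pmf ?P"
    define Y where "Y = (\<lambda>\<zeta>. \<Sum>i=1..m. \<Sum>j\<in>{1..m} - {i}. \<zeta> i * \<zeta> j * pair_kernel g m (w \<circ> \<pi>) i j)"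
    have "expct ?R (\<lambda>\<zeta>. of_bool (18 * L * G < X (\<pi> \<circ> pair_swap m \<zeta>)))
      \<le> expct ?R (\<lambda>\<zeta>. exp (- (9 / 4) * L) * exp (Y \<zeta> / (8 * G)))"
    proof (rule expct_mono)
      fix \<zeta> assume "\<zeta> \<in> set_pmf ?R"
      then have Y: "X (\<pi> \<circ> pair_swap m \<zeta>) = Y \<zeta>"
        using swap by (simp add: Y_def)
      \<comment> \<open>Chernoff bound at the scale of the chaos estimate, 18 / 8 = 9 / 4. The
        moment is at most \<open>exp (1/2) \<le> exp L\<close>, so the final exponent is at most
        \<open>- (5 / 4) * L\<close>.\<close>
      have "1 \<le> exp (- (9 / 4) * L) * exp (Y \<zeta> / (8 * G))" if "18 * L * G < Y \<zeta>"
        using that G by (simp add: exp_add[symmetric] field_simps)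
      then show "of_bool (18 * L * G < X (\<pi> \<circ> pair_swap m \<zeta>)) \<le> exp (- (9 / 4) * L) * exp (Y \<zeta> / (8 * G))"
        unfolding Y by simp
    qed (simp add: finite_Pi_rad)
    also have "\<dots> = exp (- (9 / 4) * L) * expct ?R (\<lambda>\<zeta>. exp (Y \<zeta> / (8 * G)))"
      by simp
    also have "\<dots> \<le> exp (- (9 / 4) * L) * ((1 + exp (1/2)) / 2)"
      unfolding Y_def
    proof (intro mult_left_mono expct_exp_chaos_le G)
      show "pair_kernel g m (w \<circ> \<pi>) i j = pair_kernel g m (w \<circ> \<pi>) j i" for i j
        by (simp add: pair_kernel_def g)
      show "(\<Sum>i=1..m. \<Sum>j\<in>{1..m} - {i}. (pair_kernel g m (w \<circ> \<pi>) i j)\<^sup>2) \<le> 4 * G\<^sup>2"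
        using sum_pair_kernel_sq_le[where w = "w \<circ> \<pi>" and g = g and m = m, OF g] boundp[of \<pi>] \<pi> by simp
    qed auto
    also have "\<dots> \<le> exp (- (9 / 4) * L) * exp L"
    proof (intro mult_left_mono)
      have "(1 + exp (1/2)) / 2 \<le> exp (1/2 :: real)"
      proof -
        have "1 \<le> exp (1/2 :: real)"
          by simp
        then show ?thesis
          by (simp add: field_simps)
      qed
      also have "\<dots> \<le> exp L"
        using L by simp
      finally show "(1 + exp (1/2)) / 2 \<le> exp L" .
    qed auto
    also have "\<dots> \<le> exp (- L)"
      using L by (simp add: exp_add[symmetric])
    finally show "expct ?R (\<lambda>\<zeta>. of_bool (18 * L * G < X (\<pi> \<circ> pair_swap m \<zeta>))) \<le> exp (- L)" .
  qed auto
  finally show ?thesis .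
qed

section \<open>Mean and variance of a weighted collision statistic\<close>

definition collision :: "('a \<Rightarrow> real) \<Rightarrow> 'a \<Rightarrow> 'a \<Rightarrow> real" where
  "collision V u v = V u * of_bool (u = v)"

lemma collision_commute: "collision V u v = collision V v u"
  by (simp add: collision_def)

text \<open>The free coefficients serve two purposes: \<open>split_coeff\<close> gives the
  statistic, and constant 1 with \<open>V\<close> squared gives the sum of squared kernel
  values.\<close>

definition collision_form :: "('a \<Rightarrow> real) \<Rightarrow> (nat \<Rightarrow> nat \<Rightarrow> real) \<Rightarrow> nat set \<Rightarrow> (nat \<Rightarrow> 'a) \<Rightarrow> real" where
  "collision_form V c I x = (\<Sum>a\<in>I. \<Sum>b\<in>I - {a}. c a b * collision V (x a) (x b))"

lemma sum_offdiag_insert: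
  fixes F :: "nat \<Rightarrow> nat \<Rightarrow> real"
  assumes "finite J" "a \<notin> J" "\<And>i j. F i j = F j i"
  shows "(\<Sum>i\<in>insert a J. \<Sum>j\<in>insert a J - {i}. F i j) = 2 * (\<Sum>j\<in>J. F a j) + (\<Sum>i\<in>J. \<Sum>j\<in>J - {i}. F i j)"
proof -
  have "(\<Sum>j\<in>insert a J - {i}. F i j) = F a i + (\<Sum>j\<in>J - {i}. F i j)" if "i \<in> J" for i
  proof -
    have "insert a J - {i} = insert a (J - {i})"
      using that assms(2) by auto
    then show ?thesis
      using assms by (simp add: assms(3)[of i a])
  qed
  moreover have "insert a J - {a} = J"
    using assms(2) by auto
  ultimately show ?thesis
    using assms(1,2) by (simp add: sum.distrib)
qed

context
  fixes I :: "nat set" and \<mu> :: "nat \<Rightarrow> 'a pmf" and K :: "'a set" and V :: "'a \<Rightarrow> real"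
    and c :: "nat \<Rightarrow> nat \<Rightarrow> real" and d :: 'a
  assumes finI: "finite I" and finK: "finite K" and supp: "\<And>a. a \<in> I \<Longrightarrow> set_pmf (\<mu> a) \<subseteq> K"
begin

lemma finite_supp: "a \<in> I \<Longrightarrow> finite (set_pmf (\<mu> a))"
  using supp finK finite_subset by blast

lemma expct_finite_supp: "a \<in> I \<Longrightarrow> expct (\<mu> a) f = (\<Sum>k\<in>K. f k * pmf (\<mu> a) k)"
  using supp finK by (intro integral_measure_pmf_real) auto

lemma expct_collision:
  assumes "a \<in> I" "b \<in> I" "a \<noteq> b"
  shows "expct (Pi_pmf I d \<mu>) (\<lambda>x. collision V (x a) (x b)) = (\<Sum>k\<in>K. V k * pmf (\<mu> a) k * pmf (\<mu> b) k)"
proof -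
  let ?P = "Pi_pmf (I - {a}) d \<mu>"
  have "expct ?P (\<lambda>x. of_bool (y = x b)) = pmf (\<mu> b) y" for y
  proof -
    have "expct ?P (\<lambda>x. of_bool (y = x b)) = expct (\<mu> b) (\<lambda>z. of_bool (y = z))"
      by (rule expct_Pi_component) (use assms finI in auto)
    then show ?thesis
      by (simp add: expct_of_bool measure_pmf_single eq_commute[of y])
  qed
  then have "expct (Pi_pmf I d \<mu>) (\<lambda>x. collision V (x a) (x b)) = expct (\<mu> a) (\<lambda>y. V y * pmf (\<mu> b) y)"
    using assms finI finite_supp by (subst expct_Pi_split[of I a]) (auto simp: collision_def)
  then show ?thesis
    using assms by (simp add: expct_finite_supp mult_ac)
qed

lemma expct_collision_form:
  "expct (Pi_pmf I d \<mu>) (collision_form V c I)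
    = (\<Sum>a\<in>I. \<Sum>b\<in>I - {a}. c a b * (\<Sum>k\<in>K. V k * pmf (\<mu> a) k * pmf (\<mu> b) k))"
proof -
  have fin: "finite (set_pmf (Pi_pmf I d \<mu>))"
    by (rule finite_set_Pi_pmf[OF finI finite_supp])
  have "expct (Pi_pmf I d \<mu>) (collision_form V c I)
    = (\<Sum>a\<in>I. \<Sum>b\<in>I - {a}. c a b * expct (Pi_pmf I d \<mu>) (\<lambda>x. collision V (x a) (x b)))"
    unfolding collision_form_def by (simp add: expct_sum[OF fin])
  then show ?thesis
    by (simp add: expct_collision cong: sum.cong_simp)
qed

text \<open>Efron-Stein with index \<open>a\<close> deleted from the form. By symmetry of
  \<open>c\<close> the difference is twice the row of \<open>a\<close>; once \<open>x a\<close> is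
  frozen at \<open>k\<close>, this row is a weighted count of the other coordinates equal to
  \<open>k\<close>.\<close>

lemma variance_collision_form_le:
  assumes c: "\<And>a b. c a b = c b a"
  shows "expct (Pi_pmf I d \<mu>) (\<lambda>x. (collision_form V c I x)\<^sup>2) - (expct (Pi_pmf I d \<mu>) (collision_form V c I))\<^sup>2
    \<le> 4 * (\<Sum>a\<in>I. \<Sum>k\<in>K. pmf (\<mu> a) k * (V k)\<^sup>2 *
        ((\<Sum>b\<in>I - {a}. c a b * pmf (\<mu> b) k)\<^sup>2 + (\<Sum>b\<in>I - {a}. (c a b)\<^sup>2 * pmf (\<mu> b) k)))"
proof -
  let ?P = "Pi_pmf I d \<mu>"
  define f0 where "f0 = (\<lambda>a. collision_form V c (I - {a}))"
  have "expct ?P (\<lambda>x. (collision_form V c I x)\<^sup>2) - (expct ?P (collision_form V c I))\<^sup>2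
      \<le> (\<Sum>a\<in>I. expct ?P (\<lambda>x. (collision_form V c I x - f0 a x)\<^sup>2))"
    by (rule efron_stein) (auto simp: finI finite_supp f0_def collision_form_def intro!: sum.cong)
  also have "\<dots> \<le> (\<Sum>a\<in>I. 4 * (\<Sum>k\<in>K. pmf (\<mu> a) k * (V k)\<^sup>2 *
        ((\<Sum>b\<in>I - {a}. c a b * pmf (\<mu> b) k)\<^sup>2 + (\<Sum>b\<in>I - {a}. (c a b)\<^sup>2 * pmf (\<mu> b) k))))"
  proof (rule sum_mono)
    fix a assume a: "a \<in> I"
    let ?J = "I - {a}"
    have I: "insert a ?J = I"
      using a by auto
    have "collision_form V c I x - f0 a x = 2 * (\<Sum>b\<in>?J. c a b * collision V (x a) (x b))" for x
    proof -
      have "c i j * collision V (x i) (x j) = c j i * collision V (x j) (x i)" for i j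
        by (simp add: c[of i j] collision_commute[of V "x i"])
      then show ?thesis
        using sum_offdiag_insert[of ?J a "\<lambda>a b. c a b * collision V (x a) (x b)"] finI
        unfolding I f0_def collision_form_def by simp
    qed
    then have "expct ?P (\<lambda>x. (collision_form V c I x - f0 a x)\<^sup>2)
        = expct ?P (\<lambda>x. 4 * (V (x a))\<^sup>2 * (\<Sum>b\<in>?J. c a b * of_bool (x b = x a))\<^sup>2)"
      by (intro expct_cong)
        (simp add: collision_def power_mult_distrib sum_distrib_left[symmetric] mult.left_commute eq_commute)
    also have "\<dots> = expct (\<mu> a) (\<lambda>y. 4 * (V y)\<^sup>2 * expct (Pi_pmf ?J d \<mu>) (\<lambda>x. (\<Sum>b\<in>?J. c a b * of_bool (x b = y))\<^sup>2))"
    proof (subst expct_Pi_split[OF finI a finite_supp], assumption, intro expct_cong)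
      fix y :: 'a
      have "(\<Sum>b\<in>?J. c a b * of_bool ((x(a := y)) b = (x(a := y)) a)) = (\<Sum>b\<in>?J. c a b * of_bool (x b = y))" for x
        by (intro sum.cong) auto
      then show "expct (Pi_pmf ?J d \<mu>) (\<lambda>x. 4 * (V ((x(a := y)) a))\<^sup>2 * (\<Sum>b\<in>?J. c a b * of_bool ((x(a := y)) b = (x(a := y)) a))\<^sup>2)
        = 4 * (V y)\<^sup>2 * expct (Pi_pmf ?J d \<mu>) (\<lambda>x. (\<Sum>b\<in>?J. c a b * of_bool (x b = y))\<^sup>2)"
        by simp
    qed
    also have "\<dots> \<le> expct (\<mu> a) (\<lambda>y. 4 * (V y)\<^sup>2 *
        ((\<Sum>b\<in>?J. c a b * pmf (\<mu> b) y)\<^sup>2 + (\<Sum>b\<in>?J. (c a b)\<^sup>2 * pmf (\<mu> b) y)))"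
      using finI finite_supp
      by (intro expct_mono finite_supp[OF a] mult_left_mono expct_sq_indicator_sum_le) auto
    also have "\<dots> = 4 * (\<Sum>k\<in>K. pmf (\<mu> a) k * (V k)\<^sup>2 *
        ((\<Sum>b\<in>?J. c a b * pmf (\<mu> b) k)\<^sup>2 + (\<Sum>b\<in>?J. (c a b)\<^sup>2 * pmf (\<mu> b) k)))"
      unfolding expct_finite_supp[OF a] sum_distrib_left by (intro sum.cong) (auto simp: mult_ac)
    finally show "expct ?P (\<lambda>x. (collision_form V c I x - f0 a x)\<^sup>2) \<le> \<dots>" .
  qed
  finally show ?thesis
    by (simp add: sum_distrib_left)
qed

end

section \<open>The two-sample statistic with fixed weights\<close>

text \<open>The matrix of the statistic as one quadratic form in the pooled sample. The cross
  coefficient \<open>- 2 / m\<^sup>2\<close> is shared between the entries \<open>(a, b)\<close> and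
  \<open>(b, a)\<close>.\<close>

definition split_coeff :: "nat \<Rightarrow> nat \<Rightarrow> nat \<Rightarrow> real" where
  "split_coeff m a b = (if (a \<le> m) = (b \<le> m) then 1 / (real m * (real m - 1)) else - 1 / (real m)\<^sup>2)"

lemma split_coeff_commute: "split_coeff m a b = split_coeff m b a"
  by (auto simp: split_coeff_def)

lemma U_stat_collision:
  assumes m: "2 \<le> m"
  shows "U_stat (collision V) m x (\<lambda>j. x (m + j)) = collision_form V (split_coeff m) {1..2 * m} x"
proof -
  define g where "g = (\<lambda>a b. collision V (x a) (x b))"
  have g: "g a b = g b a" for a b
    by (simp add: g_def collision_commute)
  define N where "N = real m * (real m - 1)"
  let ?F = "\<lambda>a b. of_bool (b \<noteq> a) * (split_coeff m a b * g a b)"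
  have "collision_form V (split_coeff m) {1..2 * m} x = (\<Sum>a=1..2 * m. \<Sum>b=1..2 * m. ?F a b)"
    unfolding collision_form_def sum_minus_singleton[OF finite_atLeastAtMost] g_def ..
  also have "\<dots> = (\<Sum>i=1..m. \<Sum>j=1..m. ?F i j) + (\<Sum>i=1..m. \<Sum>j=1..m. ?F i (m + j))
      + ((\<Sum>i=1..m. \<Sum>j=1..m. ?F (m + i) j) + (\<Sum>i=1..m. \<Sum>j=1..m. ?F (m + i) (m + j)))"
    unfolding sum_1_double sum.distrib by linarith
  also have "(\<Sum>i=1..m. \<Sum>j=1..m. ?F i j) = (\<Sum>i=1..m. \<Sum>j=1..m. of_bool (j \<noteq> i) * g i j) / N"
    unfolding sum_divide_distrib by (intro sum.cong) (auto simp: split_coeff_def N_def)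
  also have "(\<Sum>i=1..m. \<Sum>j=1..m. ?F (m + i) (m + j)) = (\<Sum>i=1..m. \<Sum>j=1..m. of_bool (j \<noteq> i) * g (m + i) (m + j)) / N"
    unfolding sum_divide_distrib by (intro sum.cong) (auto simp: split_coeff_def N_def)
  also have "(\<Sum>i=1..m. \<Sum>j=1..m. ?F i (m + j)) = - (\<Sum>i=1..m. \<Sum>j=1..m. g i (m + j)) / (real m)\<^sup>2"
    unfolding sum_divide_distrib sum_negf[symmetric] by (intro sum.cong) (auto simp: split_coeff_def)
  also have "(\<Sum>i=1..m. \<Sum>j=1..m. ?F (m + i) j) = - (\<Sum>i=1..m. \<Sum>j=1..m. g i (m + j)) / (real m)\<^sup>2"
    unfolding sum_divide_distrib sum_negf[symmetric]
    by (subst sum.swap, intro sum.cong) (auto simp: split_coeff_def g)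
  finally show ?thesis
    unfolding U_stat_eq[OF m] sum_minus_singleton[OF finite_atLeastAtMost]
    by (simp add: g_def N_def sum.distrib distrib_left add_divide_distrib)
qed

lemma sum_two_valued:
  fixes \<alpha> \<beta> :: real
  shows "(\<Sum>a=1..2 * m. if a \<le> m then \<alpha> else \<beta>) = real m * \<alpha> + real m * \<beta>"
proof -
  have "(\<Sum>i=1..m. if i \<le> m then \<alpha> else \<beta>) = (\<Sum>i=1..m. \<alpha>)"
    "(\<Sum>i=1..m. if m + i \<le> m then \<alpha> else \<beta>) = (\<Sum>i=1..m. \<beta>)"
    by (intro sum.cong; auto)+
  then show ?thesis
    unfolding sum_1_double by simp
qed

lemma sum_two_valued_minus:
  fixes \<alpha> \<beta> :: real
  assumes "a \<in> {1..2 * m}"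
  shows "(\<Sum>b\<in>{1..2 * m} - {a}. if b \<le> m then \<alpha> else \<beta>)
    = real m * \<alpha> + real m * \<beta> - (if a \<le> m then \<alpha> else \<beta>)"
  using assms by (simp add: sum_diff1 sum_two_valued[simplified])

text \<open>\<open>V\<close> stands for the inverse weights once these are fixed;
  \<open>signal\<close> and \<open>noise\<close> below are the \<open>S\<close> and \<Psi> of the
  overview.\<close>

locale two_samples =
  fixes p q :: "'a pmf" and K :: "'a set" and V :: "'a \<Rightarrow> real" and m :: nat and d :: 'a
  assumes finK: "finite K" and supp_p: "set_pmf p \<subseteq> K" and supp_q: "set_pmf q \<subseteq> K"
    and V_nonneg: "\<And>k. 0 \<le> V k" and m: "2 \<le> m"
begin

definition law :: "nat \<Rightarrow> 'a pmf" where
  "law a = (if a \<le> m then p else q)"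

definition U :: "(nat \<Rightarrow> 'a) \<Rightarrow> real" where
  "U = collision_form V (split_coeff m) {1..2 * m}"

abbreviation joint :: "(nat \<Rightarrow> 'a) pmf" where
  "joint \<equiv> Pi_pmf {1..2 * m} d law"

definition signal :: real where
  "signal = (\<Sum>k\<in>K. V k * (pmf p k - pmf q k)\<^sup>2)"

definition noise :: real where
  "noise = (\<Sum>k\<in>K. (V k)\<^sup>2 * ((pmf p k)\<^sup>2 + (pmf q k)\<^sup>2))"

lemma supp_law: "set_pmf (law a) \<subseteq> K"
  using supp_p supp_q by (simp add: law_def)

lemma finite_joint: "finite (set_pmf joint)"
  using supp_law finK finite_subset by (intro finite_set_Pi_pmf) blast+

lemma noise_nonneg: "0 \<le> noise"
  unfolding noise_def by (intro sum_nonneg) auto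

lemma m_pos: "0 < real m" "0 < real m - 1"
  using m by auto

text \<open>Seen from \<open>a\<close>, its own sample has \<open>m - 1\<close> coefficients
  \<open>1 / (m * (m - 1))\<close> and the other sample \<open>m\<close> coefficients
  \<open>- 1 / m\<^sup>2\<close>. Both groups have total mass \<open>1 / m\<close>, with opposite
  signs, so only \<open>p - q\<close> survives. This cancellation is what ties the first-order part
  of the variance to the signal.\<close>

lemma sum_coeff_law:
  assumes "a \<in> {1..2 * m}"
  shows "(\<Sum>b\<in>{1..2 * m} - {a}. split_coeff m a b * pmf (law b) k)
    = (if a \<le> m then 1 else - 1) * (pmf p k - pmf q k) / real m"
proof -
  have gen: "k * (x / (k * l)) + k * (- y / k\<^sup>2) - x / (k * l) = (x - y) / k"
    if "k > 0" "l > 0" "l = k - 1" for k l x y :: real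
  proof -
    have "k * (x / (k * l)) + k * (- y / k\<^sup>2) - x / (k * l) = (k - 1) * x / (k * l) - y / k"
      using that(1,2) by (simp add: field_simps power2_eq_square)
    then show ?thesis
      using that by (simp add: diff_divide_distrib)
  qed
  have "(\<Sum>b\<in>{1..2 * m} - {a}. split_coeff m a b * pmf (law b) k)
    = (\<Sum>b\<in>{1..2 * m} - {a}. if b \<le> m then split_coeff m a 1 * pmf p k else split_coeff m a (2 * m) * pmf q k)"
    using m by (intro sum.cong) (auto simp: split_coeff_def law_def)
  also have "\<dots> = (if a \<le> m then 1 else - 1) * (pmf p k - pmf q k) / real m"
    unfolding sum_two_valued_minus[OF assms]
    using m gen[OF m_pos, of "pmf p k" "pmf q k"] gen[OF m_pos, of "pmf q k" "pmf p k"]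
    by (auto simp: split_coeff_def algebra_simps)
  finally show ?thesis .
qed

text \<open>The own sample contributes \<open>pmf (law a) k / (m\<^sup>2 * (m - 1))\<close>, and
  \<open>m \<le> 3 * (m - 1)\<close> makes this at most \<open>3 * pmf (law a) k / m ^ 3\<close>;
  one third of it completes the symmetric term \<open>p + q\<close>.\<close>

lemma sum_coeff_sq_law_le:
  assumes "a \<in> {1..2 * m}"
  shows "(\<Sum>b\<in>{1..2 * m} - {a}. (split_coeff m a b)\<^sup>2 * pmf (law b) k)
    \<le> (2 * pmf (law a) k + (pmf p k + pmf q k)) / real m ^ 3"
proof -
  have gen: "k * (x / (k * l)\<^sup>2) + k * (y / k ^ 4) - x / (k * l)\<^sup>2 \<le> (2 * x + (x + y)) / k ^ 3"
    if "k \<ge> 2" "l = k - 1" "x \<ge> 0" for k l x y :: real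
  proof -
    have "k * (x / (k * l)\<^sup>2) + k * (y / k ^ 4) - x / (k * l)\<^sup>2 = x / (k\<^sup>2 * l) + y / k ^ 3"
    proof -
      have "k * (x / (k * l)\<^sup>2) - x / (k * l)\<^sup>2 = l * x / (k * l)\<^sup>2"
        using that(2) by (simp add: diff_divide_distrib left_diff_distrib)
      also have "\<dots> = x / (k\<^sup>2 * l)"
        using that by (simp add: power2_eq_square)
      moreover have "k * (y / k ^ 4) = y / k ^ 3"
        using that by (simp add: power4_eq_xxxx power3_eq_cube)
      ultimately show ?thesis by simp
    qed
    also have "x / (k\<^sup>2 * l) \<le> 3 * x / k ^ 3"
    proof -
      have "x * k \<le> x * (3 * l)"
        using that by (intro mult_left_mono) auto
      then have "x * k \<le> 3 * x * l"
        by (simp only: mult_ac)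
      then have "x * k * k\<^sup>2 \<le> 3 * x * l * k\<^sup>2"
        by (intro mult_right_mono) auto
      moreover have "0 < k" "0 < l"
        using that by auto
      ultimately show ?thesis
        by (simp add: field_simps power3_eq_cube power2_eq_square)
    qed
    finally show ?thesis
      by (simp add: add_divide_distrib)
  qed
  have m2: "real m \<ge> 2"
    using m by simp
  have "(\<Sum>b\<in>{1..2 * m} - {a}. (split_coeff m a b)\<^sup>2 * pmf (law b) k)
    = (\<Sum>b\<in>{1..2 * m} - {a}. if b \<le> m then (split_coeff m a 1)\<^sup>2 * pmf p k else (split_coeff m a (2 * m))\<^sup>2 * pmf q k)"
    using m by (intro sum.cong) (auto simp: split_coeff_def law_def)
  also have "\<dots> \<le> (2 * pmf (law a) k + (pmf p k + pmf q k)) / real m ^ 3"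
    unfolding sum_two_valued_minus[OF assms]
    using m gen[OF m2 refl, of "pmf p k" "pmf q k"] gen[OF m2 refl, of "pmf q k" "pmf p k"]
    by (auto simp: split_coeff_def law_def power_divide power_mult[symmetric] algebra_simps)
  finally show ?thesis .
qed

lemma expct_U: "expct joint U = signal"
proof -
  have "expct joint U = (\<Sum>a=1..2 * m. \<Sum>b\<in>{1..2 * m} - {a}. split_coeff m a b * (\<Sum>k\<in>K. V k * pmf (law a) k * pmf (law b) k))"
    unfolding U_def by (intro expct_collision_form finK supp_law) auto
  also have "\<dots> = (\<Sum>a=1..2 * m. \<Sum>k\<in>K. V k * pmf (law a) k * (\<Sum>b\<in>{1..2 * m} - {a}. split_coeff m a b * pmf (law b) k))"
    unfolding sum_distrib_left by (subst sum.swap) (simp add: mult_ac)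
  also have "\<dots> = (\<Sum>a=1..2 * m. if a \<le> m then (\<Sum>k\<in>K. V k * pmf p k * ((pmf p k - pmf q k) / real m))
      else (\<Sum>k\<in>K. V k * pmf q k * (- (pmf p k - pmf q k) / real m)))"
  proof (rule sum.cong[OF refl])
    fix a assume "a \<in> {1..2 * m}"
    note sum_coeff_law[OF this]
    then show "(\<Sum>k\<in>K. V k * pmf (law a) k * (\<Sum>b\<in>{1..2 * m} - {a}. split_coeff m a b * pmf (law b) k))
      = (if a \<le> m then (\<Sum>k\<in>K. V k * pmf p k * ((pmf p k - pmf q k) / real m))
         else (\<Sum>k\<in>K. V k * pmf q k * (- (pmf p k - pmf q k) / real m)))"
      by (cases "a \<le> m") (simp_all add: law_def)
  qed
  also have "\<dots> = signal"
    unfolding sum_two_valued signal_def sum_distrib_left sum.distrib[symmetric]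
    using m_pos by (intro sum.cong) (auto simp: field_simps power2_eq_square)
  finally show ?thesis .
qed

text \<open>The first-order part of the variance is the sum of
  \<open>V\<^sup>2 * (p + q) * (p - q)\<^sup>2 / m\<close>, which is \<open>signal\<close> times a
  factor \<open>V * (p + q)\<close> of order at most \<open>sqrt noise\<close>; the second-order
  part has order \<open>noise / m\<^sup>2\<close>. The free \<delta> comes from the
  arithmetic-geometric inequality that separates \<open>signal\<close> from
  \<open>sqrt noise\<close>. After Chebyshev it costs \<open>8 * \<delta>\<close>, so it is later a
  small multiple of \<beta>.\<close>

lemma variance_U_le:
  assumes S: "0 < signal" and \<delta>: "0 < \<delta>"
  shows "expct joint (\<lambda>x. (U x - signal)\<^sup>2)
    \<le> 2 * \<delta> * signal\<^sup>2 + 4 * noise / ((real m)\<^sup>2 * \<delta>) + 16 * noise / (real m)\<^sup>2"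
proof -
  define P where "P = (\<lambda>k. pmf p k)"
  define Q where "Q = (\<lambda>k. pmf q k)"
  define M where "M = real m"
  have M: "0 < M"
    using m by (simp add: M_def)
  have "expct joint (\<lambda>x. (U x - signal)\<^sup>2) = expct joint (\<lambda>x. (U x)\<^sup>2 - 2 * signal * U x + signal\<^sup>2)"
    by (intro expct_cong) (simp add: power2_diff)
  also have "\<dots> = expct joint (\<lambda>x. (U x)\<^sup>2) - (expct joint U)\<^sup>2"
    unfolding expct_diff[OF finite_joint] expct_add[OF finite_joint] expct_U
    by (simp add: expct_U[simplified] power2_eq_square)
  also have "\<dots> \<le> 4 * (\<Sum>a=1..2 * m. \<Sum>k\<in>K. pmf (law a) k * (V k)\<^sup>2 *
        ((\<Sum>b\<in>{1..2 * m} - {a}. split_coeff m a b * pmf (law b) k)\<^sup>2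
          + (\<Sum>b\<in>{1..2 * m} - {a}. (split_coeff m a b)\<^sup>2 * pmf (law b) k)))"
    unfolding U_def by (intro variance_collision_form_le finK supp_law split_coeff_commute) auto
  also have "\<dots> \<le> 4 * (\<Sum>a=1..2 * m. \<Sum>k\<in>K. pmf (law a) k * (V k)\<^sup>2 *
        ((P k - Q k)\<^sup>2 / M\<^sup>2 + (2 * pmf (law a) k + (P k + Q k)) / M ^ 3))"
  proof (intro mult_left_mono sum_mono add_mono)
    fix a k assume a: "a \<in> {1..2 * m}"
    show "(\<Sum>b\<in>{1..2 * m} - {a}. split_coeff m a b * pmf (law b) k)\<^sup>2 \<le> (P k - Q k)\<^sup>2 / M\<^sup>2"
      unfolding sum_coeff_law[OF a] by (simp add: P_def Q_def M_def power_divide power2_commute)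
    show "(\<Sum>b\<in>{1..2 * m} - {a}. (split_coeff m a b)\<^sup>2 * pmf (law b) k)
      \<le> (2 * pmf (law a) k + (P k + Q k)) / M ^ 3"
      unfolding P_def Q_def M_def by (rule sum_coeff_sq_law_le[OF a])
  qed auto
  also have "(\<Sum>a=1..2 * m. \<Sum>k\<in>K. pmf (law a) k * (V k)\<^sup>2 *
        ((P k - Q k)\<^sup>2 / M\<^sup>2 + (2 * pmf (law a) k + (P k + Q k)) / M ^ 3))
    = (\<Sum>a=1..2 * m. if a \<le> m
        then \<Sum>k\<in>K. P k * (V k)\<^sup>2 * ((P k - Q k)\<^sup>2 / M\<^sup>2 + (2 * P k + (P k + Q k)) / M ^ 3)
        else \<Sum>k\<in>K. Q k * (V k)\<^sup>2 * ((P k - Q k)\<^sup>2 / M\<^sup>2 + (2 * Q k + (P k + Q k)) / M ^ 3))"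
    by (rule sum.cong[OF refl]) (simp add: law_def P_def Q_def)
  also have "4 * \<dots> = (\<Sum>k\<in>K. 4 * (V k)\<^sup>2 * ((P k + Q k) * (P k - Q k)\<^sup>2 / M
      + (3 * (P k)\<^sup>2 + 2 * P k * Q k + 3 * (Q k)\<^sup>2) / M\<^sup>2))"
    unfolding sum_two_valued M_def[symmetric] unfolding sum_distrib_left sum.distrib[symmetric]
    using M by (intro sum.cong) (auto simp: field_simps power2_eq_square power3_eq_cube)
  also have "\<dots> \<le> (\<Sum>k\<in>K. (2 * \<delta> * signal + 4 * noise / (M\<^sup>2 * \<delta> * signal)) * (V k * (P k - Q k)\<^sup>2)
      + 16 * ((V k)\<^sup>2 * ((P k)\<^sup>2 + (Q k)\<^sup>2)) / M\<^sup>2)"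
  proof (rule sum_mono)
    fix k assume k: "k \<in> K"
    have pq: "0 \<le> P k" "0 \<le> Q k" "0 \<le> V k"
      by (simp_all add: P_def Q_def V_nonneg)
    have "(V k)\<^sup>2 * (P k + Q k)\<^sup>2 \<le> 2 * ((V k)\<^sup>2 * ((P k)\<^sup>2 + (Q k)\<^sup>2))"
    proof -
      have "(P k + Q k)\<^sup>2 \<le> 2 * ((P k)\<^sup>2 + (Q k)\<^sup>2)"
        using sum_squares_bound[of "P k" "Q k"] by (simp add: power2_sum)
      from mult_left_mono[OF this, of "(V k)\<^sup>2"] show ?thesis
        by (simp add: algebra_simps)
    qed
    also have "(V k)\<^sup>2 * ((P k)\<^sup>2 + (Q k)\<^sup>2) \<le> noise"
      unfolding noise_def P_def Q_def using finK k
      by (intro member_le_sum[of k K "\<lambda>k. (V k)\<^sup>2 * ((pmf p k)\<^sup>2 + (pmf q k)\<^sup>2)"]) auto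
    finally have VN: "(V k * (P k + Q k))\<^sup>2 \<le> 2 * noise"
      by (simp add: power_mult_distrib)
    have "4 * (V k * (P k + Q k)) / M \<le> 2 * \<delta> * signal + 4 * noise / (M\<^sup>2 * \<delta> * signal)"
    proof -
      have "4 * (V k * (P k + Q k)) / M
          \<le> 2 * (\<delta> * signal) + 2 * ((V k * (P k + Q k)) / M)\<^sup>2 / (\<delta> * signal)"
      proof -
        have "4 * y \<le> 2 * x + 2 * y\<^sup>2 / x" if "0 < x" for x y :: real
        proof -
          have "0 \<le> 2 * (x - y)\<^sup>2 / x"
            using that by simp
          also have "\<dots> = 2 * x + 2 * y\<^sup>2 / x - 4 * y"
            using that by (simp add: field_simps power2_eq_square)
          finally show ?thesis by simp
        qed
        from this[of "\<delta> * signal" "V k * (P k + Q k) / M"] show ?thesis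
          using S \<delta> by simp
      qed
      also have "2 * ((V k * (P k + Q k)) / M)\<^sup>2 / (\<delta> * signal) \<le> 2 * (2 * noise / M\<^sup>2) / (\<delta> * signal)"
        unfolding power_divide using VN S \<delta> by (intro divide_right_mono mult_left_mono) auto
      finally show ?thesis
        by (simp add: mult_ac)
    qed
    from mult_right_mono[OF this, of "V k * (P k - Q k)\<^sup>2"]
    have 1: "4 * (V k)\<^sup>2 * ((P k + Q k) * (P k - Q k)\<^sup>2 / M)
      \<le> (2 * \<delta> * signal + 4 * noise / (M\<^sup>2 * \<delta> * signal)) * (V k * (P k - Q k)\<^sup>2)"
      using pq by (simp add: power2_eq_square mult_ac)
    have "3 * (P k)\<^sup>2 + 2 * P k * Q k + 3 * (Q k)\<^sup>2 \<le> 4 * ((P k)\<^sup>2 + (Q k)\<^sup>2)"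
      using sum_squares_bound[of "P k" "Q k"] by simp
    then have "4 * (V k)\<^sup>2 * ((3 * (P k)\<^sup>2 + 2 * P k * Q k + 3 * (Q k)\<^sup>2) / M\<^sup>2)
      \<le> 4 * (V k)\<^sup>2 * ((4 * ((P k)\<^sup>2 + (Q k)\<^sup>2)) / M\<^sup>2)"
      by (intro mult_left_mono divide_right_mono) auto
    also have "\<dots> = 16 * ((V k)\<^sup>2 * ((P k)\<^sup>2 + (Q k)\<^sup>2)) / M\<^sup>2"
      by (simp add: algebra_simps)
    finally have 2: "4 * (V k)\<^sup>2 * ((3 * (P k)\<^sup>2 + 2 * P k * Q k + 3 * (Q k)\<^sup>2) / M\<^sup>2)
      \<le> 16 * ((V k)\<^sup>2 * ((P k)\<^sup>2 + (Q k)\<^sup>2)) / M\<^sup>2" .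
    show "4 * (V k)\<^sup>2 * ((P k + Q k) * (P k - Q k)\<^sup>2 / M + (3 * (P k)\<^sup>2 + 2 * P k * Q k + 3 * (Q k)\<^sup>2) / M\<^sup>2)
      \<le> (2 * \<delta> * signal + 4 * noise / (M\<^sup>2 * \<delta> * signal)) * (V k * (P k - Q k)\<^sup>2)
      + 16 * ((V k)\<^sup>2 * ((P k)\<^sup>2 + (Q k)\<^sup>2)) / M\<^sup>2"
      unfolding distrib_left[of "4 * (V k)\<^sup>2"] by (rule add_mono[OF 1 2])
  qed
  also have "\<dots> = (2 * \<delta> * signal + 4 * noise / (M\<^sup>2 * \<delta> * signal)) * signal + 16 * noise / M\<^sup>2"
    by (simp add: sum.distrib signal_def noise_def P_def Q_def sum_distrib_left sum_divide_distrib)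
  also have "\<dots> = 2 * \<delta> * signal\<^sup>2 + 4 * noise / (M\<^sup>2 * \<delta>) + 16 * noise / M\<^sup>2"
    using S M \<delta> by (simp add: field_simps power2_eq_square)
  finally show ?thesis
    by (simp add: M_def)
qed

text \<open>Squaring a collision kernel squares \<open>V\<close>, so the sum is again a collision
  form. As \<open>x * y \<le> x\<^sup>2 + y\<^sup>2\<close>, each of the at most
  \<open>(2 * m)\<^sup>2\<close> ordered pairs contributes at most \<open>noise\<close>.\<close>

lemma expct_collision_sq_le:
  "expct joint (\<lambda>x. \<Sum>a=1..2 * m. \<Sum>b\<in>{1..2 * m} - {a}. (collision V (x a) (x b))\<^sup>2) \<le> 4 * (real m)\<^sup>2 * noise"
proof -
  let ?I = "{1..2 * m}"
  have "(collision V u v)\<^sup>2 = collision (\<lambda>k. (V k)\<^sup>2) u v" for u v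
    by (simp add: collision_def)
  then have "(\<lambda>x. \<Sum>a\<in>?I. \<Sum>b\<in>?I - {a}. (collision V (x a) (x b))\<^sup>2) = collision_form (\<lambda>k. (V k)\<^sup>2) (\<lambda>_ _. 1) ?I"
    by (intro ext) (simp add: collision_form_def)
  then have "expct joint (\<lambda>x. \<Sum>a\<in>?I. \<Sum>b\<in>?I - {a}. (collision V (x a) (x b))\<^sup>2)
      = (\<Sum>a\<in>?I. \<Sum>b\<in>?I - {a}. 1 * (\<Sum>k\<in>K. (V k)\<^sup>2 * pmf (law a) k * pmf (law b) k))"
    by (simp only:) (intro expct_collision_form finK supp_law; simp)
  also have "\<dots> \<le> (\<Sum>a\<in>?I. \<Sum>b\<in>?I. noise)"
  proof (intro sum_mono order.trans[OF sum_mono sum_mono2])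
    fix a b
    have le: "x * y \<le> x\<^sup>2 + y\<^sup>2" if "0 \<le> x" "0 \<le> y" for x y :: real
      using sum_squares_bound[of x y] mult_nonneg_nonneg[OF that] by linarith
    have "(V k)\<^sup>2 * pmf (law a) k * pmf (law b) k \<le> (V k)\<^sup>2 * ((pmf p k)\<^sup>2 + (pmf q k)\<^sup>2)" for k
      unfolding mult.assoc law_def using le[of "pmf p k" "pmf q k"] le[of "pmf q k" "pmf p k"]
      by (intro mult_left_mono) (auto simp: power2_eq_square)
    then show "1 * (\<Sum>k\<in>K. (V k)\<^sup>2 * pmf (law a) k * pmf (law b) k) \<le> noise"
      unfolding noise_def by (simp add: sum_mono)
  qed (auto simp: noise_nonneg)
  also have "\<dots> = 4 * (real m)\<^sup>2 * noise"
    by (simp add: power2_eq_square)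
  finally show ?thesis .
qed

section \<open>Critical value and type II error for fixed weights\<close>

definition crit :: "real \<Rightarrow> (nat \<Rightarrow> 'a) \<Rightarrow> real" where
  "crit \<alpha> x = quantile (map_pmf (\<lambda>\<pi>. U (x \<circ> \<pi>)) (pmf_of_set (perms (2 * m)))) \<alpha>"

lemma crit_le:
  assumes L: "1 \<le> L" and G: "0 < G"
    and bound: "(\<Sum>a=1..2 * m. \<Sum>b\<in>{1..2 * m} - {a}. (collision V (x a) (x b))\<^sup>2) \<le> G\<^sup>2"
  shows "crit (exp (- L)) x \<le> 40 * L * G / (real m)\<^sup>2"
  unfolding crit_def
proof (rule quantile_le)
  have U: "U (x \<circ> \<pi>) = U_stat (collision V) m (\<lambda>i. x (\<pi> i)) (\<lambda>j. x (\<pi> (m + j)))" for \<pi>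
    using U_stat_collision[OF m, of V "x \<circ> \<pi>"] by (simp add: U_def o_def)
  have "0 \<le> collision V a b" for a b
    by (simp add: collision_def V_nonneg)
  from permuted_U_stat_tail[where g = "collision V" and w = x, OF m collision_commute this G bound L]
  show "measure_pmf.prob (map_pmf (\<lambda>\<pi>. U (x \<circ> \<pi>)) (pmf_of_set (perms (2 * m)))) {y. 40 * L * G / (real m)\<^sup>2 < y} \<le> exp (- L)"
    by (simp add: measure_map_pmf vimage_def U)
qed (use L in auto)

theorem type_II_le:
  assumes S: "0 < signal" and \<delta>: "0 < \<delta>" and L: "1 \<le> L"
  shows "measure_pmf.prob joint {x. U x \<le> crit (exp (- L)) x}
    \<le> 8 * \<delta> + (16 / \<delta> + 64 + 25600 * L\<^sup>2) * (noise / ((real m)\<^sup>2 * signal\<^sup>2))"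
proof -
  define E where "E = (\<lambda>x. \<Sum>a=1..2 * m. \<Sum>b\<in>{1..2 * m} - {a}. (collision V (x a) (x b))\<^sup>2)"
  \<comment> \<open>With this \<open>G\<close> the bound \<open>40 * L * G / m\<^sup>2\<close> on
    the critical value is \<open>signal / 2\<close>. A type II error then forces
    \<open>U x \<le> signal / 2\<close> or \<open>E x > G\<^sup>2\<close>, and one nonnegative
    function that is at least 1 in both cases combines Chebyshev and Markov. The constant 25600 is
    \<open>4 * 80\<^sup>2\<close>.\<close>
  define G where "G = signal * (real m)\<^sup>2 / (80 * L)"
  have G: "0 < G"
    using S L m by (simp add: G_def)
  have E: "0 \<le> E x" for x
    unfolding E_def by (intro sum_nonneg) auto
  have "measure_pmf.prob joint {x. U x \<le> crit (exp (- L)) x}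
    \<le> expct joint (\<lambda>x. 4 / signal\<^sup>2 * (U x - signal)\<^sup>2 + 1 / G\<^sup>2 * E x)"
  proof (rule markov_le[OF finite_joint])
    fix x
    show "0 \<le> 4 / signal\<^sup>2 * (U x - signal)\<^sup>2 + 1 / G\<^sup>2 * E x"
      using E by simp
    assume "U x \<le> crit (exp (- L)) x"
    then consider "U x \<le> signal / 2" | "signal / 2 < crit (exp (- L)) x"
      by linarith
    then show "1 \<le> 4 / signal\<^sup>2 * (U x - signal)\<^sup>2 + 1 / G\<^sup>2 * E x"
    proof cases
      case 1
      then have "(signal / 2)\<^sup>2 \<le> (signal - U x)\<^sup>2"
        using S by (intro power_mono) auto
      then have "1 \<le> 4 / signal\<^sup>2 * (U x - signal)\<^sup>2"
        using S by (simp add: power2_commute[of "U x"] power_divide field_simps)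
      then show ?thesis
        using E[of x] by (simp add: add_increasing2)
    next
      case 2
      have "40 * L * G / (real m)\<^sup>2 = signal / 2"
        using L m by (simp add: G_def)
      then have "\<not> E x \<le> G\<^sup>2"
        using crit_le[OF L G, of x] 2 unfolding E_def by linarith
      then have "1 \<le> 1 / G\<^sup>2 * E x"
        using G by simp
      then show ?thesis
        by (simp add: add_increasing)
    qed
  qed
  also have "\<dots> = 4 / signal\<^sup>2 * expct joint (\<lambda>x. (U x - signal)\<^sup>2) + 1 / G\<^sup>2 * expct joint E"
    unfolding expct_add[OF finite_joint] by simp
  also have "\<dots> \<le> 4 / signal\<^sup>2 * (2 * \<delta> * signal\<^sup>2 + 4 * noise / ((real m)\<^sup>2 * \<delta>) + 16 * noise / (real m)\<^sup>2)
      + 1 / G\<^sup>2 * (4 * (real m)\<^sup>2 * noise)"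
    using expct_collision_sq_le variance_U_le[OF S \<delta>] unfolding E_def
    by (intro add_mono mult_left_mono) auto
  also have "\<dots> = 8 * \<delta> + (16 / \<delta> + 64 + 25600 * L\<^sup>2) * (noise / ((real m)\<^sup>2 * signal\<^sup>2))"
  proof -
    have gen: "4 / s\<^sup>2 * (2 * \<delta> * s\<^sup>2 + 4 * v / (k\<^sup>2 * \<delta>) + 16 * v / k\<^sup>2) + 1 / (s * k\<^sup>2 / (80 * L))\<^sup>2 * (4 * k\<^sup>2 * v)
      = 8 * \<delta> + (16 / \<delta> + 64 + 25600 * L\<^sup>2) * (v / (k\<^sup>2 * s\<^sup>2))"
      if "s > 0" "k > 0" for s k v :: real
    proof -
      have "1 / (s * k\<^sup>2 / (80 * L))\<^sup>2 * (4 * k\<^sup>2 * v) = 25600 * L\<^sup>2 * (v / (k\<^sup>2 * s\<^sup>2))"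
        using that L by (simp add: power_divide power_mult_distrib power2_eq_square field_simps)
      moreover have "4 / s\<^sup>2 * (2 * \<delta> * s\<^sup>2 + 4 * v / (k\<^sup>2 * \<delta>) + 16 * v / k\<^sup>2)
        = 8 * \<delta> + (16 / \<delta> + 64) * (v / (k\<^sup>2 * s\<^sup>2))"
        using that \<delta> by (simp add: field_simps)
      ultimately show ?thesis
        by (simp only: distrib_right add.assoc)
    qed
    show ?thesis
      unfolding G_def by (rule gen) (use S m in auto)
  qed
  finally show ?thesis .
qed

end

section \<open>Smoothed empirical frequencies\<close>

lemma map_pmf_eq_bernoulli: "map_pmf (\<lambda>y. y = k) p = bernoulli_pmf (pmf p k)"
proof (rule pmf_eqI)
  fix b
  have "(\<lambda>y. y = k) -` {True} = {k}" "(\<lambda>y. y = k) -` {False} = UNIV - {k}"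
    by auto
  then show "pmf (map_pmf (\<lambda>y. y = k) p) b = pmf (bernoulli_pmf (pmf p k)) b"
    using measure_pmf.prob_compl[of "{k}" p]
    by (cases b) (simp_all add: pmf_map pmf_le_1 measure_pmf_single)
qed

text \<open>By \<open>(M + 1) * (M choose j) = (j + 1) * (M + 1 choose j + 1)\<close> the left side
  is the probability that a binomial variable with \<open>M + 1\<close> trials is positive. The
  multiplied-out form also covers \<open>b = 0\<close>.\<close>

lemma expct_inverse_binomial_le:
  assumes b: "0 \<le> b" "b \<le> 1"
  shows "b * (real M + 1) * expct (binomial_pmf M b) (\<lambda>j. 1 / (1 + real j)) \<le> 1"
proof -
  let ?t = "\<lambda>j. 1 / (1 + real j) * (real (M choose j) * b ^ j * (1 - b) ^ (M - j))"
  have "expct (binomial_pmf M b) (\<lambda>j. 1 / (1 + real j)) = (\<Sum>j\<le>M. ?t j)"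
    using b by (subst integral_measure_pmf_real[where A = "{..M}"])
      (auto simp: set_pmf_binomial_eq split: if_splits)
  then have "b * (real M + 1) * expct (binomial_pmf M b) (\<lambda>j. 1 / (1 + real j)) = (\<Sum>j\<le>M. b * (real M + 1) * ?t j)"
    by (simp only: sum_distrib_left)
  also have "\<dots> = (\<Sum>j\<le>M. real (Suc M choose Suc j) * b ^ Suc j * (1 - b) ^ (Suc M - Suc j))"
  proof (rule sum.cong[OF refl])
    fix j
    have "real (Suc M) * real (M choose j) = real (Suc M choose Suc j) * real (Suc j)"
      using Suc_times_binomial_eq[of M j] by (metis of_nat_mult)
    then have eq: "real (Suc M choose Suc j) = (real M + 1) * real (M choose j) / (1 + real j)"
      by (simp add: field_simps del: binomial_Suc_Suc)
    show "b * (real M + 1) * ?t j = real (Suc M choose Suc j) * b ^ Suc j * (1 - b) ^ (Suc M - Suc j)"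
      unfolding eq by simp
  qed
  also have "\<dots> \<le> (\<Sum>j\<le>Suc M. real (Suc M choose j) * b ^ j * (1 - b) ^ (Suc M - j))"
    using b by (subst sum.atMost_Suc_shift) simp
  also have "\<dots> = (b + (1 - b)) ^ Suc M"
    by (rule binomial_ring[symmetric])
  finally show ?thesis by simp
qed

text \<open>The count over \<open>J\<close> is binomial with \<open>card J\<close> trials. The
  larger index set \<open>I\<close> is there because both weight factors are read off the same
  observations, but possibly off different numbers of them.\<close>

lemma expct_inverse_count_le:
  assumes "finite I" "J \<subseteq> I"
  shows "pmf p k * (real (card J) + 1) * expct (Pi_pmf I d (\<lambda>_. p)) (\<lambda>x. 1 / (1 + (\<Sum>i\<in>J. of_bool (x i = k)))) \<le> 1"
proof -
  have J: "finite J"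
    using assms finite_subset by blast
  have "expct (Pi_pmf I d (\<lambda>_. p)) (\<lambda>x. 1 / (1 + (\<Sum>i\<in>J. of_bool (x i = k))))
      = expct (Pi_pmf J d (\<lambda>_. p)) (\<lambda>x. 1 / (1 + (\<Sum>i\<in>J. of_bool (x i = k))))"
    unfolding Pi_pmf_subset[OF assms, of d] by (simp cong: sum.cong)
  also have "\<dots> = expct (map_pmf (\<lambda>h. (\<lambda>y. y = k) \<circ> h) (Pi_pmf J d (\<lambda>_. p))) (\<lambda>h. 1 / (1 + real (card {i \<in> J. h i})))"
    using J by (simp add: Int_def)
  also have "map_pmf (\<lambda>h. (\<lambda>y. y = k) \<circ> h) (Pi_pmf J d (\<lambda>_. p)) = Pi_pmf J (d = k) (\<lambda>_. bernoulli_pmf (pmf p k))"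
    using J by (simp add: Pi_pmf_map[symmetric] map_pmf_eq_bernoulli)
  also have "expct \<dots> (\<lambda>h. 1 / (1 + real (card {i \<in> J. h i}))) = expct (binomial_pmf (card J) (pmf p k)) (\<lambda>j. 1 / (1 + real j))"
    using J by (subst binomial_pmf_altdef'[of J _ _ "d = k"]) (auto simp: pmf_le_1)
  finally show ?thesis
    using expct_inverse_binomial_le[of "pmf p k" "card J"] by (simp add: pmf_le_1)
qed

text \<open>One factor of the weights. The uniform half gives a deterministic lower bound, the
  empirical half makes the weight follow the large cells.\<close>

definition smoothed_freq :: "nat \<Rightarrow> 'i set \<Rightarrow> ('i \<Rightarrow> nat) \<Rightarrow> nat \<Rightarrow> real" where
  "smoothed_freq d J y k = 1 / (2 * real d) + 1 / (2 * real (card J)) * (\<Sum>i\<in>J. of_bool (y i = k))"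

lemma smoothed_freq_ge: "1 / (2 * real d) \<le> smoothed_freq d J y k"
  by (simp add: smoothed_freq_def sum_nonneg)

lemma smoothed_freq_pos: "1 \<le> d \<Longrightarrow> 0 < smoothed_freq d J y k"
  using smoothed_freq_ge[of d J y k] by (smt (verit) of_nat_1 of_nat_mono zero_less_divide_1_iff)

lemma sum_smoothed_freq:
  assumes "finite J" "J \<noteq> {}" "1 \<le> d" "\<And>i. i \<in> J \<Longrightarrow> y i \<in> {1..d}"
  shows "(\<Sum>k=1..d. smoothed_freq d J y k) = 1"
proof -
  have "(\<Sum>k=1..d. \<Sum>i\<in>J. of_bool (y i = k)) = (\<Sum>i\<in>J. \<Sum>k=1..d. of_bool (y i = k) :: real)"
    by (rule sum.swap)
  also have "\<dots> = (\<Sum>i\<in>J. 1)"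
  proof (rule sum.cong[OF refl])
    fix i assume "i \<in> J"
    then show "(\<Sum>k=1..d. of_bool (y i = k)) = (1 :: real)"
      using assms(4)[of i] by (simp add: of_bool_def)
  qed
  finally have "(\<Sum>k=1..d. \<Sum>i\<in>J. of_bool (y i = k)) = real (card J)"
    by simp
  note count = this
  have "(\<Sum>k=1..d. smoothed_freq d J y k)
      = (\<Sum>k=1..d. 1 / (2 * real d)) + 1 / (2 * real (card J)) * (\<Sum>k=1..d. \<Sum>i\<in>J. of_bool (y i = k))"
    unfolding smoothed_freq_def sum.distrib sum_distrib_left ..
  then show ?thesis
    unfolding count using assms by simp
qed

text \<open>Since \<open>card J \<le> d\<close>, the empirical half is at least
  \<open>N / (2 * d)\<close>, so the frequency is at least \<open>(1 + N) / (2 * d)\<close>. Only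
  one factor of the square is bounded in this way and the other by \<open>1 / (2 * d)\<close>,
  because the binomial estimate is about the first power of \<open>1 / (1 + N)\<close>.\<close>

lemma inverse_smoothed_freq_sq_le:
  assumes d: "1 \<le> d" and J: "J \<noteq> {}" "finite J" "card J \<le> d"
  shows "1 / (smoothed_freq d J y k)\<^sup>2 \<le> 4 * (real d)\<^sup>2 * (1 / (1 + (\<Sum>i\<in>J. of_bool (y i = k))))"
proof -
  define N where "N = (\<Sum>i\<in>J. of_bool (y i = k) :: real)"
  define s where "s = smoothed_freq d J y k"
  have N: "0 \<le> N"
    by (simp add: N_def sum_nonneg)
  have c: "0 < real (card J)" "real (card J) \<le> real d" "0 < real d"
    using assms by (auto simp: card_gt_0_iff)
  have "1 / (2 * real d) * N \<le> 1 / (2 * real (card J)) * N"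
    using c N by (intro mult_right_mono divide_left_mono) auto
  then have "1 / (2 * real d) * (1 + N) \<le> s"
    by (simp add: s_def smoothed_freq_def N_def distrib_left)
  moreover have "1 / (2 * real d) \<le> s"
    unfolding s_def by (rule smoothed_freq_ge)
  moreover have s: "0 < s"
    unfolding s_def by (rule smoothed_freq_pos[OF d])
  ultimately have "(1 / (2 * real d) * (1 + N)) * (1 / (2 * real d)) \<le> s * s"
    using N c by (intro mult_mono) auto
  then have "1 / (s * s) \<le> 1 / ((1 / (2 * real d) * (1 + N)) * (1 / (2 * real d)))"
    using N c s by (intro divide_left_mono) (auto intro!: mult_pos_pos divide_pos_pos)
  also have "\<dots> = 4 * (real d)\<^sup>2 * (1 / (1 + N))"
    by (simp add: power2_eq_square)
  finally show ?thesis
    by (simp add: s_def N_def power2_eq_square)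
qed

text \<open>One factor \<open>pmf p k\<close> cancels against the mean of \<open>1 / (1 + N)\<close>
  and the other sums to 1 over \<open>k\<close>. The resulting bound is free of \<open>p\<close>,
  which is the purpose of the weights.\<close>

lemma expct_sum_sq_ratio_le:
  fixes p :: "nat pmf"
  assumes I: "finite I" "J \<subseteq> I" "J \<noteq> {}" and d: "1 \<le> d" "card J \<le> d"
    and p: "set_pmf p \<subseteq> {1..d}"
  shows "expct (Pi_pmf I e (\<lambda>_. p)) (\<lambda>y. \<Sum>k=1..d. (pmf p k)\<^sup>2 / (smoothed_freq d J y k)\<^sup>2)
    \<le> 4 * (real d)\<^sup>2 / (real (card J) + 1)"
proof -
  let ?P = "Pi_pmf I e (\<lambda>_. p)"
  have fp: "finite (set_pmf p)"
    using p finite_subset by blast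
  have fin: "finite (set_pmf ?P)"
    using I fp by (intro finite_set_Pi_pmf)
  have J: "finite J"
    using I finite_subset by blast
  have "expct ?P (\<lambda>y. (pmf p k)\<^sup>2 / (smoothed_freq d J y k)\<^sup>2) \<le> pmf p k * (4 * (real d)\<^sup>2 / (real (card J) + 1))" for k
  proof -
    have "expct ?P (\<lambda>y. (pmf p k)\<^sup>2 / (smoothed_freq d J y k)\<^sup>2)
        \<le> expct ?P (\<lambda>y. ((pmf p k)\<^sup>2 * (4 * (real d)\<^sup>2)) * (1 / (1 + (\<Sum>i\<in>J. of_bool (y i = k)))))"
      using mult_left_mono[OF inverse_smoothed_freq_sq_le[OF d(1) I(3) J d(2)], of "(pmf p k)\<^sup>2"]
      by (intro expct_mono fin) (simp add: mult.assoc)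
    also have "\<dots> = (pmf p k)\<^sup>2 * (4 * (real d)\<^sup>2) * expct ?P (\<lambda>y. 1 / (1 + (\<Sum>i\<in>J. of_bool (y i = k))))"
      by (rule integral_mult_right_zero)
    also have "\<dots> = (pmf p k * (4 * (real d)\<^sup>2 / (real (card J) + 1))) *
        (pmf p k * (real (card J) + 1) * expct ?P (\<lambda>y. 1 / (1 + (\<Sum>i\<in>J. of_bool (y i = k)))))"
    proof -
      have "(x\<^sup>2 * a) * e = (x * (a / c)) * (x * c * e)" if "c > 0" for x a e c :: real
        using that by (simp add: power2_eq_square)
      then show ?thesis
        by (simp only:)
    qed
    also have "\<dots> \<le> (pmf p k * (4 * (real d)\<^sup>2 / (real (card J) + 1))) * 1"
      by (intro mult_left_mono expct_inverse_count_le I) auto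
    finally show ?thesis by simp
  qed
  then have "expct ?P (\<lambda>y. \<Sum>k=1..d. (pmf p k)\<^sup>2 / (smoothed_freq d J y k)\<^sup>2)
      \<le> (\<Sum>k=1..d. pmf p k * (4 * (real d)\<^sup>2 / (real (card J) + 1)))"
    unfolding expct_sum[OF fin] by (intro sum_mono)
  also have "\<dots> = (\<Sum>k=1..d. pmf p k) * (4 * (real d)\<^sup>2 / (real (card J) + 1))"
    by (rule sum_distrib_right[symmetric])
  also have "(\<Sum>k=1..d. pmf p k) = 1"
    using p by (intro sum_pmf_eq_1) auto
  finally show ?thesis by simp
qed

text \<open>Independence of the two coordinate vectors. It makes the mean of a function of the first
  times a function of the second factorise.\<close>

lemma expct_Pi_pair:
  assumes I: "finite I" and fin: "finite (set_pmf p)" "finite (set_pmf q)"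
  shows "expct (Pi_pmf I (d, e) (\<lambda>_. pair_pmf p q)) F
    = expct (Pi_pmf I d (\<lambda>_. p)) (\<lambda>y. expct (Pi_pmf I e (\<lambda>_. q)) (\<lambda>z. F (\<lambda>i. (y i, z i))))"
  using I
proof (induction I arbitrary: F rule: finite_induct)
  case empty
  then show ?case by simp
next
  case (insert a I)
  let ?P = "Pi_pmf I d (\<lambda>_. p)" and ?Q = "Pi_pmf I e (\<lambda>_. q)"
  have fP: "finite (set_pmf ?P)" and fQ: "finite (set_pmf ?Q)"
    using insert.hyps fin by (auto intro!: finite_set_Pi_pmf)
  have ins: "expct (Pi_pmf (insert a I) d (\<lambda>_. p)) f = expct p (\<lambda>u. expct ?P (\<lambda>y. f (y(a := u))))"
    "expct (Pi_pmf (insert a I) e (\<lambda>_. q)) g = expct q (\<lambda>v. expct ?Q (\<lambda>z. g (z(a := v))))" for f g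
    using insert.hyps fin by (auto intro!: expct_Pi_insert)
  have upd: "(\<lambda>i. (y i, z i))(a := (u, v)) = (\<lambda>i. ((y(a := u)) i, (z(a := v)) i))" for y z u v
    by (rule ext) simp
  have "expct (Pi_pmf (insert a I) (d, e) (\<lambda>_. pair_pmf p q)) F
    = expct p (\<lambda>u. expct q (\<lambda>v. expct ?P (\<lambda>y. expct ?Q (\<lambda>z. F (\<lambda>i. ((y(a := u)) i, (z(a := v)) i))))))"
    using insert.hyps fin by (subst expct_Pi_insert) (auto simp: expct_pair insert.IH upd)
  also have "\<dots> = expct p (\<lambda>u. expct ?P (\<lambda>y. expct q (\<lambda>v. expct ?Q (\<lambda>z. F (\<lambda>i. ((y(a := u)) i, (z(a := v)) i))))))"
    by (subst expct_swap[OF fin(2) fP]) simp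
  also have "\<dots> = expct (Pi_pmf (insert a I) d (\<lambda>_. p)) (\<lambda>y. expct (Pi_pmf (insert a I) e (\<lambda>_. q)) (\<lambda>z. F (\<lambda>i. (y i, z i))))"
    unfolding ins ..
  finally show ?case .
qed

section \<open>Reduction of the test to product laws\<close>

text \<open>By the last premise \<open>f i\<close> reads only its block, so cutting \<open>A\<close>
  into the block of \<open>j\<close> and the rest splits the product law into two independent
  pieces, one for \<open>f j\<close> and one for all other functions. It yields the law of the
  constructed samples, whose entries read disjoint sets of data positions.\<close>

lemma Pi_pmf_blocks:
  assumes "finite J" "finite A" "\<And>i. i \<in> J \<Longrightarrow> B i \<subseteq> A" "disjoint_family_on B J"
    and "\<And>i x y. i \<in> J \<Longrightarrow> (\<And>b. b \<in> B i \<Longrightarrow> x b = y b) \<Longrightarrow> f i x = f i y"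
  shows "map_pmf (\<lambda>x i. if i \<in> J then f i x else e) (Pi_pmf A d P)
    = Pi_pmf J e (\<lambda>i. map_pmf (f i) (Pi_pmf A d P))"
  using assms
proof (induction J arbitrary: A rule: finite_induct)
  case empty
  then show ?case by (simp add: map_pmf_const)
next
  case (insert j J)
  define A1 where "A1 = B j"
  define A2 where "A2 = A - B j"
  have fA: "finite A1" "finite A2" "A1 \<inter> A2 = {}" "A1 \<union> A2 = A" "A1 \<subseteq> A" "A2 \<subseteq> A"
    using insert.prems(1) insert.prems(2)[of j] finite_subset[of "B j" A] unfolding A1_def A2_def by auto
  have dis: "B i \<inter> B j = {}" if "i \<in> J" for i
    using insert.prems(3) insert.hyps that by (auto simp: disjoint_family_on_def)
  let ?P1 = "Pi_pmf A1 d P" and ?P2 = "Pi_pmf A2 d P"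
  have marg: "map_pmf (f i) (Pi_pmf A' d P) = map_pmf (f i) (Pi_pmf A d P)"
    if "i \<in> insert j J" "A' \<subseteq> A" "B i \<subseteq> A'" for i A'
  proof -
    have "f i (\<lambda>b. if b \<in> A' then x b else d) = f i x" for x
      using that by (intro insert.prems(4)) auto
    then show ?thesis
      by (simp add: Pi_pmf_subset[OF insert.prems(1) that(2)] pmf.map_comp o_def)
  qed
  have IH: "map_pmf (\<lambda>x i. if i \<in> J then f i x else e) ?P2 = Pi_pmf J e (\<lambda>i. map_pmf (f i) ?P2)"
  proof (rule insert.IH)
    show "B i \<subseteq> A2" if "i \<in> J" for i
      using that dis[OF that] insert.prems(2)[of i] by (auto simp: A2_def)
    show "disjoint_family_on B J"
      using insert.prems(3) by (auto simp: disjoint_family_on_def)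
    show "f i x = f i y" if "i \<in> J" "\<And>b. b \<in> B i \<Longrightarrow> x b = y b" for i x y
      using insert.prems(4) that by blast
  qed (rule fA)
  let ?merge = "\<lambda>(g, h) b. if b \<in> A1 then g b else h b"
  have mj: "f j (?merge gh) = f j (fst gh)" for gh
    by (rule insert.prems(4)) (auto simp: A1_def split_def)
  have mi: "f i (?merge gh) = f i (snd gh)" if "i \<in> J" for i gh
    by (rule insert.prems(4)) (use dis[OF that] that in \<open>auto simp: A1_def split_def\<close>)
  have "map_pmf (\<lambda>x i. if i \<in> insert j J then f i x else e) (Pi_pmf A d P)
    = map_pmf (\<lambda>gh i. if i \<in> insert j J then f i (?merge gh) else e) (pair_pmf ?P1 ?P2)"
    unfolding fA(4)[symmetric] Pi_pmf_union[OF fA(1,2,3)] by (simp add: pmf.map_comp o_def)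
  also have "\<dots> = map_pmf (\<lambda>(u, F). F(j := u))
      (map_pmf (\<lambda>(g, h). (f j g, \<lambda>i. if i \<in> J then f i h else e)) (pair_pmf ?P1 ?P2))"
    unfolding pmf.map_comp
  proof (rule map_pmf_cong[OF refl])
    fix gh
    show "(\<lambda>i. if i \<in> insert j J then f i (?merge gh) else e)
      = ((\<lambda>(u, F). F(j := u)) \<circ> (\<lambda>(g, h). (f j g, \<lambda>i. if i \<in> J then f i h else e))) gh"
      using mj[of gh] mi[of _ gh] by (auto simp: fun_eq_iff split_def)
  qed
  also have "map_pmf (\<lambda>(g, h). (f j g, \<lambda>i. if i \<in> J then f i h else e)) (pair_pmf ?P1 ?P2)
    = pair_pmf (map_pmf (f j) ?P1) (map_pmf (\<lambda>h i. if i \<in> J then f i h else e) ?P2)"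
    by (rule map_pair)
  also have "map_pmf (f j) ?P1 = map_pmf (f j) (Pi_pmf A d P)"
    by (rule marg) (use fA in \<open>auto simp: A1_def\<close>)
  also have "map_pmf (\<lambda>h i. if i \<in> J then f i h else e) ?P2 = Pi_pmf J e (\<lambda>i. map_pmf (f i) (Pi_pmf A d P))"
    unfolding IH
  proof (rule Pi_pmf_cong[OF refl refl], rule marg)
    show "B i \<subseteq> A2" if "i \<in> J" for i
      using that dis[OF that] insert.prems(2)[of i] by (auto simp: A2_def)
  qed (use fA in auto)
  finally show ?case
    unfolding Pi_pmf_insert[OF insert.hyps] .
qed

lemma map_pmf_two_components:
  assumes "finite A" "a \<in> A" "b \<in> A" "a \<noteq> b"
  shows "map_pmf (\<lambda>x. (f (x a), g (x b))) (Pi_pmf A d (\<lambda>_. p)) = pair_pmf (map_pmf f p) (map_pmf g p)"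
proof -
  let ?Q = "Pi_pmf (A - {a}) d (\<lambda>_. p)"
  have "insert a (A - {a}) = A"
    using assms by auto
  then have "Pi_pmf A d (\<lambda>_. p) = map_pmf (\<lambda>(y, x). x(a := y)) (pair_pmf p ?Q)"
    using Pi_pmf_insert[of "A - {a}" a d "\<lambda>_. p"] assms by auto
  then have "map_pmf (\<lambda>x. (f (x a), g (x b))) (Pi_pmf A d (\<lambda>_. p))
    = map_pmf (\<lambda>(y, x). (f y, g (x b))) (pair_pmf p ?Q)"
    using assms by (simp add: pmf.map_comp o_def split_def)
  also have "\<dots> = pair_pmf (map_pmf f p) (map_pmf (\<lambda>x. g (x b)) ?Q)"
    by (rule map_pair)
  also have "map_pmf (\<lambda>x. g (x b)) ?Q = map_pmf g (map_pmf (\<lambda>x. x b) ?Q)"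
    by (simp add: pmf.map_comp o_def)
  also have "map_pmf (\<lambda>x. x b) ?Q = p"
    using assms by (simp add: Pi_pmf_component)
  finally show ?thesis .
qed

text \<open>Positions \<open>{1..2 * m}\<close> of \<open>sample m x\<close> hold the pooled observations, positions
  \<open>{2 * m<..3 * m}\<close> the part of the second constructed sample that only enters the weights.\<close>

definition sample :: "nat \<Rightarrow> (nat \<Rightarrow> nat \<times> nat) \<Rightarrow> nat \<Rightarrow> nat \<times> nat" where
  "sample m x i = (if i \<in> {1..3 * m} then
     (if i \<le> m then x i else (fst (x (m + i)), snd (x (3 * m + i)))) else (0, 0))"

lemma map_sample_data_pmf:
  "map_pmf (sample m) (data_pmf (2 * m) p)
    = Pi_pmf {1..3 * m} (0, 0) (\<lambda>i. if i \<le> m then p else prod_of_marginals p)"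
proof -
  let ?A = "{1..3 * (2 * m)}" and ?J = "{1..3 * m}"
  let ?f = "\<lambda>i x. if i \<le> m then x i else (fst (x (m + i)), snd (x (3 * m + i)))"
  \<comment> \<open>For \<open>i > m\<close>, \<open>m + i\<close> lies in
    \<open>{2 * m + 1..4 * m}\<close> and \<open>3 * m + i\<close> in
    \<open>{4 * m + 1..6 * m}\<close>, so no data position is shared. Within one block the two
    positions differ, which gives the product of the marginals.\<close>
  let ?B = "\<lambda>i. if i \<le> m then {i} else {m + i, 3 * m + i}"
  have "map_pmf (sample m) (Pi_pmf ?A (0, 0) (\<lambda>_. p)) = map_pmf (\<lambda>x i. if i \<in> ?J then ?f i x else (0, 0)) (Pi_pmf ?A (0, 0) (\<lambda>_. p))"
    by (intro map_pmf_cong refl ext) (simp add: sample_def)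
  also have "\<dots> = Pi_pmf ?J (0, 0) (\<lambda>i. map_pmf (?f i) (Pi_pmf ?A (0, 0) (\<lambda>_. p)))"
  proof (rule Pi_pmf_blocks[where B = ?B])
    show "disjoint_family_on ?B ?J"
      by (auto simp: disjoint_family_on_def)
    show "?B i \<subseteq> ?A" if "i \<in> ?J" for i
      using that by auto
    show "?f i x = ?f i y" if "i \<in> ?J" "\<And>b. b \<in> ?B i \<Longrightarrow> x b = y b" for i x y
      using that(2) by (auto split: if_splits)
  qed auto
  also have "\<dots> = Pi_pmf ?J (0, 0) (\<lambda>i. if i \<le> m then p else prod_of_marginals p)"
  proof (rule Pi_pmf_cong[OF refl refl])
    fix i assume i: "i \<in> ?J"
    show "map_pmf (?f i) (Pi_pmf ?A (0, 0) (\<lambda>_. p)) = (if i \<le> m then p else prod_of_marginals p)"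
    proof (cases "i \<le> m")
      case True
      then show ?thesis
        using i by (simp add: Pi_pmf_component)
    next
      case False
      then have "map_pmf (\<lambda>x. (fst (x (m + i)), snd (x (3 * m + i)))) (Pi_pmf ?A (0, 0) (\<lambda>_. p))
        = pair_pmf (map_pmf fst p) (map_pmf snd p)"
        using i by (intro map_pmf_two_components) auto
      then show ?thesis
        using False by (simp add: prod_of_marginals_def)
    qed
  qed
  finally show ?thesis
    by (simp add: data_pmf_def)
qed

text \<open>The value 0 off the grid makes \<open>collision\<close> agree with \<open>g_star\<close>
  at all arguments, as the sum in \<open>g_star\<close> finds no match there.\<close>

definition inv_weight :: "nat \<Rightarrow> nat \<Rightarrow> nat \<Rightarrow> (nat \<Rightarrow> nat \<times> nat) \<Rightarrow> nat \<times> nat \<Rightarrow> real" where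
  "inv_weight m d1 d2 X k = (if k \<in> {1..d1} \<times> {1..d2} then
     inverse (smoothed_freq d1 {2 * m + 1..2 * m + min m d1} (\<lambda>i. fst (X i)) (fst k)
       * smoothed_freq d2 {2 * m + 1..2 * m + min m d2} (\<lambda>i. snd (X i)) (snd k)) else 0)"

lemma inv_weight_cong:
  assumes "\<And>i. i \<in> {2 * m<..3 * m} \<Longrightarrow> X i = Y i"
  shows "inv_weight m d1 d2 X = inv_weight m d1 d2 Y"
proof -
  have "smoothed_freq d {2 * m + 1..2 * m + min m d} (\<lambda>i. f (X i)) = smoothed_freq d {2 * m + 1..2 * m + min m d} (\<lambda>i. f (Y i))"
    for d and f :: "nat \<times> nat \<Rightarrow> nat"
    unfolding smoothed_freq_def using assms by (intro ext arg_cong2[of _ _ _ _ "(+)"] arg_cong2[of _ _ _ _ "(*)"] sum.cong) auto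
  then show ?thesis
    by (auto simp: inv_weight_def fun_eq_iff)
qed

lemma g_star_weight:
  "g_star d1 d2 (weight (2 * m) d1 d2 x) = collision (inv_weight m d1 d2 (sample m x))"
proof (intro ext)
  fix u v :: "nat \<times> nat"
  have sf: "smoothed_freq d {2 * m + 1..2 * m + min m d} y k
    = 1 / (2 * real d) + 1 / (2 * real (min m d)) * (\<Sum>i=1..min m d. of_bool (y (2 * m + i) = k))" for d y k
  proof -
    have "(\<Sum>i\<in>{2 * m + 1..2 * m + min m d}. of_bool (y i = k) :: real) = (\<Sum>i=1..min m d. of_bool (y (2 * m + i) = k))"
      by (rule sum.reindex_bij_witness[of _ "\<lambda>i. 2 * m + i" "\<lambda>i. i - 2 * m"]) auto
    then show ?thesis
      by (simp add: smoothed_freq_def)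
  qed
  have "weight (2 * m) d1 d2 x k1 k2 = smoothed_freq d1 {2 * m + 1..2 * m + min m d1} (\<lambda>i. fst (sample m x i)) k1
      * smoothed_freq d2 {2 * m + 1..2 * m + min m d2} (\<lambda>i. snd (sample m x i)) k2" for k1 k2
  proof -
    \<comment> \<open>The offsets \<open>3 * m\<close> and \<open>5 * m\<close> in the weights are
      \<open>m + 2 * m\<close> and \<open>3 * m + 2 * m\<close>, that is, position
      \<open>2 * m + i\<close> of \<open>sample\<close>.\<close>
    have "3 * (2 * m) div 2 = 3 * m" "5 * (2 * m) div 2 = 5 * m"
      by auto
    then show ?thesis
      unfolding sf weight_def Let_def
      by (intro arg_cong2[of _ _ _ _ "(*)"] arg_cong2[of _ _ _ _ "(+)"] sum.cong refl) (auto simp: sample_def algebra_simps)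
  qed
  then have V: "inverse (weight (2 * m) d1 d2 x k1 k2) = inv_weight m d1 d2 (sample m x) (k1, k2)"
    if "k1 \<in> {1..d1}" "k2 \<in> {1..d2}" for k1 k2
    using that by (simp add: inv_weight_def)
  have "g_star d1 d2 (weight (2 * m) d1 d2 x) u v
    = (\<Sum>k1=1..d1. \<Sum>k2=1..d2. if (k1, k2) = u then collision (inv_weight m d1 d2 (sample m x)) u v else 0)"
    unfolding g_star_def by (intro sum.cong refl) (auto simp: V collision_def prod_eq_iff)
  also have "\<dots> = (\<Sum>k\<in>{1..d1} \<times> {1..d2}. if k = u then collision (inv_weight m d1 d2 (sample m x)) u v else 0)"
    by (simp add: sum.cartesian_product split_def)
  also have "\<dots> = collision (inv_weight m d1 d2 (sample m x)) u v"
    by (auto simp: sum.delta' sum.delta collision_def inv_weight_def)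
  finally show "g_star d1 d2 (weight (2 * m) d1 d2 x) u v = collision (inv_weight m d1 d2 (sample m x)) u v" .
qed

lemma U_stat_cong:
  assumes "2 \<le> m" "\<And>i. i \<in> {1..m} \<Longrightarrow> u i = u' i" "\<And>i. i \<in> {1..m} \<Longrightarrow> v i = v' i"
  shows "U_stat g m u v = U_stat g m u' v'"
  unfolding U_stat_eq[OF assms(1)] using assms(2,3) by simp

definition test_stat :: "nat \<Rightarrow> nat \<Rightarrow> nat \<Rightarrow> (nat \<Rightarrow> nat \<times> nat) \<Rightarrow> (nat \<Rightarrow> nat) \<Rightarrow> real" where
  "test_stat m d1 d2 X \<pi> = collision_form (inv_weight m d1 d2 X) (split_coeff m) {1..2 * m} (X \<circ> \<pi>)"

lemma pooled_eq_sample: "a \<in> {1..2 * m} \<Longrightarrow> pooled (2 * m) x a = sample m x a"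
  by (auto simp: pooled_def sample_def Y_tilde_def Z_tilde_def algebra_simps)

lemma U_perm_eq:
  assumes m: "2 \<le> m" and \<pi>: "\<pi> \<in> perms (2 * m)"
  shows "U_perm (2 * m) d1 d2 x \<pi> = test_stat m d1 d2 (sample m x) \<pi>"
proof -
  have r: "\<pi> a \<in> {1..2 * m}" if "a \<in> {1..2 * m}" for a
    using \<pi> permutes_in_image[of \<pi> "{1..2 * m}" a] that by (simp add: perms_def)
  show ?thesis
    unfolding U_perm_def g_star_weight test_stat_def U_stat_collision[OF m, symmetric]
      nonzero_mult_div_cancel_left[OF zero_neq_numeral[symmetric]]
  proof (rule U_stat_cong[OF m])
    fix i assume "i \<in> {1..m}"
    then have i: "i \<in> {1..2 * m}" "m + i \<in> {1..2 * m}"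
      by auto
    show "pooled (2 * m) x (\<pi> i) = (sample m x \<circ> \<pi>) i"
      unfolding o_def by (rule pooled_eq_sample[OF r[OF i(1)]])
    show "pooled (2 * m) x (\<pi> (m + i)) = (sample m x \<circ> \<pi>) (m + i)"
      unfolding o_def by (rule pooled_eq_sample[OF r[OF i(2)]])
  qed
qed

lemma U_split_eq:
  assumes m: "2 \<le> m"
  shows "U_split (2 * m) d1 d2 x = test_stat m d1 d2 (sample m x) id"
  unfolding U_split_def g_star_weight test_stat_def U_stat_collision[OF m, symmetric]
    nonzero_mult_div_cancel_left[OF zero_neq_numeral[symmetric]]
proof (rule U_stat_cong[OF m])
  fix i assume i: "i \<in> {1..m}"
  then show "Y_tilde x i = (sample m x \<circ> id) i"
    by (simp add: Y_tilde_def sample_def)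
  have "m + (m + i) = 2 * m + i" "3 * m + (m + i) = 2 * (2 * m) + i"
    by simp_all
  then show "Z_tilde (2 * m) x i = (sample m x \<circ> id) (m + i)"
    using i unfolding Z_tilde_def sample_def o_def id_def by (simp only:) simp
qed

lemma crit_value_eq:
  assumes m: "2 \<le> m"
  shows "crit_value (2 * m) d1 d2 \<alpha> x
    = quantile (map_pmf (test_stat m d1 d2 (sample m x)) (pmf_of_set (perms (2 * m)))) \<alpha>"
proof -
  have "map_pmf (U_perm (2 * m) d1 d2 x) (pmf_of_set (perms (2 * m)))
    = map_pmf (test_stat m d1 d2 (sample m x)) (pmf_of_set (perms (2 * m)))"
    by (intro map_pmf_cong refl U_perm_eq m) simp
  then show ?thesis
    by (simp add: crit_value_def quantile_def perm_cdf_def perms_def)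
qed

text \<open>Under the null the product of the marginals is \<open>p\<close> itself, so all
  \<open>3 * m\<close> positions of the sample are i.i.d.; permutations of the first
  \<open>2 * m\<close> fix every position that the weights read.\<close>

theorem type_I_error:
  assumes m: "2 \<le> m" and \<alpha>: "0 < \<alpha>" "\<alpha> < 1" and p: "p \<in> P_null d1 d2"
  shows "emeasure (measure_pmf (data_pmf (2 * m) p)) {x. U_split (2 * m) d1 d2 x > crit_value (2 * m) d1 d2 \<alpha> x} \<le> ennreal \<alpha>"
proof -
  define c where "c = (\<lambda>X. quantile (map_pmf (test_stat m d1 d2 X) (pmf_of_set (perms (2 * m)))) \<alpha>)"
  let ?D = "Pi_pmf {1..3 * m} (0, 0) (\<lambda>_. p)"
  have pq: "prod_of_marginals p = p" and supp: "set_pmf p \<subseteq> {1..d1} \<times> {1..d2}"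
    using p by (auto simp: P_null_def P_Multi_def)
  have "measure_pmf.prob (data_pmf (2 * m) p) {x. U_split (2 * m) d1 d2 x > crit_value (2 * m) d1 d2 \<alpha> x}
    = measure_pmf.prob (map_pmf (sample m) (data_pmf (2 * m) p)) {X. test_stat m d1 d2 X id > c X}"
    by (simp add: measure_map_pmf vimage_def U_split_eq[OF m] crit_value_eq[OF m] c_def)
  also have "map_pmf (sample m) (data_pmf (2 * m) p) = ?D"
    unfolding map_sample_data_pmf pq by simp
  also have "measure_pmf.prob ?D {X. test_stat m d1 d2 X id > c X} \<le> \<alpha>"
    unfolding c_def
  proof (rule permutation_test_level[OF _ \<alpha>])
    show "finite (set_pmf ?D)"
      using supp finite_subset by (intro finite_set_Pi_pmf) auto
    fix \<sigma> assume "\<sigma> \<in> perms (2 * m)"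
    then have \<sigma>: "\<sigma> permutes {1..2 * m}"
      by (simp add: perms_def)
    then have \<sigma>3: "\<sigma> permutes {1..3 * m}"
      by (rule permutes_subset) auto
    show "map_pmf (\<lambda>x. x \<circ> \<sigma>) ?D = ?D"
      using permutes_imp_bij[OF \<sigma>3] permutes_not_in[OF \<sigma>3]
      by (intro Pi_pmf_bij_betw[symmetric]) auto
    fix X :: "nat \<Rightarrow> nat \<times> nat" and \<pi>
    have "inv_weight m d1 d2 (X \<circ> \<sigma>) = inv_weight m d1 d2 X"
      using permutes_not_in[OF \<sigma>] by (intro inv_weight_cong) auto
    then show "test_stat m d1 d2 (X \<circ> \<sigma>) \<pi> = test_stat m d1 d2 X (\<sigma> \<circ> \<pi>)"
      by (simp add: test_stat_def comp_assoc)
  qed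
  finally show ?thesis
    by (simp add: measure_pmf.emeasure_eq_measure ennreal_leI)
qed

section \<open>The type II error\<close>

lemma weighted_Cauchy_Schwarz:
  fixes w D :: "'a \<Rightarrow> real"
  assumes w: "\<And>k. k \<in> K \<Longrightarrow> 0 < w k" and sum: "(\<Sum>k\<in>K. w k) = 1"
  shows "(\<Sum>k\<in>K. \<bar>D k\<bar>)\<^sup>2 \<le> (\<Sum>k\<in>K. inverse (w k) * (D k)\<^sup>2)"
proof -
  have "(\<Sum>k\<in>K. \<bar>D k\<bar>) = (\<Sum>k\<in>K. sqrt (w k) * (\<bar>D k\<bar> / sqrt (w k)))"
    using w by (intro sum.cong) fastforce+
  then have "(\<Sum>k\<in>K. \<bar>D k\<bar>)\<^sup>2 \<le> (\<Sum>k\<in>K. (sqrt (w k))\<^sup>2) * (\<Sum>k\<in>K. (\<bar>D k\<bar> / sqrt (w k))\<^sup>2)"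
    using Cauchy_Schwarz_ineq_sum[of "\<lambda>k. sqrt (w k)" "\<lambda>k. \<bar>D k\<bar> / sqrt (w k)" K] by simp
  also have "(\<Sum>k\<in>K. (sqrt (w k))\<^sup>2) = 1"
    unfolding sum[symmetric] using w by (intro sum.cong) (auto simp: less_imp_le)
  also have "(\<Sum>k\<in>K. (\<bar>D k\<bar> / sqrt (w k))\<^sup>2) = (\<Sum>k\<in>K. inverse (w k) * (D k)\<^sup>2)"
  proof (rule sum.cong[OF refl])
    fix k assume "k \<in> K"
    then show "(\<bar>D k\<bar> / sqrt (w k))\<^sup>2 = inverse (w k) * (D k)\<^sup>2"
      using w[of k] by (simp add: power_divide field_simps)
  qed
  finally show ?thesis by simp
qed

text \<open>This removes \<open>p\<^sup>2\<close> before averaging: \<open>x\<^sup>2 + y\<^sup>2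
  \<le> 2 * (x - y)\<^sup>2 + 3 * y\<^sup>2\<close>, the difference being
  \<open>(x - 2 * y)\<^sup>2\<close>, and the part in \<open>p - q\<close> sums to at most
  \<open>2 * B * signal\<close>. The signal, which depends on the weights, is then replaced by its
  lower bound \<eta>.\<close>

lemma (in two_samples) noise_ratio_le:
  assumes B: "\<And>k. k \<in> K \<Longrightarrow> V k \<le> B" and \<eta>: "0 < \<eta>" "\<eta> \<le> signal"
  shows "noise / ((real m)\<^sup>2 * signal\<^sup>2)
    \<le> 2 * B / ((real m)\<^sup>2 * \<eta>) + 3 * (\<Sum>k\<in>K. (V k)\<^sup>2 * (pmf q k)\<^sup>2) / ((real m)\<^sup>2 * \<eta>\<^sup>2)"
proof -
  define Q where "Q = (\<Sum>k\<in>K. (V k)\<^sup>2 * (pmf q k)\<^sup>2)"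
  define s where "s = signal"
  define M where "M = (real m)\<^sup>2"
  have s: "0 < s" "\<eta> \<le> s"
    using \<eta> by (auto simp: s_def)
  have M: "0 < M"
    using m by (simp add: M_def)
  have Q: "0 \<le> Q"
    unfolding Q_def by (intro sum_nonneg) auto
  have B0: "0 \<le> B"
  proof -
    have "K \<noteq> {}"
      using supp_p set_pmf_not_empty[of p] by auto
    then show ?thesis
      using B V_nonneg order_trans by blast
  qed
  have "noise \<le> (\<Sum>k\<in>K. 2 * B * (V k * (pmf p k - pmf q k)\<^sup>2) + 3 * ((V k)\<^sup>2 * (pmf q k)\<^sup>2))"
    unfolding noise_def
  proof (rule sum_mono)
    fix k assume k: "k \<in> K"
    let ?x = "pmf p k" and ?y = "pmf q k"
    have "?x\<^sup>2 + ?y\<^sup>2 \<le> 2 * (?x - ?y)\<^sup>2 + 3 * ?y\<^sup>2"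
    proof -
      have "2 * (?x - ?y)\<^sup>2 + 3 * ?y\<^sup>2 - (?x\<^sup>2 + ?y\<^sup>2) = (?x - 2 * ?y)\<^sup>2"
        by (simp add: power2_eq_square algebra_simps)
      then show ?thesis
        by (smt (verit) zero_le_power2)
    qed
    then have "(V k)\<^sup>2 * (?x\<^sup>2 + ?y\<^sup>2) \<le> (V k)\<^sup>2 * (2 * (?x - ?y)\<^sup>2 + 3 * ?y\<^sup>2)"
      by (intro mult_left_mono) auto
    also have "\<dots> = V k * (2 * (V k * (?x - ?y)\<^sup>2)) + 3 * ((V k)\<^sup>2 * ?y\<^sup>2)"
      by (simp add: power2_eq_square algebra_simps)
    also have "V k * (2 * (V k * (?x - ?y)\<^sup>2)) \<le> B * (2 * (V k * (?x - ?y)\<^sup>2))"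
      using B[OF k] V_nonneg by (intro mult_right_mono) auto
    finally show "(V k)\<^sup>2 * (?x\<^sup>2 + ?y\<^sup>2) \<le> 2 * B * (V k * (?x - ?y)\<^sup>2) + 3 * ((V k)\<^sup>2 * ?y\<^sup>2)"
      by simp
  qed
  also have "\<dots> = 2 * B * s + 3 * Q"
    by (simp add: sum.distrib sum_distrib_left s_def signal_def Q_def)
  finally have "noise / (M * s\<^sup>2) \<le> (2 * B * s + 3 * Q) / (M * s\<^sup>2)"
    using M s by (intro divide_right_mono) auto
  also have "\<dots> = 2 * B / (M * s) + 3 * Q / (M * s\<^sup>2)"
    using M s by (simp add: add_divide_distrib power2_eq_square)
  also have "\<dots> \<le> 2 * B / (M * \<eta>) + 3 * Q / (M * \<eta>\<^sup>2)"
    using M s \<eta>(1) B0 Q by (intro add_mono divide_left_mono mult_left_mono power_mono mult_pos_pos) auto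
  finally show ?thesis
    by (simp add: M_def Q_def s_def)
qed

text \<open>The sample splits at position \<open>2 * m\<close> into the pooled observations
  \<open>P1\<close> and the independent weight data \<open>P2\<close>. For each fixed value of the
  latter the fixed-weight bound applies, with \<eta> equal to \<open>\<epsilon>\<^sup>2\<close>;
  only the bound \<open>R\<close> on the noise ratio is then averaged. The term with 8 comes from
  \<open>2 * B\<close> at \<open>B = 4 * d1 * d2\<close>.\<close>

theorem type_II_error_le:
  assumes m: "2 \<le> m" and d: "1 \<le> d1" "1 \<le> d2" and p: "p \<in> P_alt d1 d2 \<epsilon>"
    and \<epsilon>: "0 < \<epsilon>" and \<delta>: "0 < \<delta>" and L: "1 \<le> L"
  shows "measure_pmf.prob (data_pmf (2 * m) p) {x. U_split (2 * m) d1 d2 x \<le> crit_value (2 * m) d1 d2 (exp (- L)) x}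
    \<le> 8 * \<delta> + (16 / \<delta> + 64 + 25600 * L\<^sup>2) *
      (8 * (real d1 * real d2) / ((real m)\<^sup>2 * \<epsilon>\<^sup>2) + 3 * ((4 * (real d1)\<^sup>2 / (real (min m d1) + 1)) *
          (4 * (real d2)\<^sup>2 / (real (min m d2) + 1))) / ((real m)\<^sup>2 * \<epsilon> ^ 4))"
proof -
  define q where "q = prod_of_marginals p"
  define pY where "pY = map_pmf fst p"
  define pZ where "pZ = map_pmf snd p"
  let ?K = "{1..d1} \<times> {1..d2}" and ?I1 = "{1..2 * m}" and ?I2 = "{2 * m<..3 * m}"
  let ?law = "\<lambda>i. if i \<le> m then p else q"
  define J where "J = (\<lambda>d. {2 * m + 1..2 * m + min m d})"
  define P1 where "P1 = Pi_pmf ?I1 (0, 0) ?law"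
  define P2 where "P2 = Pi_pmf ?I2 (0, 0) (\<lambda>_. q)"
  define cv where "cv = (\<lambda>X. quantile (map_pmf (test_stat m d1 d2 X) (pmf_of_set (perms (2 * m)))) (exp (- L)))"
  define merge where "merge = (\<lambda>x w (i :: nat). if i \<in> ?I1 then x i else w i :: nat \<times> nat)"
  have suppp: "set_pmf p \<subseteq> ?K"
    using p by (auto simp: P_alt_def P_Multi_def)
  have suppY: "set_pmf pY \<subseteq> {1..d1}" and suppZ: "set_pmf pZ \<subseteq> {1..d2}"
    using suppp by (auto simp: pY_def pZ_def)
  have q: "q = pair_pmf pY pZ"
    by (simp add: q_def pY_def pZ_def prod_of_marginals_def)
  then have suppq: "set_pmf q \<subseteq> ?K"
    using suppY suppZ by auto
  have finp: "finite (set_pmf p)" "finite (set_pmf q)" "finite (set_pmf pY)" "finite (set_pmf pZ)"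
    using suppp suppq suppY suppZ by (meson finite_subset finite_SigmaI finite_atLeastAtMost)+
  have fin1: "finite (set_pmf P1)" and fin2: "finite (set_pmf P2)"
    unfolding P1_def P2_def using finp by (auto intro!: finite_set_Pi_pmf)
  have J: "finite (J d)" "card (J d) = min m d" "J d \<subseteq> ?I2" for d
    by (auto simp: J_def)
  have Jne: "J d \<noteq> {}" if "1 \<le> d" for d
    using that m by (simp add: J_def)
  define QY where "QY = (\<lambda>y. \<Sum>k=1..d1. (pmf pY k)\<^sup>2 / (smoothed_freq d1 (J d1) y k)\<^sup>2)"
  define QZ where "QZ = (\<lambda>z. \<Sum>k=1..d2. (pmf pZ k)\<^sup>2 / (smoothed_freq d2 (J d2) z k)\<^sup>2)"
  define R where "R = (\<lambda>w. 8 * (real d1 * real d2) / ((real m)\<^sup>2 * \<epsilon>\<^sup>2)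
      + 3 / ((real m)\<^sup>2 * \<epsilon> ^ 4) * (QY (\<lambda>i. fst (w i)) * QZ (\<lambda>i. snd (w i))))"
  define A where "A = 16 / \<delta> + 64 + 25600 * L\<^sup>2"
  have A: "0 \<le> A"
    using \<delta> by (simp add: A_def)

  have "measure_pmf.prob (data_pmf (2 * m) p) {x. U_split (2 * m) d1 d2 x \<le> crit_value (2 * m) d1 d2 (exp (- L)) x}
    = measure_pmf.prob (map_pmf (sample m) (data_pmf (2 * m) p)) {X. test_stat m d1 d2 X id \<le> cv X}"
    by (simp add: measure_map_pmf vimage_def U_split_eq[OF m] crit_value_eq[OF m] cv_def)
  also have "map_pmf (sample m) (data_pmf (2 * m) p) = map_pmf (\<lambda>(x, w). merge x w) (pair_pmf P1 P2)"
  proof -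
    have "{1..3 * m} = ?I1 \<union> ?I2"
      by auto
    then have "map_pmf (sample m) (data_pmf (2 * m) p) = Pi_pmf (?I1 \<union> ?I2) (0, 0) ?law"
      unfolding map_sample_data_pmf q_def by simp
    also have "\<dots> = map_pmf (\<lambda>(x, w). merge x w) (pair_pmf P1 (Pi_pmf ?I2 (0, 0) ?law))"
      unfolding merge_def P1_def by (rule Pi_pmf_union) auto
    also have "Pi_pmf ?I2 (0, 0) ?law = P2"
      unfolding P2_def by (intro Pi_pmf_cong) auto
    finally show ?thesis .
  qed
  also have "measure_pmf.prob \<dots> {X. test_stat m d1 d2 X id \<le> cv X}
    = expct P2 (\<lambda>w. measure_pmf.prob P1 {x. test_stat m d1 d2 (merge x w) id \<le> cv (merge x w)})"
    unfolding expct_of_bool[symmetric]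
    by (simp add: expct_pair[OF fin1 fin2] split_def expct_swap[OF fin2 fin1])
  also have "\<dots> \<le> expct P2 (\<lambda>w. 8 * \<delta> + A * R w)"
  proof (rule expct_mono[OF fin2])
    fix w assume w: "w \<in> set_pmf P2"
    have wK: "w i \<in> ?K" if "i \<in> ?I2" for i
      using w that suppq by (auto simp: P2_def set_Pi_pmf PiE_dflt_def)
    let ?V = "inv_weight m d1 d2 w"
    define a where "a = smoothed_freq d1 (J d1) (\<lambda>i. fst (w i))"
    define b where "b = smoothed_freq d2 (J d2) (\<lambda>i. snd (w i))"
    have ab: "0 < a k1" "0 < b k2" for k1 k2
      unfolding a_def b_def using d by (simp_all add: smoothed_freq_pos)
    have V: "?V k = inverse (a (fst k) * b (snd k))" if "k \<in> ?K" for k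
      using that unfolding inv_weight_def a_def b_def J_def by simp
    interpret two_samples p q ?K ?V m "(0, 0)"
    proof
      show "0 \<le> ?V k" for k
      proof (cases "k \<in> ?K")
        case True
        show ?thesis
          unfolding V[OF True] using ab by (simp add: less_imp_le)
      next
        case False
        then show ?thesis
          by (simp only: inv_weight_def if_False order_refl)
      qed
    qed (use suppp suppq m in auto)
    have mw: "inv_weight m d1 d2 (merge x w) = ?V" for x
      by (intro inv_weight_cong) (auto simp: merge_def)
    have ts: "test_stat m d1 d2 (merge x w) \<pi> = U (x \<circ> \<pi>)" if "\<pi> \<in> perms (2 * m)" for x \<pi>
    proof -
      have "(merge x w \<circ> \<pi>) a = (x \<circ> \<pi>) a" if "a \<in> ?I1" for a
        using \<open>\<pi> \<in> perms (2 * m)\<close> permutes_in_image[of \<pi> ?I1 a] that by (simp add: merge_def perms_def)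
      then show ?thesis
        unfolding test_stat_def U_def mw collision_form_def by (intro sum.cong refl) auto
    qed
    have "id \<in> perms (2 * m)"
      by (simp add: perms_def permutes_id)
    then have tsid: "test_stat m d1 d2 (merge x w) id = U x" for x
      using ts[of id x] by simp
    have cr: "cv (merge x w) = crit (exp (- L)) x" for x
    proof -
      have "map_pmf (test_stat m d1 d2 (merge x w)) (pmf_of_set (perms (2 * m)))
        = map_pmf (\<lambda>\<pi>. U (x \<circ> \<pi>)) (pmf_of_set (perms (2 * m)))"
        using ts by (intro map_pmf_cong) auto
      then show ?thesis
        by (simp add: cv_def crit_def)
    qed
    have P1: "P1 = joint"
      unfolding P1_def law_def ..
    have sumab: "(\<Sum>k\<in>?K. a (fst k) * b (snd k)) = 1"
    proof -
      have "(\<Sum>k\<in>?K. a (fst k) * b (snd k)) = (\<Sum>k=1..d1. a k) * (\<Sum>k=1..d2. b k)"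
        by (simp add: sum_product sum.cartesian_product split_def)
      also have "(\<Sum>k=1..d1. a k) = 1"
        unfolding a_def using J Jne d wK by (intro sum_smoothed_freq) (auto simp: mem_Times_iff subset_iff)
      also have "(\<Sum>k=1..d2. b k) = 1"
        unfolding b_def using J Jne d wK by (intro sum_smoothed_freq) (auto simp: mem_Times_iff subset_iff)
      finally show ?thesis by simp
    qed
    have S: "\<epsilon>\<^sup>2 \<le> signal"
    proof -
      have "\<epsilon> \<le> (\<Sum>k\<in>?K. \<bar>pmf p k - pmf q k\<bar>)"
        using p by (simp add: P_alt_def l1_dist_def sum.cartesian_product split_def q_def)
      then have "\<epsilon>\<^sup>2 \<le> (\<Sum>k\<in>?K. \<bar>pmf p k - pmf q k\<bar>)\<^sup>2"
        using \<epsilon> by (intro power_mono) auto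
      also have "\<dots> \<le> (\<Sum>k\<in>?K. inverse (a (fst k) * b (snd k)) * (pmf p k - pmf q k)\<^sup>2)"
        using sumab ab by (intro weighted_Cauchy_Schwarz) auto
      also have "\<dots> = signal"
        unfolding signal_def by (intro sum.cong refl) (simp only: V)
      finally show ?thesis .
    qed
    have B: "?V k \<le> 4 * (real d1 * real d2)" if "k \<in> ?K" for k
    proof -
      have "1 / (2 * real d1) * (1 / (2 * real d2)) \<le> a (fst k) * b (snd k)"
        unfolding a_def b_def by (intro mult_mono smoothed_freq_ge) (use d ab[unfolded a_def b_def] in \<open>auto simp: less_imp_le\<close>)
      then have "inverse (a (fst k) * b (snd k)) \<le> inverse (1 / (2 * real d1) * (1 / (2 * real d2)))"
        using d by (intro le_imp_inverse_le) auto
      then show ?thesis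
        unfolding V[OF that] by simp
    qed
    have Q: "(\<Sum>k\<in>?K. (?V k)\<^sup>2 * (pmf q k)\<^sup>2) = QY (\<lambda>i. fst (w i)) * QZ (\<lambda>i. snd (w i))"
    proof -
      have "(\<Sum>k\<in>?K. (?V k)\<^sup>2 * (pmf q k)\<^sup>2) = (\<Sum>(k1, k2)\<in>?K. ((pmf pY k1)\<^sup>2 / (a k1)\<^sup>2) * ((pmf pZ k2)\<^sup>2 / (b k2)\<^sup>2))"
      proof (rule sum.cong[OF refl])
        fix k assume k: "k \<in> ?K"
        obtain k1 k2 where kk: "k = (k1, k2)"
          by fastforce
        show "(?V k)\<^sup>2 * (pmf q k)\<^sup>2 = (case k of (k1, k2) \<Rightarrow> ((pmf pY k1)\<^sup>2 / (a k1)\<^sup>2) * ((pmf pZ k2)\<^sup>2 / (b k2)\<^sup>2))"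
          using V[OF k] unfolding kk q fst_conv snd_conv
          by (simp only: pmf_pair power_mult_distrib power_inverse divide_inverse inverse_mult_distrib case_prod_conv mult_ac)
      qed
      then show ?thesis
        by (simp add: QY_def QZ_def a_def b_def sum_product sum.cartesian_product)
    qed
    have "measure_pmf.prob P1 {x. test_stat m d1 d2 (merge x w) id \<le> cv (merge x w)}
      \<le> 8 * \<delta> + A * (noise / ((real m)\<^sup>2 * signal\<^sup>2))"
      unfolding tsid cr P1 A_def using S \<epsilon> by (intro type_II_le \<delta> L) (smt (verit) zero_less_power)
    also have "noise / ((real m)\<^sup>2 * signal\<^sup>2) \<le> R w"
    proof -
      have "noise / ((real m)\<^sup>2 * signal\<^sup>2) \<le> 2 * (4 * (real d1 * real d2)) / ((real m)\<^sup>2 * \<epsilon>\<^sup>2)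
        + 3 * (\<Sum>k\<in>?K. (?V k)\<^sup>2 * (pmf q k)\<^sup>2) / ((real m)\<^sup>2 * (\<epsilon>\<^sup>2)\<^sup>2)"
        by (rule noise_ratio_le) (use B S \<epsilon> in auto)
      then show ?thesis
        unfolding Q R_def by (simp flip: power_mult)
    qed
    finally show "measure_pmf.prob P1 {x. test_stat m d1 d2 (merge x w) id \<le> cv (merge x w)} \<le> 8 * \<delta> + A * R w"
      using A by (simp add: mult_left_mono)
  qed
  also have "\<dots> = 8 * \<delta> + A * expct P2 R"
    by (simp add: expct_add[OF fin2])
  also have "expct P2 R = 8 * (real d1 * real d2) / ((real m)\<^sup>2 * \<epsilon>\<^sup>2)
      + 3 / ((real m)\<^sup>2 * \<epsilon> ^ 4) * expct P2 (\<lambda>w. QY (\<lambda>i. fst (w i)) * QZ (\<lambda>i. snd (w i)))"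
    unfolding R_def expct_add[OF fin2] by simp
  also have "expct P2 (\<lambda>w. QY (\<lambda>i. fst (w i)) * QZ (\<lambda>i. snd (w i)))
    = expct (Pi_pmf ?I2 0 (\<lambda>_. pY)) QY * expct (Pi_pmf ?I2 0 (\<lambda>_. pZ)) QZ"
    unfolding P2_def q by (subst expct_Pi_pair) (auto simp: finp)
  also have "\<dots> \<le> (4 * (real d1)\<^sup>2 / (real (min m d1) + 1)) * (4 * (real d2)\<^sup>2 / (real (min m d2) + 1))"
  proof (rule mult_mono)
    show "expct (Pi_pmf ?I2 0 (\<lambda>_. pY)) QY \<le> 4 * (real d1)\<^sup>2 / (real (min m d1) + 1)"
      unfolding QY_def J(2)[symmetric] using J Jne d suppY by (intro expct_sum_sq_ratio_le) auto
    show "expct (Pi_pmf ?I2 0 (\<lambda>_. pZ)) QZ \<le> 4 * (real d2)\<^sup>2 / (real (min m d2) + 1)"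
      unfolding QZ_def J(2)[symmetric] using J Jne d suppZ by (intro expct_sum_sq_ratio_le) auto
    show "0 \<le> expct (Pi_pmf ?I2 0 (\<lambda>_. pZ)) QZ"
      unfolding QZ_def by (intro integral_nonneg_AE) (auto intro!: sum_nonneg)
  qed auto
  finally show ?thesis
    using A \<epsilon> m unfolding A_def by (simp add: mult_left_mono divide_right_mono mult_ac)
qed

section \<open>The separation condition and the constants\<close>

lemma l1_dist_le_2:
  assumes "p \<in> P_Multi d1 d2"
  shows "l1_dist d1 d2 p (prod_of_marginals p) \<le> 2"
proof -
  let ?q = "prod_of_marginals p" and ?K = "{1..d1} \<times> {1..d2}"
  have "l1_dist d1 d2 p ?q = (\<Sum>k\<in>?K. \<bar>pmf p k - pmf ?q k\<bar>)"
    by (simp add: l1_dist_def sum.cartesian_product split_def)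
  also have "\<dots> \<le> (\<Sum>k\<in>?K. pmf p k + pmf ?q k)"
    by (intro sum_mono) (simp add: abs_le_iff add_increasing add_increasing2)
  also have "\<dots> = (\<Sum>k\<in>?K. pmf p k) + (\<Sum>k\<in>?K. pmf ?q k)"
    by (rule sum.distrib)
  also have "(\<Sum>k\<in>?K. pmf p k) = 1"
    using assms by (intro sum_pmf_eq_1) (auto simp: P_Multi_def)
  also have "(\<Sum>k\<in>?K. pmf ?q k) = 1"
    using assms by (intro sum_pmf_eq_1) (auto simp: P_Multi_def prod_of_marginals_def)
  finally show ?thesis
    by simp
qed

lemma powr_mult_nat: "0 < x \<Longrightarrow> (x powr a) ^ k = x powr (a * real k)" for x :: real
  by (simp add: powr_power mult.commute)

text \<open>The fourth power clears all roots, and \<open>\<epsilon> ^ 4\<close> is the natural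
  scale: the signal is at least \<open>\<epsilon>\<^sup>2\<close> and enters the type II bound
  squared. There is one conclusion for each term of the maximum.\<close>

lemma separation_pow4:
  fixes d1 d2 n :: nat and \<beta> L \<epsilon> :: real
  assumes d: "1 \<le> d1" "1 \<le> d2" "1 \<le> n" and \<beta>: "0 < \<beta>" and L: "0 \<le> L"
    and \<epsilon>: "\<epsilon> \<ge> 200 / \<beta> powr (3/4) * sqrt L *
            max (real d1 powr (1/4) * real d2 powr (1/2) / real n powr (3/4))
                (real d1 powr (1/4) * real d2 powr (1/4) / real n powr (1/2))"
  shows "200 ^ 4 * (L\<^sup>2 / \<beta> ^ 3) * (real d1 * (real d2)\<^sup>2 / real n ^ 3) \<le> \<epsilon> ^ 4"
    and "200 ^ 4 * (L\<^sup>2 / \<beta> ^ 3) * (real d1 * real d2 / (real n)\<^sup>2) \<le> \<epsilon> ^ 4"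
proof -
  define c where "c = 200 / \<beta> powr (3/4) * sqrt L"
  have c: "0 \<le> c"
    using L by (simp add: c_def)
  have c4: "c ^ 4 = 200 ^ 4 * (L\<^sup>2 / \<beta> ^ 3)"
  proof -
    have "sqrt L ^ 4 = (sqrt L ^ 2) ^ 2"
      by (simp flip: power_mult)
    then show ?thesis
      using \<beta> L by (simp add: c_def power_mult_distrib power_divide powr_mult_nat powr_numeral)
  qed
  have le: "c ^ 4 * t ^ 4 \<le> \<epsilon> ^ 4" if "0 \<le> t" "t \<le> max (real d1 powr (1/4) * real d2 powr (1/2) / real n powr (3/4))
                (real d1 powr (1/4) * real d2 powr (1/4) / real n powr (1/2))" for t
  proof -
    have "c * t \<le> \<epsilon>"
      using mult_left_mono[OF that(2) c] \<epsilon> by (simp add: c_def)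
    then show ?thesis
      unfolding power_mult_distrib[symmetric] using c that(1) by (intro power_mono) auto
  qed
  have eq: "(real d1 powr (1/4) * real d2 powr (1/2) / real n powr (3/4)) ^ 4 = real d1 * (real d2)\<^sup>2 / real n ^ 3"
    using d by (simp add: power_mult_distrib power_divide powr_mult_nat powr_numeral)
  from le[of "real d1 powr (1/4) * real d2 powr (1/2) / real n powr (3/4)", unfolded eq c4]
  show "200 ^ 4 * (L\<^sup>2 / \<beta> ^ 3) * (real d1 * (real d2)\<^sup>2 / real n ^ 3) \<le> \<epsilon> ^ 4"
    by simp
  have eq: "(real d1 powr (1/4) * real d2 powr (1/4) / real n powr (1/2)) ^ 4 = real d1 * real d2 / (real n)\<^sup>2"
    using d by (simp add: power_mult_distrib power_divide powr_mult_nat powr_numeral)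
  from le[of "real d1 powr (1/4) * real d2 powr (1/4) / real n powr (1/2)", unfolded eq c4]
  show "200 ^ 4 * (L\<^sup>2 / \<beta> ^ 3) * (real d1 * real d2 / (real n)\<^sup>2) \<le> \<epsilon> ^ 4"
    by simp
qed

text \<open>The choice \<open>\<delta> = \<beta> / 32\<close> spends \<open>\<beta> / 4\<close> on
  \<open>8 * \<delta>\<close> and makes \<open>16 / \<delta>\<close> equal to
  \<open>512 / \<beta>\<close>, so the product has to stay below \<open>3 / 4 * \<beta>\<close>. In
  the proof 1600000000 is \<open>200 ^ 4\<close>.\<close>

lemma type_II_bound_small:
  fixes d1 d2 m :: nat and \<beta> L \<epsilon> :: real
  assumes m: "2 \<le> m" and d: "1 \<le> d1" "d1 \<le> d2" and \<beta>: "0 < \<beta>" "\<beta> < 1" and L: "1 \<le> L"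
    and \<epsilon>: "0 < \<epsilon>" "\<epsilon> \<le> 2"
    and e1: "200 ^ 4 * (L\<^sup>2 / \<beta> ^ 3) * (real d1 * (real d2)\<^sup>2 / real (2 * m) ^ 3) \<le> \<epsilon> ^ 4"
    and e2: "200 ^ 4 * (L\<^sup>2 / \<beta> ^ 3) * (real d1 * real d2 / (real (2 * m))\<^sup>2) \<le> \<epsilon> ^ 4"
  shows "8 * (\<beta> / 32) + (16 / (\<beta> / 32) + 64 + 25600 * L\<^sup>2) *
      (8 * (real d1 * real d2) / ((real m)\<^sup>2 * \<epsilon>\<^sup>2) + 3 * ((4 * (real d1)\<^sup>2 / (real (min m d1) + 1)) *
          (4 * (real d2)\<^sup>2 / (real (min m d2) + 1))) / ((real m)\<^sup>2 * \<epsilon> ^ 4)) \<le> \<beta>"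
proof -
  define x where "x = real d1"
  define y where "y = real d2"
  define M where "M = real m"
  define \<kappa> where "\<kappa> = L\<^sup>2 / \<beta> ^ 3"
  have pos: "1 \<le> x" "x \<le> y" "2 \<le> M" "0 < \<epsilon> ^ 4"
    using d m \<epsilon> by (auto simp: x_def y_def M_def)
  have "\<beta> ^ 3 \<le> 1"
    using \<beta> by (intro power_le_one) auto
  moreover have L2: "1 \<le> L\<^sup>2"
    using L by simp
  ultimately have \<kappa>: "1 \<le> \<kappa>"
    using \<beta> by (simp add: \<kappa>_def field_simps)
  have E1: "1600000000 * \<kappa> * (x * y\<^sup>2 / (8 * M ^ 3)) \<le> \<epsilon> ^ 4"
    using e1 by (simp add: x_def y_def M_def \<kappa>_def power_mult_distrib)
  have E2: "1600000000 * \<kappa> * (x * y / (4 * M\<^sup>2)) \<le> \<epsilon> ^ 4"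
    using e2 by (simp add: x_def y_def M_def \<kappa>_def power_mult_distrib)
  \<comment> \<open>\<open>\<epsilon> \<le> 2\<close> and the separation condition leave no room for \<open>d1 > n / 2\<close>.\<close>
  have xM: "x \<le> M"
  proof -
    have "x ^ 3 \<le> x * y\<^sup>2"
      using pos by (simp add: power3_eq_cube power2_eq_square mult_mono)
    then have "x ^ 3 / (8 * M ^ 3) \<le> x * y\<^sup>2 / (8 * M ^ 3)"
      using pos by (intro divide_right_mono) auto
    also have "\<dots> \<le> \<kappa> * (x * y\<^sup>2 / (8 * M ^ 3))"
      using \<kappa> pos mult_right_mono[of 1 \<kappa> "x * y\<^sup>2 / (8 * M ^ 3)"] by simp
    also have "1600000000 * \<dots> \<le> 2 ^ 4"
      using E1 power_mono[of \<epsilon> 2 4] \<epsilon> by (simp add: mult.assoc)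
    finally have "x ^ 3 / (8 * M ^ 3) \<le> 1 / 8"
      by simp
    then have "x ^ 3 \<le> M ^ 3"
      using pos by (simp add: field_simps)
    then show ?thesis
      using pos by (intro power_le_imp_le_base[of x 2 M]) auto
  qed
  then have m1: "min m d1 = d1"
    by (simp add: x_def M_def)
  have F1: "x * y\<^sup>2 / M ^ 3 / \<epsilon> ^ 4 \<le> 8 / (1600000000 * \<kappa>)"
    using E1 pos \<kappa> by (simp add: field_simps)
  have F2: "x * y / M\<^sup>2 / \<epsilon> ^ 4 \<le> 4 / (1600000000 * \<kappa>)"
    using E2 pos \<kappa> by (simp add: field_simps)
  have sq: "4 * z\<^sup>2 / (z + 1) \<le> 4 * z" if "1 \<le> z" for z :: real
    using that by (simp add: field_simps power2_eq_square)
  define W where "W = real (min m d2) + 1"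
  have W: "0 < W"
    by (simp add: W_def)
  \<comment> \<open>Here only \<open>\<epsilon>\<^sup>2\<close> is in the denominator;
    \<open>\<epsilon> \<le> 2\<close> gives
    \<open>1 / \<epsilon>\<^sup>2 \<le> 4 / \<epsilon> ^ 4\<close>, and \<open>F2\<close>
    applies.\<close>
  have "8 * (x * y) / (M\<^sup>2 * \<epsilon>\<^sup>2) \<le> 128 / (1600000000 * \<kappa>)"
  proof -
    have "\<epsilon> ^ 4 = \<epsilon>\<^sup>2 * \<epsilon>\<^sup>2"
      by (simp flip: power_add)
    moreover have "\<epsilon>\<^sup>2 \<le> 2\<^sup>2"
      using \<epsilon> by (intro power_mono) auto
    then have "\<epsilon>\<^sup>2 * \<epsilon>\<^sup>2 \<le> 4 * \<epsilon>\<^sup>2"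
      by (intro mult_right_mono) auto
    ultimately have "\<epsilon> ^ 4 \<le> 4 * \<epsilon>\<^sup>2"
      by simp
    then have "1 / \<epsilon>\<^sup>2 \<le> 4 / \<epsilon> ^ 4"
      using \<epsilon> pos by (simp add: field_simps)
    then have "8 * (x * y / M\<^sup>2) * (1 / \<epsilon>\<^sup>2) \<le> 8 * (x * y / M\<^sup>2) * (4 / \<epsilon> ^ 4)"
      using pos by (intro mult_left_mono) auto
    also have "\<dots> = 32 * (x * y / M\<^sup>2 / \<epsilon> ^ 4)"
      by simp
    finally show ?thesis
      using F2 by simp
  qed
  moreover have "3 * ((4 * x\<^sup>2 / (x + 1)) * (4 * y\<^sup>2 / W)) / (M\<^sup>2 * \<epsilon> ^ 4) \<le> 384 / (1600000000 * \<kappa>)"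
  proof -
    have "3 * ((4 * x\<^sup>2 / (x + 1)) * (4 * y\<^sup>2 / W)) / (M\<^sup>2 * \<epsilon> ^ 4)
      \<le> 3 * (4 * x * (4 * y\<^sup>2 / W)) / (M\<^sup>2 * \<epsilon> ^ 4)"
      using pos W sq[of x] by (intro divide_right_mono mult_left_mono mult_right_mono) auto
    also have "\<dots> \<le> 384 / (1600000000 * \<kappa>)"
    \<comment> \<open>If \<open>d2 \<le> m\<close>, the factor for \<open>d2\<close> is at most
      \<open>4 * y\<close> and \<open>F2\<close> suffices; otherwise it is at most
      \<open>4 * y\<^sup>2 / M\<close>, which calls for \<open>F1\<close>.\<close>
    proof (cases "d2 \<le> m")
      case True
      then have "W = y + 1"
        by (simp add: W_def y_def)
      then have "3 * (4 * x * (4 * y\<^sup>2 / W)) / (M\<^sup>2 * \<epsilon> ^ 4) \<le> 3 * (4 * x * (4 * y)) / (M\<^sup>2 * \<epsilon> ^ 4)"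
        using pos sq[of y] by (intro divide_right_mono mult_left_mono) auto
      also have "\<dots> = 48 * (x * y / M\<^sup>2 / \<epsilon> ^ 4)"
        by simp
      also have "\<dots> \<le> 48 * (4 / (1600000000 * \<kappa>))"
        using F2 by (intro mult_left_mono) auto
      also have "\<dots> \<le> 384 / (1600000000 * \<kappa>)"
        using \<kappa> by (simp add: field_simps)
      finally show ?thesis .
    next
      case False
      then have "M \<le> W"
        by (simp add: W_def M_def)
      then have "4 * y\<^sup>2 / W \<le> 4 * y\<^sup>2 / M"
        using pos by (intro divide_left_mono) auto
      then have "3 * (4 * x * (4 * y\<^sup>2 / W)) / (M\<^sup>2 * \<epsilon> ^ 4) \<le> 3 * (4 * x * (4 * y\<^sup>2 / M)) / (M\<^sup>2 * \<epsilon> ^ 4)"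
        using pos by (intro divide_right_mono mult_left_mono) auto
      also have "\<dots> = 48 * (x * y\<^sup>2 / M ^ 3 / \<epsilon> ^ 4)"
        by (simp add: power3_eq_cube power2_eq_square)
      also have "\<dots> \<le> 48 * (8 / (1600000000 * \<kappa>))"
        using F1 by (intro mult_left_mono) auto
      finally show ?thesis by simp
    qed
    finally show ?thesis .
  qed
  ultimately have Z: "8 * (x * y) / (M\<^sup>2 * \<epsilon>\<^sup>2) + 3 * ((4 * x\<^sup>2 / (x + 1)) * (4 * y\<^sup>2 / W)) / (M\<^sup>2 * \<epsilon> ^ 4)
      \<le> 512 / (1600000000 * \<kappa>)" (is "?Z \<le> _")
    by simp
  \<comment> \<open>Here 26176 = 512 + 64 + 25600, after each term is enlarged to a multiple of
    \<open>L\<^sup>2 / \<beta>\<close>.\<close>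
  have A: "512 / \<beta> + 64 + 25600 * L\<^sup>2 \<le> 26176 * L\<^sup>2 / \<beta>"
  proof -
    have "512 / \<beta> \<le> 512 * L\<^sup>2 / \<beta>" "64 \<le> 64 * L\<^sup>2 / \<beta>" "25600 * L\<^sup>2 \<le> 25600 * L\<^sup>2 / \<beta>"
      using L2 \<beta> mult_left_mono[of \<beta> 1 "L\<^sup>2"] by (auto simp: field_simps)
    then show ?thesis
      by (simp add: add_divide_distrib)
  qed
  have "(512 / \<beta> + 64 + 25600 * L\<^sup>2) * ?Z \<le> (26176 * L\<^sup>2 / \<beta>) * (512 / (1600000000 * \<kappa>))"
    using pos \<beta> W by (intro mult_mono A Z) (auto intro!: add_nonneg_nonneg divide_nonneg_nonneg mult_nonneg_nonneg)
  \<comment> \<open>\<kappa> cancels \<open>L\<^sup>2\<close> and turns \<open>1 / \<beta>\<close>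
    into \<open>\<beta>\<^sup>2\<close>, of which one factor is then bounded by 1.\<close>
  also have "\<dots> = 26176 * 512 / 1600000000 * \<beta>\<^sup>2"
    using \<beta> L by (simp add: \<kappa>_def power2_eq_square power3_eq_cube)
  also have "\<dots> \<le> 3 / 4 * \<beta>"
    using \<beta> by (simp add: power2_eq_square)
  finally have "(512 / \<beta> + 64 + 25600 * L\<^sup>2) * ?Z \<le> 3 / 4 * \<beta>" .
  then show ?thesis
    unfolding m1 x_def[symmetric] y_def[symmetric] M_def[symmetric] W_def[symmetric] by simp
qed

theorem proposition8p3:
  "\<exists>C::real. C > 0 \<and>
    (\<forall>(d1::nat) (d2::nat) (n::nat) (\<alpha>::real) (\<beta>::real) (\<epsilon>::real).
      1 \<le> d1 \<longrightarrow> d1 \<le> d2 \<longrightarrow> even n \<longrightarrow> 4 \<le> n \<longrightarrow>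
      0 < \<alpha> \<longrightarrow> \<alpha> < exp (- 1) \<longrightarrow> 0 < \<beta> \<longrightarrow> \<beta> < 1 - \<alpha> \<longrightarrow>
      \<epsilon> \<ge> C / \<beta> powr (3/4) * sqrt (ln (1 / \<alpha>)) *
            max (real d1 powr (1/4) * real d2 powr (1/2) / real n powr (3/4))
                (real d1 powr (1/4) * real d2 powr (1/4) / real n powr (1/2)) \<longrightarrow>
      (SUP p \<in> P_null d1 d2.
         emeasure (measure_pmf (data_pmf n p)) {x. U_split n d1 d2 x > crit_value n d1 d2 \<alpha> x})
        \<le> ennreal \<alpha> \<and>
      (SUP p \<in> P_alt d1 d2 \<epsilon>.
         emeasure (measure_pmf (data_pmf n p)) {x. U_split n d1 d2 x \<le> crit_value n d1 d2 \<alpha> x})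
        \<le> ennreal \<beta>)"
proof (intro exI[of _ 200] conjI allI impI)
  show "(0 :: real) < 200"
    by simp
next
  fix d1 d2 n :: nat and \<alpha> \<beta> \<epsilon> :: real
  assume d: "1 \<le> d1" "d1 \<le> d2" and n: "even n" "4 \<le> n"
    and \<alpha>: "0 < \<alpha>" "\<alpha> < exp (- 1)" and \<beta>: "0 < \<beta>" "\<beta> < 1 - \<alpha>"
    and \<epsilon>: "\<epsilon> \<ge> 200 / \<beta> powr (3/4) * sqrt (ln (1 / \<alpha>)) *
            max (real d1 powr (1/4) * real d2 powr (1/2) / real n powr (3/4))
                (real d1 powr (1/4) * real d2 powr (1/4) / real n powr (1/2))"
  obtain m where nm: "n = 2 * m"
    using n by (elim evenE)
  have m: "2 \<le> m"
    using n nm by simp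
  define L where "L = ln (1 / \<alpha>)"
  have ln: "ln \<alpha> < - 1"
    using \<alpha> ln_less_cancel_iff[of \<alpha> "exp (- 1)"] by simp
  \<comment> \<open>This is where \<open>\<alpha> < exp (- 1)\<close> enters: with
    \<open>1 \<le> L\<close> the tail bound absorbs its additive remainder and its moment constant
    into multiples of \<open>L\<close>.\<close>
  then have L: "1 \<le> L" and eL: "exp (- L) = \<alpha>"
    using \<alpha> by (simp_all add: L_def ln_div)
  have "exp (- 1 :: real) < 1"
    by simp
  then have \<alpha>1: "\<alpha> < 1"
    using \<alpha> by linarith
  show "(SUP p \<in> P_null d1 d2.
      emeasure (measure_pmf (data_pmf n p)) {x. U_split n d1 d2 x > crit_value n d1 d2 \<alpha> x}) \<le> ennreal \<alpha>"
    unfolding nm by (intro SUP_least type_I_error m \<alpha>(1) \<alpha>1)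
  show "(SUP p \<in> P_alt d1 d2 \<epsilon>.
      emeasure (measure_pmf (data_pmf n p)) {x. U_split n d1 d2 x \<le> crit_value n d1 d2 \<alpha> x}) \<le> ennreal \<beta>"
  proof (rule SUP_least)
    fix p assume p: "p \<in> P_alt d1 d2 \<epsilon>"
    have d2: "1 \<le> d2" and n1: "1 \<le> n" and \<beta>1: "\<beta> < 1" and L0: "0 \<le> L"
      using d n \<alpha> \<beta> L by auto
    \<comment> \<open>The existence of \<open>p\<close> in the alternative bounds \<epsilon>, and
      this upper bound is what later forces \<open>d1 \<le> m\<close>.\<close>
    have \<epsilon>2: "\<epsilon> \<le> 2"
      using p l1_dist_le_2[of p d1 d2] by (auto simp: P_alt_def)
    have "0 < 200 / \<beta> powr (3/4) * sqrt (ln (1 / \<alpha>)) *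
            max (real d1 powr (1/4) * real d2 powr (1/2) / real n powr (3/4))
                (real d1 powr (1/4) * real d2 powr (1/4) / real n powr (1/2))"
      using d d2 n1 \<beta> L unfolding L_def[symmetric] by (intro mult_pos_pos) (auto simp: less_max_iff_disj)
    then have \<epsilon>0: "0 < \<epsilon>"
      using \<epsilon> by linarith
    note sep = separation_pow4[OF d(1) d2 n1 \<beta>(1) L0 \<epsilon>[folded L_def], unfolded nm]
    have "measure_pmf.prob (data_pmf n p) {x. U_split n d1 d2 x \<le> crit_value n d1 d2 \<alpha> x} \<le> \<beta>"
      unfolding nm eL[symmetric]
      using type_II_error_le[OF m d(1) d2 p \<epsilon>0 _ L, of "\<beta> / 32"]
        type_II_bound_small[OF m d \<beta>(1) \<beta>1 L \<epsilon>0 \<epsilon>2 sep] \<beta>(1) by linarith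
    then show "emeasure (measure_pmf (data_pmf n p)) {x. U_split n d1 d2 x \<le> crit_value n d1 d2 \<alpha> x} \<le> ennreal \<beta>"
      by (simp add: measure_pmf.emeasure_eq_measure ennreal_leI)
  qed
qed

end
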